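(* Let $\lambda$ be Haar measure on $\mathbb T^d=\mathbb R^d/\mathbb Z^d$, and for $\alpha\in\mathbb T^d$ let $T_\alpha x=x+\alpha$. For $x,y\in\mathbb T^d$ let $d_n^{(r)}(x,y)$ be the $r$-th smallest among $d(x,T_\alpha y),\dots,d(x,T_\alpha^ny)$. Then for $\lambda$-a.e. $\alpha\in\mathbb T^d$ the following hold. (a) For $\lambda$-a.e. $x$ and $\lambda$-a.e. $y$ (for all $x$ in a set of full measure, for a.e. $y$), $$\limsup_{n\to\infty}\frac{|\ln d_n^{(1)}(x,y)|-\frac1d\ln n}{\ln\ln n}=\frac1d,$$ and for every $r\ge2$, for $\lambda$-a.e. $x$ and $\lambda$-a.e. $y$, $$\limsup_{n\to\infty}\frac{|\ln d_n^{(r)}(x,y)|-\frac1d\ln n}{\ln\ln n}=\frac1{2d}.$$ (b) For every $r\ge1$ and every $x\in\mathbb T^d$, $$\limsup_{n\to\infty}\frac{|\ln d_n^{(r)}(x,x)|-\frac1d\ln n}{\ln\ln n}=\frac1d.$$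
   Context: $d(\cdot,\cdot)$ is the standard flat distance on $\mathbb T^d$. *)

theory Defs
  imports "HOL-Probability.Probability"
begin

section \<open>The flat torus\<close>

definition int_lattice_rel :: "real ^ 'd \<Rightarrow> real ^ 'd \<Rightarrow> bool" where
  "int_lattice_rel u v \<longleftrightarrow> (\<forall>i. u $ i - v $ i \<in> \<int>)"

quotient_type (overloaded) 'd torus = "real ^ ('d::finite)" / int_lattice_rel
  morphisms rep_torus to_torus
proof (rule equivpI)
  show "reflp (int_lattice_rel :: real ^ 'd \<Rightarrow> _)"
    by (simp add: reflp_def int_lattice_rel_def)
  show "symp (int_lattice_rel :: real ^ 'd \<Rightarrow> _)"
  proof (rule sympI)
    fix u v :: "real ^ 'd" assume uv: "int_lattice_rel u v"
    have "v $ i - u $ i \<in> \<int>" for i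
      using uv Ints_minus[of "u $ i - v $ i"] by (simp add: int_lattice_rel_def)
    then show "int_lattice_rel v u" by (simp add: int_lattice_rel_def)
  qed
  show "transp (int_lattice_rel :: real ^ 'd \<Rightarrow> _)"
  proof (rule transpI)
    fix u v w :: "real ^ 'd" assume uvw: "int_lattice_rel u v" "int_lattice_rel v w"
    have "u $ i - w $ i \<in> \<int>" for i
      using uvw Ints_add[of "u $ i - v $ i" "v $ i - w $ i"] by (simp add: int_lattice_rel_def)
    then show "int_lattice_rel u w" by (simp add: int_lattice_rel_def)
  qed
qed

lemma to_torus_eq_iff: "to_torus u = to_torus v \<longleftrightarrow> (\<forall>i. u $ i - v $ i \<in> \<int>)"
  by (simp add: torus.abs_eq_iff int_lattice_rel_def)

lemma to_torus_surj: "\<exists>u. to_torus u = x"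
  by (metis Quotient_torus Quotient_abs_rep)

instantiation torus :: (finite) ab_group_add
begin

lift_definition zero_torus :: "'a torus" is 0 .

lift_definition plus_torus :: "'a torus \<Rightarrow> 'a torus \<Rightarrow> 'a torus" is "(+)"
  unfolding int_lattice_rel_def by (simp add: add_diff_add)

lift_definition uminus_torus :: "'a torus \<Rightarrow> 'a torus" is uminus
proof -
  fix u v :: "real ^ 'a" assume uv: "int_lattice_rel u v"
  have "(- u) $ i - (- v) $ i \<in> \<int>" for i
    using uv Ints_minus[of "u $ i - v $ i"] by (simp add: int_lattice_rel_def)
  then show "int_lattice_rel (- u) (- v)" unfolding int_lattice_rel_def by blast
qed

definition minus_torus :: "'a torus \<Rightarrow> 'a torus \<Rightarrow> 'a torus" where
  "minus_torus x y = x + (- y)"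

instance
proof
  fix x y z :: "'a torus"
  show "x + y + z = x + (y + z)"
    by transfer (simp add: int_lattice_rel_def)
  show "x + y = y + x"
    by transfer (simp add: int_lattice_rel_def)
  show "0 + x = x"
    by transfer (simp add: int_lattice_rel_def)
  show "- x + x = 0"
    by transfer (simp add: int_lattice_rel_def)
  show "x - y = x + - y"
    by (rule minus_torus_def)
qed

end

lemma to_torus_add: "to_torus (u + v) = to_torus u + to_torus v"
  by (simp add: plus_torus.abs_eq)

definition torus_dist :: "'d::finite torus \<Rightarrow> 'd torus \<Rightarrow> real" where
  "torus_dist x y = Inf {norm (u - v) | u v. to_torus u = x \<and> to_torus v = y}"

lemma torus_dist_bdd: "bdd_below {norm (u - v) | u v. to_torus u = x \<and> to_torus v = y}"
  by (rule bdd_belowI[where m = 0]) auto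

lemma torus_dist_nonempty: "{norm (u - v) | u v. to_torus u = x \<and> to_torus v = y} \<noteq> {}"
  using to_torus_surj[of x] to_torus_surj[of y] by auto

lemma torus_dist_le: "torus_dist (to_torus u) (to_torus v) \<le> norm (u - v)"
  unfolding torus_dist_def by (rule cInf_lower[OF _ torus_dist_bdd]) auto

lemma torus_dist_approx:
  assumes "torus_dist x y < c"
  obtains u v where "to_torus u = x" "to_torus v = y" "norm (u - v) < c"
  using assms cInf_less_iff[OF torus_dist_nonempty torus_dist_bdd]
  unfolding torus_dist_def by blast

lemma torus_dist_ge:
  assumes "\<And>u v. to_torus u = x \<Longrightarrow> to_torus v = y \<Longrightarrow> c \<le> norm (u - v)"
  shows "c \<le> torus_dist x y"
  unfolding torus_dist_def using assms
  by (intro cInf_greatest[OF torus_dist_nonempty]) auto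

lemma torus_dist_eq_0_iff: "torus_dist x y = 0 \<longleftrightarrow> x = y"
proof
  assume "x = y"
  obtain u where "to_torus u = x" using to_torus_surj by blast
  then have "torus_dist x y \<le> 0" using torus_dist_le[of u u] \<open>x = y\<close> by simp
  moreover have "0 \<le> torus_dist x y" by (rule torus_dist_ge) simp
  ultimately show "torus_dist x y = 0" by simp
next
  assume d0: "torus_dist x y = 0"
  show "x = y"
  proof (rule ccontr)
    assume "x \<noteq> y"
    obtain u v where uv: "to_torus u = x" "to_torus v = y"
      using to_torus_surj[of x] to_torus_surj[of y] by blast
    with \<open>x \<noteq> y\<close> obtain i where i: "u $ i - v $ i \<notin> \<int>"
      using to_torus_eq_iff[of u v] by auto
    define t where "t = u $ i - v $ i"
    define c where "c = min (frac t) (1 - frac t)"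
    have "c > 0"
      using i frac_lt_1[of t] frac_gt_0_iff[of t] by (simp add: c_def t_def)
    have "c \<le> torus_dist x y"
    proof (rule torus_dist_ge)
      fix u' v' assume "to_torus u' = x" "to_torus v' = y"
      then have "u' $ i - u $ i \<in> \<int>" "v' $ i - v $ i \<in> \<int>"
        using uv to_torus_eq_iff[of u' u] to_torus_eq_iff[of v' v] by simp_all
      then have "(u' $ i - u $ i) - (v' $ i - v $ i) \<in> \<int>" by (rule Ints_diff)
      then obtain k where k: "(u' $ i - u $ i) - (v' $ i - v $ i) = of_int k"
        by (rule Ints_cases)
      have s: "u' $ i - v' $ i = of_int (k + \<lfloor>t\<rfloor>) + frac t"
        using k by (simp add: t_def frac_def)
      have "c \<le> \<bar>of_int (k + \<lfloor>t\<rfloor>) + frac t\<bar>"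
      proof (cases "k + \<lfloor>t\<rfloor> \<ge> 0")
        case True
        then have "(of_int (k + \<lfloor>t\<rfloor>) :: real) \<ge> 0" by linarith
        then show ?thesis unfolding c_def by linarith
      next
        case False
        then have "(of_int (k + \<lfloor>t\<rfloor>) :: real) \<le> -1" by linarith
        then show ?thesis unfolding c_def by linarith
      qed
      also have "\<dots> = \<bar>(u' - v') $ i\<bar>" using s by simp
      also have "\<dots> \<le> norm (u' - v')" by (rule component_le_norm_cart)
      finally show "c \<le> norm (u' - v')" .
    qed
    with \<open>c > 0\<close> d0 show False by simp
  qed
qed

lemma torus_dist_triangle: "torus_dist x y \<le> torus_dist x z + torus_dist y z"
proof (rule field_le_epsilon)
  fix e :: real assume "e > 0"
  obtain u w where uw: "to_torus u = x" "to_torus w = z" "norm (u - w) < torus_dist x z + e / 2"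
    using \<open>e > 0\<close> torus_dist_approx[of x z "torus_dist x z + e / 2"] by auto
  obtain v w' where vw: "to_torus v = y" "to_torus w' = z" "norm (v - w') < torus_dist y z + e / 2"
    using \<open>e > 0\<close> torus_dist_approx[of y z "torus_dist y z + e / 2"] by auto
  have "w $ i - w' $ i \<in> \<int>" for i
    using uw vw to_torus_eq_iff[of w w'] by simp
  then have "to_torus (v + (w - w')) = y"
    using vw(1) to_torus_eq_iff[of "v + (w - w')" v] by simp
  then have "torus_dist x y \<le> norm (u - (v + (w - w')))"
    using torus_dist_le[of u "v + (w - w')"] uw(1) by simp
  also have "u - (v + (w - w')) = (u - w) - (v - w')" by simp
  also have "norm \<dots> \<le> norm (u - w) + norm (v - w')" by (rule norm_triangle_ineq4)
  finally show "torus_dist x y \<le> torus_dist x z + torus_dist y z + e"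
    using uw(3) vw(3) by linarith
qed

text \<open>The distance on the torus is the quotient of the Euclidean distance.\<close>

instantiation torus :: (finite) metric_space
begin

definition dist_torus :: "'a torus \<Rightarrow> 'a torus \<Rightarrow> real" where
  "dist_torus = torus_dist"

definition uniformity_torus :: "('a torus \<times> 'a torus) filter" where
  "uniformity_torus = (INF e\<in>{0<..}. principal {(x, y). dist x y < e})"

definition open_torus :: "'a torus set \<Rightarrow> bool" where
  "open_torus U \<longleftrightarrow> (\<forall>x\<in>U. \<forall>\<^sub>F (x', y) in uniformity. x' = x \<longrightarrow> y \<in> U)"

instance
  by standard
    (simp_all add: dist_torus_def torus_dist_eq_0_iff torus_dist_triangle
      uniformity_torus_def open_torus_def)

end

section \<open>Haar measure\<close>

definition unit_cube :: "(real ^ 'd) set" where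
  "unit_cube = {u. \<forall>i. 0 \<le> u $ i \<and> u $ i < 1}"

text \<open>The normalized Haar measure, realized as the image of Lebesgue measure on a fundamental
  domain of \<open>\<int>^d\<close>. Below it is shown to be a translation invariant Borel probability measure.\<close>

definition haar :: "'d::finite torus measure" where
  "haar = distr (restrict_space lborel unit_cube) borel to_torus"

lemma dist_to_torus_le: "dist (to_torus u) (to_torus v) \<le> dist u v"
  by (simp add: dist_torus_def torus_dist_le dist_norm)

lemma continuous_on_to_torus: "continuous_on A to_torus"
  unfolding continuous_on_iff by (meson dist_to_torus_le le_less_trans)

lemma measurable_to_torus [measurable]: "to_torus \<in> borel_measurable borel"
  by (rule borel_measurable_continuous_onI[OF continuous_on_to_torus])

lemma sets_unit_cube [measurable]: "unit_cube \<in> sets borel"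
  unfolding unit_cube_def by measurable

lemma sets_haar [simp, measurable_cong]: "sets haar = sets borel"
  by (simp add: haar_def)

lemma space_haar [simp]: "space haar = UNIV"
  by (simp add: haar_def)

lemma measurable_to_torus_cube:
  "to_torus \<in> borel_measurable (restrict_space lborel unit_cube)"
  by (rule measurable_restrict_space1) simp

lemma emeasure_haar:
  assumes "A \<in> sets borel"
  shows "emeasure haar A = emeasure lborel (to_torus -` A \<inter> unit_cube)"
proof -
  have "emeasure haar A
      = emeasure (restrict_space lborel unit_cube) (to_torus -` A \<inter> unit_cube)"
    unfolding haar_def
    by (subst emeasure_distr[OF measurable_to_torus_cube])
      (use assms in \<open>simp_all add: space_restrict_space\<close>)
  also have "\<dots> = emeasure lborel (to_torus -` A \<inter> unit_cube)"
    by (rule emeasure_restrict_space) simp_all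
  finally show ?thesis .
qed

lemma emeasure_unit_cube: "emeasure lborel (unit_cube :: (real ^ 'd::finite) set) = 1"
proof -
  have "emeasure lborel (unit_cube :: (real ^ 'd) set) \<le> emeasure lborel (cbox (0 :: real ^ 'd) 1)"
    by (rule emeasure_mono) (auto simp: unit_cube_def mem_box_cart less_imp_le)
  moreover have "emeasure lborel (box (0 :: real ^ 'd) 1) \<le> emeasure lborel (unit_cube :: (real ^ 'd) set)"
    by (rule emeasure_mono) (auto simp: unit_cube_def mem_box_cart less_imp_le)
  moreover have "(\<Prod>b\<in>Basis. (1 :: real ^ 'd) \<bullet> b) = 1"
    by (rule prod.neutral) (auto simp: Basis_vec_def inner_axis)
  moreover have "\<And>b. b \<in> Basis \<Longrightarrow> (0 :: real ^ 'd) \<bullet> b \<le> 1 \<bullet> b"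
    by (auto simp: Basis_vec_def inner_axis)
  ultimately show ?thesis
    by (simp add: emeasure_lborel_cbox_eq emeasure_lborel_box_eq)
qed

lemma prob_space_haar: "prob_space (haar :: 'd::finite torus measure)"
proof (rule prob_spaceI)
  show "emeasure (haar :: 'd torus measure) (space haar) = 1"
    using emeasure_haar[of "UNIV :: 'd torus set"] emeasure_unit_cube by simp
qed

lemma lborel_translate:
  fixes B :: "(real ^ 'd::finite) set"
  assumes "B \<in> sets borel"
  shows "emeasure lborel ((\<lambda>u. u + c) -` B) = emeasure lborel B"
proof -
  have "emeasure lborel B = emeasure (distr lborel borel ((+) c)) B"
    by (simp add: lborel_distr_plus)
  also have "\<dots> = emeasure lborel ((+) c -` B)"
    using assms by (subst emeasure_distr) simp_all
  finally show ?thesis by (simp add: add.commute vimage_def)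
qed

definition int_vec :: "int ^ 'd \<Rightarrow> real ^ 'd" where
  "int_vec k = (\<chi> i. of_int (k $ i))"

lemma to_torus_int_vec: "to_torus (u + int_vec k) = to_torus u"
  by (simp add: to_torus_eq_iff int_vec_def)

lemma unit_cube_cover: "u - int_vec (\<chi> i. \<lfloor>u $ i\<rfloor>) \<in> unit_cube"
  by (simp add: unit_cube_def int_vec_def) linarith

lemma unit_cube_disjoint:
  assumes "u - int_vec k \<in> unit_cube" "u - int_vec l \<in> unit_cube"
  shows "k = l"
proof -
  have "k $ i = l $ i" for i
  proof -
    have "0 \<le> u $ i - of_int (k $ i)" "u $ i - of_int (k $ i) < 1"
         "0 \<le> u $ i - of_int (l $ i)" "u $ i - of_int (l $ i) < 1"
      using assms by (simp_all add: unit_cube_def int_vec_def)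
    then show ?thesis by linarith
  qed
  then show ?thesis by (simp add: vec_eq_iff)
qed

lemma emeasure_unit_cube_tiling:
  fixes S :: "(real ^ 'd::finite) set"
  assumes "S \<in> sets borel"
  shows "emeasure lborel S
    = (\<integral>\<^sup>+k. emeasure lborel (S \<inter> {u. u - int_vec k \<in> unit_cube}) \<partial>count_space UNIV)"
proof -
  have cube: "{u. u - c \<in> unit_cube} \<in> sets borel" for c :: "real ^ 'd"
  proof -
    have "(\<lambda>u. u - c) \<in> borel_measurable borel" by measurable
    from measurable_sets[OF this sets_unit_cube] show ?thesis by (simp add: vimage_def)
  qed
  have "S = (\<Union>k. S \<inter> {u. u - int_vec k \<in> unit_cube})"
    using unit_cube_cover by blast
  also have "emeasure lborel \<dots>
      = (\<integral>\<^sup>+k. emeasure lborel (S \<inter> {u. u - int_vec k \<in> unit_cube}) \<partial>count_space UNIV)"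
    using assms cube
    by (intro emeasure_UN_countable)
      (auto simp: disjoint_family_on_def dest: unit_cube_disjoint)
  finally show ?thesis .
qed

lemma emeasure_haar_translate:
  fixes A :: "'d::finite torus set"
  assumes A: "A \<in> sets borel"
  shows "emeasure haar ((\<lambda>x. x + a) -` A) = emeasure haar A"
proof -
  obtain c where c: "to_torus c = a" using to_torus_surj by blast
  define B where "B = to_torus -` A"
  have B [measurable]: "B \<in> sets borel"
    using measurable_sets[OF measurable_to_torus A] by (simp add: B_def)
  have per: "u + int_vec k \<in> B \<longleftrightarrow> u \<in> B" for u k
    by (simp add: B_def to_torus_int_vec)
  have shift: "(\<lambda>u. u + w) \<in> borel_measurable borel" for w :: "real ^ 'd" by measurable
  have cube: "{u. u + w \<in> unit_cube} \<in> sets borel" for w :: "real ^ 'd"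
    using measurable_sets[OF shift sets_unit_cube] by (simp add: vimage_def)
  have cube': "{u. u - w \<in> unit_cube} \<in> sets borel" for w :: "real ^ 'd"
    using cube[of "- w"] by simp
  have "continuous_on UNIV (\<lambda>x. x + a)"
    unfolding continuous_on_iff
  proof (intro ballI allI impI)
    fix x :: "'d torus" and e :: real assume "e > 0"
    have "dist (y + a) (x + a) \<le> dist y x" for y
      unfolding dist_torus_def
    proof (rule torus_dist_ge)
      fix u v assume "to_torus u = y" "to_torus v = x"
      then show "torus_dist (y + a) (x + a) \<le> norm (u - v)"
        using torus_dist_le[of "u + c" "v + c"] c by (simp add: to_torus_add)
    qed
    then show "\<exists>d>0. \<forall>x'\<in>UNIV. dist x' x < d \<longrightarrow> dist (x' + a) (x + a) < e"
      using \<open>e > 0\<close> le_less_trans by blast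
  qed
  then have "(\<lambda>x. x + a) \<in> borel_measurable borel"
    by (rule borel_measurable_continuous_onI)
  from measurable_sets[OF this A] have A': "(\<lambda>x. x + a) -` A \<in> sets borel" by simp
  have "emeasure haar ((\<lambda>x. x + a) -` A)
      = emeasure lborel ((\<lambda>u. u + c) -` (B \<inter> {u. u - c \<in> unit_cube}))"
    unfolding emeasure_haar[OF A']
    by (rule arg_cong[where f = "emeasure lborel"]) (auto simp: B_def to_torus_add c)
  also have "\<dots> = emeasure lborel (B \<inter> {u. u - c \<in> unit_cube})"
    by (rule lborel_translate) (use B cube' in auto)
  also have "\<dots> = (\<integral>\<^sup>+k. emeasure lborel
      (B \<inter> {u. u - c \<in> unit_cube} \<inter> {u. u - int_vec k \<in> unit_cube}) \<partial>count_space UNIV)"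
    by (rule emeasure_unit_cube_tiling) (use B cube' in auto)
  also have "\<dots> = (\<integral>\<^sup>+k. emeasure lborel
      (B \<inter> unit_cube \<inter> {u. u - (c - int_vec k) \<in> unit_cube}) \<partial>count_space UNIV)"
  proof (rule nn_integral_cong)
    fix k :: "int ^ 'd"
    let ?E = "B \<inter> {u. u - c \<in> unit_cube} \<inter> {u. u - int_vec k \<in> unit_cube}"
    have "emeasure lborel ?E = emeasure lborel ((\<lambda>u. u + int_vec k) -` ?E)"
      by (rule lborel_translate[symmetric]) (use B cube' in auto)
    also have "(\<lambda>u. u + int_vec k) -` ?E
        = B \<inter> unit_cube \<inter> {u. u - (c - int_vec k) \<in> unit_cube}"
      by (auto simp: per algebra_simps)
    finally show "emeasure lborel ?E
        = emeasure lborel (B \<inter> unit_cube \<inter> {u. u - (c - int_vec k) \<in> unit_cube})" .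
  qed
  also have "\<dots> = (\<integral>\<^sup>+k. emeasure lborel
      ((\<lambda>u. u + c) -` (B \<inter> unit_cube \<inter> {u. u - (c - int_vec k) \<in> unit_cube})) \<partial>count_space UNIV)"
    by (intro nn_integral_cong lborel_translate[symmetric]) (use B cube' in auto)
  also have "\<dots> = (\<integral>\<^sup>+k. emeasure lborel
      ((\<lambda>u. u + c) -` (B \<inter> unit_cube) \<inter> {u. u - int_vec (- k) \<in> unit_cube}) \<partial>count_space UNIV)"
    by (intro nn_integral_cong arg_cong[where f = "emeasure lborel"])
      (auto simp: int_vec_def algebra_simps vec_eq_iff unit_cube_def)
  also have "\<dots> = (\<integral>\<^sup>+k. emeasure lborel
      ((\<lambda>u. u + c) -` (B \<inter> unit_cube) \<inter> {u. u - int_vec k \<in> unit_cube}) \<partial>count_space UNIV)"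
    by (rule nn_integral_bij_count_space[OF bij_uminus])
  also have "\<dots> = emeasure lborel ((\<lambda>u. u + c) -` (B \<inter> unit_cube))"
    by (rule emeasure_unit_cube_tiling[symmetric])
      (use measurable_sets[OF shift, of "B \<inter> unit_cube"] B in auto)
  also have "\<dots> = emeasure lborel (B \<inter> unit_cube)"
    by (rule lborel_translate) (use B in auto)
  also have "\<dots> = emeasure haar A"
    by (simp add: emeasure_haar[OF A] B_def)
  finally show ?thesis .
qed

section \<open>Recurrence distances\<close>

definition translation :: "'d::finite torus \<Rightarrow> 'd torus \<Rightarrow> 'd torus" where
  "translation \<alpha> x = x + \<alpha>"

text \<open>The \<open>r\<close>-th smallest, counted with multiplicity, of the \<open>n\<close> distances from \<open>x\<close> to the orbit
  points of \<open>y\<close> at times \<open>1, \<dots>, n\<close>. Only \<open>1 \<le> r \<le> n\<close> is meaningful; the finitely many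
  \<open>n < r\<close> do not influence a limit superior as \<open>n\<close> tends to infinity. The value can be 0 only if
  the orbit of \<open>y\<close> hits \<open>x\<close>, which for almost every \<open>\<alpha>\<close> is impossible when \<open>y = x\<close> and happens,
  for each \<open>x\<close>, only for countably many \<open>y\<close>; so the convention \<open>ln 0 = 0\<close> has no effect on
  almost everywhere statements about logarithms of these distances.\<close>

definition orbit_dist ::
  "'d::finite torus \<Rightarrow> nat \<Rightarrow> nat \<Rightarrow> 'd torus \<Rightarrow> 'd torus \<Rightarrow> real" where
  "orbit_dist \<alpha> r n x y
    = sort (map (\<lambda>k. dist x ((translation \<alpha> ^^ k) y)) [1..<Suc n]) ! (r - 1)"

end

theory Submission
  imports Defs "HOL-Real_Asymp.Real_Asymp"
begin

text \<open>
  Put \<open>w = y - x\<close>. The point \<open>y + k \<alpha>\<close> is close to \<open>x\<close> exactly when \<open>w + k \<alpha>\<close> is close to \<open>0\<close>, so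
  everything is about the times \<open>k\<close> at which \<open>w + k \<alpha>\<close> (part (a), with \<open>w\<close> generic) or \<open>k \<alpha>\<close> itself
  (part (b)) hits a small cube around \<open>0\<close>. A bounded factor in the radius is invisible on the scale of
  the theorem, so sup-norm cubes replace balls; their Haar measure is a \<open>d\<close>-th power.

  Upper bounds come from the first Borel--Cantelli lemma over the times \<open>k < 2 ^ (m + 1)\<close>, for cubes
  of radius \<open>\<rho>\<close> with \<open>\<rho> ^ d = 2 ^ (- m) * m powr - p\<close>. The expected number of hits is of order
  \<open>m powr - p\<close>. Since \<open>w + j \<alpha>\<close> and \<open>w + k \<alpha>\<close> are independent for \<open>j \<noteq> k\<close>
  (\<open>orbit_pair_independent\<close>), the expected number of pairs of hits is of order \<open>m powr - (2 * p)\<close>.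
  So for large \<open>m\<close> there is no hit if \<open>p > 1\<close> and at most one if \<open>p > 1 / 2\<close>. This is where the two
  exponents \<open>1 / d\<close> and \<open>1 / (2 * d)\<close> come from.

  The lower bound for \<open>r = 1\<close> in (a) is the converse Borel--Cantelli lemma for pairwise independent
  events (\<open>single_hits_AE\<close>). The other lower bounds rest on one observation
  (\<open>orbit_dist_le_of_progression\<close>): if \<open>b \<alpha>\<close> is very close to \<open>0\<close>, then a hit at time \<open>a\<close> forces
  further hits at times \<open>a + b, a + 2 b, \<dots>\<close>. Hence \<open>r\<close> hits are about as likely as two, and when
  \<open>w = 0\<close>, where time \<open>0\<close> is a hit for free, one close return of \<open>\<alpha>\<close> is enough for every \<open>r\<close>.

  Close returns are studied along scales \<open>K i\<close> (\<open>block_span\<close>) with radii given by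
  \<open>\<rho> ^ d = 1 / (K i * i powr \<sigma>)\<close>. The event \<open>close_return \<sigma> i\<close> has probability of order \<open>i powr - \<sigma>\<close>:
  by Dirichlet's theorem the larger cubes with \<open>\<rho> ^ d = 1 / K i\<close> are always hit, and shrinking the
  neighbourhoods of torsion points costs no more than the ratio of the volumes
  (\<open>measure_near_torsion_ge\<close>). The scales grow like a power of \<open>i!\<close>. This is fast enough for events at
  different scales to be nearly independent, by a bound on the correlation of two multiples of \<open>\<alpha>\<close>
  (\<open>measure_two_multiples_in_cubes\<close>), and slow enough for \<open>ln (ln (K i))\<close> to be asymptotic to \<open>ln i\<close>,
  so that a power of \<open>i\<close> is the same as a power of \<open>ln n\<close>. The Kochen--Stone inequality gives a
  divergent sum of close returns with positive probability, and a zero-one law for sets invariant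
  under dyadic torsion points gives it almost surely (\<open>close_returns_AE\<close>). For \<open>\<sigma> = 1\<close> this is the
  lower bound in (b).

  For \<open>\<sigma> = 1 / 2\<close> the close returns of almost every \<open>\<alpha>\<close> have divergent sum even with weights
  \<open>i powr - (1 / 2)\<close>, which is the order of the probability that \<open>w\<close> has a hit at scale \<open>i\<close>. For fixed
  generic \<open>\<alpha>\<close>, an orbit segment at a later scale is equidistributed at the resolution of an earlier
  one (\<open>overlap_le_AE\<close>), so hits at different scales are asymptotically independent, and almost
  every \<open>w\<close> has infinitely many hits at scales with a close return (\<open>hits_AE\<close>).
\<close>

section \<open>Topology and integer multiples on the torus\<close>

lemma dist_to_torus_lessE:
  assumes "dist (to_torus u) y < e"
  obtains v where "to_torus v = y" "norm (u - v) < e"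
proof -
  obtain u' v' where *: "to_torus u' = to_torus u" "to_torus v' = y" "norm (u' - v') < e"
    using assms torus_dist_approx unfolding dist_torus_def by metis
  have "u $ i - u' $ i \<in> \<int>" for i using *(1)[symmetric] unfolding to_torus_eq_iff by blast
  then have "to_torus (v' + (u - u')) = to_torus v'" unfolding to_torus_eq_iff by simp
  then have "to_torus (v' + (u - u')) = y" using *(2) by simp
  moreover have "norm (u - (v' + (u - u'))) < e" using *(3) by (simp add: algebra_simps)
  ultimately show ?thesis by (rule that)
qed

lemma open_to_torus_image:
  assumes "open U" shows "open (to_torus ` U)"
  unfolding open_dist
proof safe
  fix u assume "u \<in> U"
  then obtain e where e: "e > 0" "\<And>v. dist v u < e \<Longrightarrow> v \<in> U"
    using assms unfolding open_dist by blast
  have "y \<in> to_torus ` U" if "dist y (to_torus u) < e" for y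
  proof -
    have "dist (to_torus u) y < e" using that by (simp add: dist_commute)
    then obtain v where "to_torus v = y" "norm (u - v) < e" by (rule dist_to_torus_lessE)
    then show ?thesis using e(2)[of v] by (auto simp: dist_norm norm_minus_commute)
  qed
  then show "\<exists>e>0. \<forall>y. dist y (to_torus u) < e \<longrightarrow> y \<in> to_torus ` U" using e(1) by blast
qed

lemma open_vimage_to_torus:
  fixes U :: "'d::finite torus set"
  assumes "open U" shows "open (to_torus -` U)"
  by (rule open_vimage[OF assms continuous_on_to_torus])

text \<open>
  Second countability and continuity of addition make the Borel sets of a product of tori the product
  of the Borel sets, so that sums of random points are measurable.
\<close>

instance torus :: (finite) second_countable_topology
proof
  obtain B :: "(real ^ 'a) set set" where B: "countable B" "topological_basis B"
    using ex_countable_basis by blast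
  have "topological_basis ((`) to_torus ` B)"
  proof (rule topological_basisI)
    fix S assume "S \<in> (`) to_torus ` B"
    then show "open S"
      using B(2) open_to_torus_image topological_basis_open by blast
  next
    fix O' :: "'a torus set" and x assume O': "open O'" "x \<in> O'"
    obtain u where u: "to_torus u = x" using to_torus_surj by blast
    have "open (to_torus -` O')"
      using O'(1) by (rule open_vimage_to_torus)
    moreover have "u \<in> to_torus -` O'" by (simp add: u O'(2))
    ultimately obtain b where b: "b \<in> B" "u \<in> b" "b \<subseteq> to_torus -` O'"
      by (rule topological_basisE[OF B(2)])
    show "\<exists>B'\<in>(`) to_torus ` B. x \<in> B' \<and> B' \<subseteq> O'"
    proof (intro bexI conjI)
      show "x \<in> to_torus ` b" using b(2) u by blast
      show "to_torus ` b \<subseteq> O'" using b(3) by blast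
      show "to_torus ` b \<in> (`) to_torus ` B" using b(1) by blast
    qed
  qed
  then have "open = generate_topology ((`) to_torus ` B)" by (rule topological_basis_imp_subbasis)
  moreover have "countable ((`) to_torus ` B)" using B(1) by simp
  ultimately show "\<exists>B::'a torus set set. countable B \<and> open = generate_topology B" by blast
qed

lemma dist_torus_add_le: "dist (x + y) (x' + y') \<le> dist x x' + dist y (y' :: 'd::finite torus)"
proof (rule field_le_epsilon)
  fix e :: real assume "e > 0"
  obtain u u' where u: "to_torus u = x" "to_torus u' = x'" "norm (u - u') < dist x x' + e / 2"
    using torus_dist_approx[of x x' "dist x x' + e / 2"] \<open>e > 0\<close> by (auto simp: dist_torus_def)
  obtain v v' where v: "to_torus v = y" "to_torus v' = y'" "norm (v - v') < dist y y' + e / 2"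
    using torus_dist_approx[of y y' "dist y y' + e / 2"] \<open>e > 0\<close> by (auto simp: dist_torus_def)
  have "dist (x + y) (x' + y') \<le> norm ((u + v) - (u' + v'))"
    using dist_to_torus_le[of "u + v" "u' + v'"] u v by (simp add: to_torus_add dist_norm)
  also have "\<dots> \<le> norm (u - u') + norm (v - v')"
    by (metis add_diff_add norm_triangle_ineq)
  finally show "dist (x + y) (x' + y') \<le> dist x x' + dist y y' + e" using u v by linarith
qed

instance torus :: (finite) topological_monoid_add
proof
  fix a b :: "'a torus"
  have "((\<lambda>x. fst x + snd x) \<longlongrightarrow> a + b) (nhds (a, b))"
  proof (rule tendstoI)
    fix e :: real assume "e > 0"
    have "dist (fst x + snd x) (a + b) < e" if "dist x (a, b) < e / 2" for x
      using dist_torus_add_le[of "fst x" "snd x" a b] that dist_fst_le[of x "(a, b)"]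
        dist_snd_le[of x "(a, b)"] by simp
    then show "\<forall>\<^sub>F x in nhds (a, b). dist (fst x + snd x) (a + b) < e"
      unfolding eventually_nhds_metric using \<open>e > 0\<close> by (intro exI[of _ "e / 2"]) auto
  qed
  then show "LIM x nhds a \<times>\<^sub>F nhds b. fst x + snd x :> nhds (a + b)"
    by (simp add: nhds_prod)
qed

lift_definition zmul :: "int \<Rightarrow> 'd::finite torus \<Rightarrow> 'd torus" is "\<lambda>k u. of_int k *\<^sub>R u"
proof -
  fix k :: int and u v :: "real ^ 'd" assume "int_lattice_rel u v"
  then have "of_int k * (u $ i - v $ i) \<in> \<int>" for i by (simp add: int_lattice_rel_def)
  then show "int_lattice_rel (of_int k *\<^sub>R u) (of_int k *\<^sub>R v)"
    by (simp add: int_lattice_rel_def algebra_simps)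
qed

lemma zmul_to_torus: "zmul k (to_torus u) = to_torus (of_int k *\<^sub>R u)"
  by (rule zmul.abs_eq)

lemma zmul_add_left: "zmul (a + b) x = zmul a x + zmul b x"
  by transfer (simp add: int_lattice_rel_def algebra_simps)

lemma zmul_add_right: "zmul a (x + y) = zmul a x + zmul a y"
  by transfer (simp add: int_lattice_rel_def algebra_simps)

lemma zmul_zmul: "zmul a (zmul b x) = zmul (a * b) x"
  by transfer (simp add: int_lattice_rel_def algebra_simps)

lemma zmul_0 [simp]: "zmul 0 x = 0"
  by transfer (simp add: int_lattice_rel_def)

lemma zmul_1 [simp]: "zmul 1 x = x"
  by transfer (simp add: int_lattice_rel_def)

lemma zmul_minus_left: "zmul (- a) x = - zmul a x"
  by (metis add.right_inverse add_eq_0_iff zmul_0 zmul_add_left)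

lemma zmul_diff_right: "zmul k (x - y) = zmul k x - zmul k y"
  by (metis add_diff_cancel_right' diff_add_cancel zmul_add_right)

lemma zmul_diff_left: "zmul (a - b) x = zmul a x - zmul b x"
  using zmul_add_left[of a "- b" x] by (simp add: zmul_minus_left)

lemma translation_funpow: "(translation \<alpha> ^^ k) y = y + zmul (int k) \<alpha>"
  by (induction k) (simp_all add: translation_def zmul_add_left algebra_simps)

lemma zmul_surj: assumes "k \<noteq> 0" shows "\<exists>y. zmul k y = x"
proof -
  obtain u where "to_torus u = x" using to_torus_surj by blast
  then have "zmul k (to_torus ((1 / of_int k) *\<^sub>R u)) = x" using assms by (simp add: zmul_to_torus)
  then show ?thesis by blast
qed

lemma continuous_on_zmul: "continuous_on UNIV (zmul k :: 'd::finite torus \<Rightarrow> 'd torus)"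
proof -
  have *: "open (zmul k -` U)" if "open U" for U :: "'d torus set"
  proof -
    have "open (to_torus -` U)"
      using that by (rule open_vimage_to_torus)
    then have "open ((\<lambda>u. of_int k *\<^sub>R u) -` (to_torus -` U))"
      by (rule open_vimage) (intro continuous_intros)
    moreover have "zmul k -` U = to_torus ` ((\<lambda>u. of_int k *\<^sub>R u) -` (to_torus -` U))"
    proof safe
      fix x assume x: "zmul k x \<in> U"
      obtain u where u: "to_torus u = x" using to_torus_surj by blast
      show "x \<in> to_torus ` ((\<lambda>u. of_int k *\<^sub>R u) -` (to_torus -` U))"
        using x by (intro image_eqI[of _ _ u]) (auto simp: u[symmetric] zmul_to_torus)
    qed (simp add: zmul_to_torus)
    ultimately show ?thesis by (simp add: open_to_torus_image)
  qed
  show ?thesis unfolding continuous_on_open_vimage[OF open_UNIV] using * by simp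
qed

lemma measurable_zmul [measurable]: "zmul k \<in> borel_measurable borel"
  by (rule borel_measurable_continuous_onI[OF continuous_on_zmul])

section \<open>Sup-norm cubes\<close>

definition tbox :: "real ^ 'd \<Rightarrow> real ^ 'd \<Rightarrow> 'd::finite torus set" where
  "tbox a b = to_torus ` cbox a b"

definition tcube :: "real \<Rightarrow> 'd::finite torus set" where
  "tcube \<rho> = tbox (\<chi> i. - \<rho>) (\<chi> i. \<rho>)"

lemma tbox_borel [measurable]: "tbox a b \<in> sets borel"
  unfolding tbox_def
  by (intro borel_closed compact_imp_closed compact_continuous_image continuous_on_to_torus) simp

lemma tcube_borel [measurable]: "tcube \<rho> \<in> sets borel"
  unfolding tcube_def by simp

lemma mem_tcube: "x \<in> tcube \<rho> \<longleftrightarrow> (\<exists>u. to_torus u = x \<and> (\<forall>i. \<bar>u $ i\<bar> \<le> \<rho>))"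
  unfolding tcube_def tbox_def by (auto simp: mem_box_cart abs_le_iff minus_le_iff)

lemma tcube_mono: "\<rho> \<le> \<rho>' \<Longrightarrow> tcube \<rho> \<subseteq> tcube \<rho>'"
  unfolding mem_tcube subset_iff by (blast intro: order_trans)

lemma tcube_add: assumes "x \<in> tcube a" "y \<in> tcube b" shows "x + y \<in> tcube (a + b)"
proof -
  obtain u v where "to_torus u = x" "to_torus v = y" "\<And>i. \<bar>u $ i\<bar> \<le> a" "\<And>i. \<bar>v $ i\<bar> \<le> b"
    using assms by (auto simp: mem_tcube)
  then show ?thesis unfolding mem_tcube
    by (intro exI[of _ "u + v"]) (auto simp: to_torus_add intro: order_trans[OF abs_triangle_ineq add_mono])
qed

lemma tcube_zmul: assumes "x \<in> tcube a" shows "zmul k x \<in> tcube (\<bar>of_int k\<bar> * a)"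
proof -
  obtain u where "to_torus u = x" "\<And>i. \<bar>u $ i\<bar> \<le> a" using assms by (auto simp: mem_tcube)
  then show ?thesis unfolding mem_tcube
    by (intro exI[of _ "of_int k *\<^sub>R u"]) (auto simp: zmul_to_torus[symmetric] abs_mult mult_left_mono)
qed

lemma tcube_minus: "x \<in> tcube a \<Longrightarrow> - x \<in> tcube a"
  using tcube_zmul[of x a "- 1"] by (simp add: zmul_minus_left)

lemma tcube_minus_iff: "- x \<in> tcube a \<longleftrightarrow> x \<in> tcube a"
  using tcube_minus[of x a] tcube_minus[of "- x" a] by auto

lemma tcube_diff: "x \<in> tcube a \<Longrightarrow> y \<in> tcube b \<Longrightarrow> x - y \<in> tcube (a + b)"
  using tcube_add[of x a "- y" b] tcube_minus[of y b] by simp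

lemma dist_le_of_tcube:
  assumes "y - x \<in> tcube \<rho>" shows "dist x (y :: 'd::finite torus) \<le> real CARD('d) * \<rho>"
proof -
  obtain w where w: "to_torus w = y - x" "\<And>i. \<bar>w $ i\<bar> \<le> \<rho>" using assms by (auto simp: mem_tcube)
  obtain u where u: "to_torus u = x" using to_torus_surj by blast
  have "to_torus (u + w) = y" using u w by (simp add: to_torus_add)
  then have "dist x y \<le> norm w"
    using dist_to_torus_le[of u "u + w"] u by (simp add: dist_norm)
  also have "\<dots> \<le> (\<Sum>i\<in>UNIV. \<bar>w $ i\<bar>)" by (rule norm_le_l1_cart)
  also have "\<dots> \<le> (\<Sum>i\<in>(UNIV :: 'd set). \<rho>)" by (intro sum_mono w)
  finally show ?thesis by simp
qed

lemma tcube_of_dist_less: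
  assumes "dist x (y :: 'd::finite torus) < \<rho>" shows "y - x \<in> tcube \<rho>"
proof -
  obtain u where u: "to_torus u = x" using to_torus_surj by blast
  obtain v where v: "to_torus v = y" "norm (u - v) < \<rho>"
    using dist_to_torus_lessE[of u y \<rho>] assms u by blast
  have "to_torus (v - u) + x = y" using to_torus_add[of "v - u" u] u v by simp
  then have "to_torus (v - u) = y - x" by (simp add: algebra_simps)
  moreover have "\<bar>(v - u) $ i\<bar> \<le> \<rho>" for i
    using component_le_norm_cart[of "v - u" i] v(2) by (simp add: norm_minus_commute)
  ultimately show ?thesis unfolding mem_tcube by blast
qed

lemma torus_tcube_UNIV: "x \<in> tcube (1 :: real)"
proof -
  obtain u where u: "to_torus u = x" using to_torus_surj by blast
  have "to_torus (\<chi> i. u $ i - \<lfloor>u $ i\<rfloor>) = x" unfolding u[symmetric] to_torus_eq_iff by simp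
  moreover have "\<bar>(\<chi> i. u $ i - \<lfloor>u $ i\<rfloor>) $ i\<bar> \<le> 1" for i by simp linarith
  ultimately show ?thesis unfolding mem_tcube by blast
qed

section \<open>Measure-preserving maps and the measure of cubes\<close>

interpretation haar: prob_space "haar :: 'd::finite torus measure"
  by (rule prob_space_haar)

lemma measure_haar_translate:
  "A \<in> sets borel \<Longrightarrow> measure haar {x. x + a \<in> A} = measure haar (A :: 'd::finite torus set)"
  using emeasure_haar_translate[of A a] by (simp add: measure_def vimage_def)

text \<open>
  The cube is moved into the interior of the fundamental domain, where no two of its points are
  identified.
\<close>

lemma measure_haar_tcube_eq:
  assumes "0 \<le> \<rho>" "\<rho> < 1 / 2"
  shows "measure haar (tcube \<rho> :: 'd::finite torus set) = (2 * \<rho>) ^ CARD('d)"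
proof -
  define a :: "real ^ 'd" where "a = (\<chi> i. \<rho>)"
  define c :: "real ^ 'd" where "c = (\<chi> i. 2 * \<rho>)"
  have eq: "{x. x - to_torus a \<in> tcube \<rho>} = tbox 0 c"
  proof safe
    fix x assume "x - to_torus a \<in> tcube \<rho>"
    then obtain u where u: "to_torus u = x - to_torus a" "\<And>i. \<bar>u $ i\<bar> \<le> \<rho>" by (auto simp: mem_tcube)
    then have "to_torus (u + a) = x" by (simp add: to_torus_add)
    moreover have "u + a \<in> cbox 0 c"
    proof -
      have "0 \<le> (u + a) $ i \<and> (u + a) $ i \<le> c $ i" for i
        using u(2)[of i] by (simp add: a_def c_def abs_le_iff)
      then show ?thesis by (simp add: mem_box_cart)
    qed
    ultimately show "x \<in> tbox 0 c" unfolding tbox_def by blast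
  next
    fix x assume "x \<in> tbox 0 c"
    then obtain u where u: "to_torus u = x" "u \<in> cbox 0 c" by (auto simp: tbox_def)
    have "to_torus (u - a) + to_torus a = x" using to_torus_add[of "u - a" a] u by simp
    then have "to_torus (u - a) = x - to_torus a" by (simp add: algebra_simps)
    moreover have "\<bar>(u - a) $ i\<bar> \<le> \<rho>" for i
      using u(2)[unfolded mem_box_cart, rule_format, of i] by (simp add: a_def c_def abs_le_iff)
    ultimately show "x - to_torus a \<in> tcube \<rho>" unfolding mem_tcube by blast
  qed
  have pre: "to_torus -` tbox 0 c \<inter> unit_cube = cbox 0 c"
  proof (intro equalityI subsetI)
    fix u assume "u \<in> to_torus -` tbox 0 c \<inter> unit_cube"
    then have "to_torus u \<in> tbox 0 c" "u \<in> unit_cube" by auto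
    then obtain v where v: "to_torus u = to_torus v" "v \<in> cbox 0 c" by (auto simp: tbox_def)
    have "u $ i = v $ i" for i
    proof -
      have "u $ i - v $ i \<in> \<int>" using v(1) to_torus_eq_iff by blast
      then obtain k where k: "u $ i - v $ i = of_int k" by (rule Ints_cases)
      have "0 \<le> v $ i" "v $ i < 1"
        using v(2)[unfolded mem_box_cart, rule_format, of i] assms by (simp_all add: c_def)
      moreover have "0 \<le> u $ i" "u $ i < 1" using \<open>u \<in> unit_cube\<close> by (auto simp: unit_cube_def)
      ultimately have "k = 0" using k by linarith
      then show ?thesis using k by simp
    qed
    then have "u = v" by (simp add: vec_eq_iff)
    then show "u \<in> cbox 0 c" using v by simp
  next
    fix u assume u: "u \<in> cbox 0 c"
    then have 1: "to_torus u \<in> tbox 0 c" by (simp add: tbox_def)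
    have "0 \<le> u $ i \<and> u $ i < 1" for i
      using u[unfolded mem_box_cart, rule_format, of i] assms by (simp add: c_def)
    then show "u \<in> to_torus -` tbox 0 c \<inter> unit_cube" using 1 by (simp add: unit_cube_def)
  qed
  have "measure haar (tcube \<rho> :: 'd torus set) = measure haar (tbox 0 c)"
    using measure_haar_translate[of "tcube \<rho>" "- to_torus a"] eq by simp
  also have "\<dots> = measure lborel (cbox 0 c)"
    unfolding measure_def by (subst emeasure_haar) (simp_all add: pre)
  also have "\<dots> = (\<Prod>i\<in>(UNIV::'d set). c $ i - 0 $ i)"
    using assms by (subst content_cbox_cart) (auto simp: c_def interval_ne_empty_cart)
  also have "\<dots> = (2 * \<rho>) ^ CARD('d)" by (simp add: c_def)
  finally show ?thesis .
qed

lemma measure_haar_tcube_le: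
  assumes "0 \<le> \<rho>"
  shows "measure haar (tcube \<rho> :: 'd::finite torus set) \<le> (2 * \<rho>) ^ CARD('d)"
proof (cases "\<rho> < 1 / 2")
  case False
  then have "(1 :: real) \<le> (2 * \<rho>) ^ CARD('d)" by (intro one_le_power) simp
  then show ?thesis using haar.prob_le_1[of "tcube \<rho> :: 'd torus set"] by linarith
qed (simp add: measure_haar_tcube_eq assms)

text \<open>
  The image of Haar measure under a surjective endomorphism is a translation invariant probability
  measure, and such a measure equals Haar measure: integrate the indicator of \<open>A\<close> at \<open>x + y\<close> against
  both measures in both orders.
\<close>

lemma emeasure_haar_zmul:
  assumes k: "k \<noteq> 0" and A: "A \<in> sets borel"
  shows "emeasure haar (zmul k -` A) = emeasure haar (A :: 'd::finite torus set)"
proof -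
  define \<mu> where "\<mu> = distr haar borel (zmul k :: 'd torus \<Rightarrow> _)"
  interpret \<mu>: prob_space \<mu> unfolding \<mu>_def by (rule haar.prob_space_distr) simp
  interpret P: pair_prob_space \<mu> haar ..
  have [measurable_cong]: "sets \<mu> = sets borel" by (simp add: \<mu>_def)
  note A [measurable]
  have em: "emeasure \<mu> B = emeasure haar (zmul k -` B)" if "B \<in> sets borel" for B
    using that by (simp add: \<mu>_def emeasure_distr)
  have inv: "emeasure \<mu> {x. x + y \<in> A} = emeasure \<mu> A" for y
  proof -
    obtain z where z: "zmul k z = y" using zmul_surj[OF k] by blast
    have "emeasure \<mu> {x. x + y \<in> A} = emeasure haar ((\<lambda>x. x + z) -` (zmul k -` A))"
      by (subst em) (auto simp: z[symmetric] zmul_add_right intro!: arg_cong[where f="emeasure haar"])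
    also have "\<dots> = emeasure haar (zmul k -` A)"
      using measurable_sets[OF measurable_zmul A] by (intro emeasure_haar_translate) simp
    finally show ?thesis using em[OF A] by simp
  qed
  have "emeasure haar A = (\<integral>\<^sup>+x. emeasure haar ((\<lambda>y. y + x) -` A) \<partial>\<mu>)"
    using emeasure_haar_translate[OF A] \<mu>.emeasure_space_1 by simp
  also have "\<dots> = (\<integral>\<^sup>+x. \<integral>\<^sup>+y. indicator A (x + y) \<partial>haar \<partial>\<mu>)"
  proof (rule nn_integral_cong)
    fix x
    have "(\<integral>\<^sup>+y. indicator A (x + y) \<partial>haar) = (\<integral>\<^sup>+y. indicator ((\<lambda>y. y + x) -` A) y \<partial>haar)"
      by (intro nn_integral_cong) (auto simp: indicator_def add.commute)
    also have "\<dots> = emeasure haar ((\<lambda>y. y + x) -` A)"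
      by (rule nn_integral_indicator) (use measurable_sets[of "\<lambda>y. y + x" borel borel A] A in simp)
    finally show "emeasure haar ((\<lambda>y. y + x) -` A) = (\<integral>\<^sup>+y. indicator A (x + y) \<partial>haar)" by simp
  qed
  also have "\<dots> = (\<integral>\<^sup>+y. \<integral>\<^sup>+x. indicator A (x + y) \<partial>\<mu> \<partial>haar)"
    by (rule P.Fubini'[symmetric]) measurable
  also have "\<dots> = (\<integral>\<^sup>+y. emeasure \<mu> {x. x + y \<in> A} \<partial>(haar :: 'd torus measure))"
  proof (rule nn_integral_cong)
    fix y
    have "(\<integral>\<^sup>+x. indicator A (x + y) \<partial>\<mu>) = (\<integral>\<^sup>+x. indicator {x. x + y \<in> A} x \<partial>\<mu>)"
      by (intro nn_integral_cong) (auto simp: indicator_def)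
    also have "\<dots> = emeasure \<mu> {x. x + y \<in> A}"
      by (rule nn_integral_indicator) measurable
    finally show "(\<integral>\<^sup>+x. indicator A (x + y) \<partial>\<mu>) = emeasure \<mu> {x. x + y \<in> A}" .
  qed
  also have "\<dots> = emeasure \<mu> A" using haar.emeasure_space_1[where 'd = 'd] inv by simp
  finally show ?thesis using em[OF A] by simp
qed

lemma measure_haar_zmul:
  "k \<noteq> 0 \<Longrightarrow> A \<in> sets borel \<Longrightarrow> measure haar {x. zmul k x \<in> A} = measure haar (A :: 'd::finite torus set)"
  using emeasure_haar_zmul[of k A] by (simp add: measure_def vimage_def)

interpretation haar2: pair_prob_space haar "haar :: 'd::finite torus measure" ..

text \<open>
  Fixing \<open>\<alpha>\<close> and translating \<open>w\<close> by \<open>j \<alpha>\<close> reduces to \<open>j = 0\<close>; then, for fixed \<open>w\<close>, the point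
  \<open>w + h \<alpha>\<close> with \<open>h \<noteq> 0\<close> is Haar distributed.
\<close>

lemma orbit_pair_independent:
  fixes A B :: "'d::finite torus set"
  assumes "j \<noteq> k" and [measurable]: "A \<in> sets borel" "B \<in> sets borel"
  shows "measure (haar \<Otimes>\<^sub>M haar) {(\<alpha>, w). w + zmul j \<alpha> \<in> A \<and> w + zmul k \<alpha> \<in> B}
    = measure haar A * measure haar B"
proof -
  let ?P = "haar \<Otimes>\<^sub>M haar :: ('d torus \<times> 'd torus) measure"
  have ev: "{(\<alpha>, w). w + zmul j \<alpha> \<in> A \<and> w + zmul k \<alpha> \<in> B} \<in> sets ?P" for j k
  proof -
    have "{p \<in> space ?P. snd p + zmul j (fst p) \<in> A \<and> snd p + zmul k (fst p) \<in> B} \<in> sets ?P"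
      by measurable
    then show ?thesis by (simp add: space_pair_measure case_prod_beta')
  qed
  define h where "h = k - j"
  have h: "h \<noteq> 0" using assms by (simp add: h_def)
  have "emeasure ?P {(\<alpha>, w). w + zmul j \<alpha> \<in> A \<and> w + zmul k \<alpha> \<in> B}
      = (\<integral>\<^sup>+\<alpha>. emeasure haar {w. w + zmul j \<alpha> \<in> A \<and> w + zmul k \<alpha> \<in> B} \<partial>haar)"
    by (subst haar.emeasure_pair_measure_alt[OF ev]) (simp add: vimage_def)
  also have "\<dots> = (\<integral>\<^sup>+\<alpha>. emeasure haar {w. w \<in> A \<and> w + zmul h \<alpha> \<in> B} \<partial>haar)"
  proof (rule nn_integral_cong)
    fix \<alpha> :: "'d torus"
    have 1: "(\<lambda>w. w + zmul j \<alpha>) -` {w. w \<in> A \<and> w + zmul h \<alpha> \<in> B} = {w. w + zmul j \<alpha> \<in> A \<and> w + zmul k \<alpha> \<in> B}"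
      by (auto simp: h_def zmul_diff_left add.assoc)
    have 2: "{w. w \<in> A \<and> w + zmul h \<alpha> \<in> B} \<in> sets borel" by measurable
    show "emeasure haar {w. w + zmul j \<alpha> \<in> A \<and> w + zmul k \<alpha> \<in> B} = emeasure haar {w. w \<in> A \<and> w + zmul h \<alpha> \<in> B}"
      using emeasure_haar_translate[OF 2, of "zmul j \<alpha>"] unfolding 1 .
  qed
  also have "\<dots> = emeasure ?P {(\<alpha>, w). w \<in> A \<and> w + zmul h \<alpha> \<in> B}"
    using haar.emeasure_pair_measure_alt[OF ev[of 0 h]] by (simp add: vimage_def)
  also have "\<dots> = (\<integral>\<^sup>+w. emeasure haar {\<alpha>. w \<in> A \<and> w + zmul h \<alpha> \<in> B} \<partial>haar)"
    using haar2.emeasure_pair_measure_alt2[OF ev[of 0 h]] by (simp add: vimage_def)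
  also have "\<dots> = (\<integral>\<^sup>+w. emeasure haar B * indicator A w \<partial>haar)"
  proof (rule nn_integral_cong)
    fix w :: "'d torus"
    have m: "{x. x + w \<in> B} \<in> sets borel" by measurable
    have "emeasure haar {\<alpha>. w + zmul h \<alpha> \<in> B} = emeasure haar (zmul h -` {x. x + w \<in> B})"
      by (simp add: vimage_def add.commute)
    also have "\<dots> = emeasure haar B"
      using emeasure_haar_zmul[OF h m] emeasure_haar_translate[of B w] by (simp add: vimage_def)
    finally show "emeasure haar {\<alpha>. w \<in> A \<and> w + zmul h \<alpha> \<in> B} = emeasure haar B * indicator A w"
      by (auto simp: indicator_def)
  qed
  also have "\<dots> = emeasure haar A * emeasure haar B"
    by (subst nn_integral_cmult_indicator) (simp_all add: mult.commute)
  finally show ?thesis by (simp add: measure_def enn2real_mult)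
qed

section \<open>Torsion points and the correlation of two multiples\<close>

definition torsion_index :: "nat \<Rightarrow> (int ^ 'd::finite) set" where
  "torsion_index q = {p. \<forall>i. p $ i \<in> {0..<int q}}"

definition torsion_point :: "nat \<Rightarrow> int ^ 'd \<Rightarrow> 'd::finite torus" where
  "torsion_point q p = to_torus (\<chi> i. of_int (p $ i) / of_nat q)"

lemma vec_set_product:
  fixes S :: "'d::finite \<Rightarrow> int set"
  assumes "\<And>i. finite (S i)"
  shows "finite {p :: int ^ 'd. \<forall>i. p $ i \<in> S i}"
    and "card {p :: int ^ 'd. \<forall>i. p $ i \<in> S i} = (\<Prod>i\<in>UNIV. card (S i))"
proof -
  have eq: "{p :: int ^ 'd. \<forall>i. p $ i \<in> S i} = vec_lambda ` (\<Pi>\<^sub>E i\<in>UNIV. S i)"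
  proof safe
    fix p :: "int ^ 'd" assume "\<forall>i. p $ i \<in> S i"
    then show "p \<in> vec_lambda ` (\<Pi>\<^sub>E i\<in>UNIV. S i)"
      by (intro image_eqI[of _ _ "vec_nth p"]) (auto simp: PiE_UNIV_domain)
  qed (auto simp: PiE_UNIV_domain)
  have inj: "inj_on vec_lambda (\<Pi>\<^sub>E i\<in>(UNIV::'d set). S i)"
    by (rule inj_onI) (metis vec_lambda_inverse iso_tuple_UNIV_I)
  show "finite {p :: int ^ 'd. \<forall>i. p $ i \<in> S i}"
    unfolding eq using assms by (intro finite_imageI finite_PiE) auto
  show "card {p :: int ^ 'd. \<forall>i. p $ i \<in> S i} = (\<Prod>i\<in>UNIV. card (S i))"
    unfolding eq card_image[OF inj] by (rule card_PiE) simp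
qed

lemma torsion_index: "finite (torsion_index q :: (int ^ 'd::finite) set)"
  "card (torsion_index q :: (int ^ 'd::finite) set) = q ^ CARD('d)"
  using vec_set_product[of "\<lambda>_ :: 'd. {0..<int q}"] by (simp_all add: torsion_index_def)

lemma card_ints_between:
  fixes x y :: real assumes "x \<le> y"
  shows "finite {n :: int. x \<le> n \<and> n \<le> y}" "real (card {n :: int. x \<le> n \<and> n \<le> y}) \<le> y - x + 1"
proof -
  have eq: "{n :: int. x \<le> n \<and> n \<le> y} = {\<lceil>x\<rceil>..\<lfloor>y\<rfloor>}" by (auto simp: le_floor_iff ceiling_le_iff)
  show "finite {n :: int. x \<le> n \<and> n \<le> y}" unfolding eq by simp
  show "real (card {n :: int. x \<le> n \<and> n \<le> y}) \<le> y - x + 1"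
    unfolding eq using assms by (simp) linarith
qed

text \<open>
  The integers \<open>j p + q z\<close> lie in an interval of length \<open>q (b - a)\<close>, and they determine \<open>p\<close> modulo \<open>q\<close>
  because \<open>j\<close> is invertible modulo \<open>q\<close>.
\<close>

lemma card_residues_in_arc:
  fixes a b t :: real
  assumes q: "q > 0" and cop: "coprime j (int q)" and "a \<le> b"
  shows "real (card {p \<in> {0..<int q}. \<exists>z::int. a \<le> of_int j * (t + of_int p / q) + z \<and> of_int j * (t + of_int p / q) + z \<le> b})
    \<le> q * (b - a) + 1" (is "real (card ?S) \<le> _")
proof -
  define x where "x = q * (a - of_int j * t)"
  define y where "y = q * (b - of_int j * t)"
  have xy: "x \<le> y" unfolding x_def y_def using \<open>a \<le> b\<close> q by (intro mult_left_mono) auto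
  let ?N = "{n :: int. x \<le> n \<and> n \<le> y}"
  have ex: "\<exists>n\<in>?N. n mod int q = (j * p) mod int q" if p: "p \<in> ?S" for p
  proof -
    obtain z :: int where z: "a \<le> of_int j * (t + of_int p / q) + z" "of_int j * (t + of_int p / q) + z \<le> b"
      using p by blast
    have e: "real_of_int (j * p + int q * z) = q * (of_int j * (t + of_int p / q) + z - of_int j * t)"
      using q by (simp add: field_simps)
    have "x \<le> of_int (j * p + int q * z)"
      unfolding e x_def using z q by (intro mult_left_mono) auto
    moreover have "of_int (j * p + int q * z) \<le> y"
      unfolding e y_def using z q by (intro mult_left_mono) auto
    moreover have "(j * p + int q * z) mod int q = (j * p) mod int q" by simp
    ultimately show ?thesis by blast
  qed
  define f where "f p = (SOME n. n \<in> ?N \<and> n mod int q = (j * p) mod int q)" for p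
  have f: "f p \<in> ?N \<and> f p mod int q = (j * p) mod int q" if "p \<in> ?S" for p
    unfolding f_def by (rule someI_ex) (use ex[OF that] in blast)
  have "inj_on f ?S"
  proof (rule inj_onI)
    fix p p' assume p: "p \<in> ?S" "p' \<in> ?S" "f p = f p'"
    then have "(j * p) mod int q = (j * p') mod int q" using f[OF p(1)] f[OF p(2)] by simp
    then have "int q dvd j * (p - p')" by (simp add: mod_eq_dvd_iff right_diff_distrib)
    then have "int q dvd p - p'"
      using cop by (simp add: coprime_dvd_mult_right_iff coprime_commute)
    then have "p mod int q = p' mod int q" by (simp add: mod_eq_dvd_iff)
    then show "p = p'" using p(1,2) by simp
  qed
  then have "card ?S \<le> card ?N"
  proof (rule card_inj_on_le)
    show "f ` ?S \<subseteq> ?N" using f by blast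
    show "finite ?N" by (rule card_ints_between(1)[OF xy])
  qed
  then have "real (card ?S) \<le> y - x + 1" using card_ints_between(2)[OF xy] by linarith
  also have "y - x = q * (b - a)" by (simp add: x_def y_def algebra_simps)
  finally show ?thesis .
qed

lemma card_torsion_in_box:
  fixes a b :: "real ^ 'd::finite"
  assumes q: "q > 0" and cop: "coprime j (int q)" and ab: "\<And>i. a $ i \<le> b $ i"
  shows "real (card {p \<in> torsion_index q. zmul j (x + torsion_point q p) \<in> tbox a b})
    \<le> (\<Prod>i\<in>UNIV. q * (b $ i - a $ i) + 1)"
proof -
  obtain t where t: "to_torus t = x" using to_torus_surj by blast
  define S where "S i = {p \<in> {0..<int q}. \<exists>z::int. a $ i \<le> of_int j * (t $ i + of_int p / q) + z
      \<and> of_int j * (t $ i + of_int p / q) + z \<le> b $ i}" for i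
  have sub: "{p \<in> torsion_index q. zmul j (x + torsion_point q p) \<in> tbox a b} \<subseteq> {p. \<forall>i. p $ i \<in> S i}"
  proof safe
    fix p i assume p: "p \<in> torsion_index q" "zmul j (x + torsion_point q p) \<in> tbox a b"
    define u :: "real ^ 'd" where "u = of_int j *\<^sub>R (t + (\<chi> i. of_int (p $ i) / of_nat q))"
    have "to_torus u \<in> tbox a b"
      using p(2) by (simp add: u_def zmul_to_torus[symmetric] torsion_point_def t to_torus_add)
    then obtain v where v: "to_torus v = to_torus u" "v \<in> cbox a b" by (auto simp: tbox_def)
    then have "v $ i - u $ i \<in> \<int>" using to_torus_eq_iff by blast
    then obtain z where "v $ i - u $ i = of_int z" by (rule Ints_cases)
    then have "v $ i = of_int j * (t $ i + of_int (p $ i) / q) + z" by (simp add: u_def)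
    moreover have "a $ i \<le> v $ i" "v $ i \<le> b $ i" using v(2) by (auto simp: mem_box_cart)
    ultimately show "p $ i \<in> S i" using p(1) unfolding S_def torsion_index_def by auto
  qed
  have fin: "finite (S i)" for i by (rule finite_subset[of _ "{0..<int q}"]) (auto simp: S_def)
  have "card {p \<in> torsion_index q. zmul j (x + torsion_point q p) \<in> tbox a b} \<le> (\<Prod>i\<in>UNIV. card (S i))"
    using card_mono[OF vec_set_product(1)[of S] sub] vec_set_product(2)[of S] fin by simp
  then have "real (card {p \<in> torsion_index q. zmul j (x + torsion_point q p) \<in> tbox a b}) \<le> (\<Prod>i\<in>UNIV. real (card (S i)))"
    by (simp only: of_nat_prod[symmetric] of_nat_le_iff)
  also have "\<dots> \<le> (\<Prod>i\<in>UNIV. q * (b $ i - a $ i) + 1)"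
    unfolding S_def by (intro prod_mono conjI card_residues_in_arc q cop ab) simp
  finally show ?thesis .
qed

text \<open>
  Averaging over the translates of a point \<open>x\<close> of \<open>A\<close> by the \<open>q\<close>-torsion points, all of which
  remain in \<open>A\<close>, compares the measure of the box with the number of translates that \<open>j\<close> sends into it.
  This one estimate yields both the correlation bound (take for \<open>A\<close> the preimage of a cube under
  multiplication by \<open>q\<close>) and the zero-one law (take \<open>j = 1\<close> and let \<open>q\<close> tend to infinity).
\<close>

lemma measure_torsion_invariant_inter_box:
  fixes A :: "'d::finite torus set" and a b :: "real ^ 'd"
  assumes q: "q > 0" and cop: "coprime j (int q)" and ab: "\<And>i. a $ i \<le> b $ i"
    and A [measurable]: "A \<in> sets borel"
    and inv: "\<And>x p. x + torsion_point q p \<in> A \<longleftrightarrow> x \<in> A"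
  shows "measure haar {x. x \<in> A \<and> zmul j x \<in> tbox a b}
    \<le> measure haar A * (\<Prod>i\<in>UNIV. b $ i - a $ i + 1 / q)"
proof -
  define D where "D = {x. x \<in> A \<and> zmul j x \<in> tbox a b}"
  have D [measurable]: "D \<in> sets borel" unfolding D_def by measurable
  let ?I = "torsion_index q :: (int ^ 'd) set"
  let ?c = "\<Prod>i\<in>(UNIV :: 'd set). q * (b $ i - a $ i) + 1"
  have Dp [measurable]: "{x. x + torsion_point q p \<in> D} \<in> sets haar" for p by simp
  have "q ^ CARD('d) * measure haar D = (\<Sum>p\<in>?I. measure haar {x. x + torsion_point q p \<in> D})"
    by (simp add: measure_haar_translate torsion_index)
  also have "\<dots> = (\<integral>x. (\<Sum>p\<in>?I. indicator {x. x + torsion_point q p \<in> D} x) \<partial>haar)"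
    by (subst Bochner_Integration.integral_sum) (auto simp: haar.emeasure_eq_measure)
  also have "\<dots> \<le> (\<integral>x. ?c * indicator A x \<partial>haar)"
  proof (rule integral_mono)
    fix x :: "'d torus"
    have "(\<Sum>p\<in>?I. indicator {x. x + torsion_point q p \<in> D} x :: real)
        = card {p \<in> ?I. x + torsion_point q p \<in> D}"
      using torsion_index(1) by (simp add: indicator_def of_bool_def sum.If_cases[OF torsion_index(1)] Int_def)
    also have "\<dots> \<le> ?c * indicator A x"
    proof (cases "x \<in> A")
      case True
      have "{p \<in> ?I. x + torsion_point q p \<in> D} \<subseteq> {p \<in> ?I. zmul j (x + torsion_point q p) \<in> tbox a b}"
        unfolding D_def by blast
      then have "card {p \<in> ?I. x + torsion_point q p \<in> D} \<le> card {p \<in> ?I. zmul j (x + torsion_point q p) \<in> tbox a b}"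
        by (intro card_mono) (auto intro: finite_subset[OF _ torsion_index(1)])
      then show ?thesis using True card_torsion_in_box[OF q cop ab, of x] by simp
    qed (simp add: D_def inv)
    finally show "(\<Sum>p\<in>?I. indicator {x. x + torsion_point q p \<in> D} x :: real) \<le> ?c * indicator A x" .
  qed (auto simp: haar.emeasure_eq_measure intro!: Bochner_Integration.integrable_sum)
  also have "\<dots> = measure haar A * ?c" by simp
  also have "?c = (\<Prod>i\<in>(UNIV :: 'd set). q * (b $ i - a $ i + 1 / q))"
    using q by (intro prod.cong) (auto simp: field_simps)
  also have "\<dots> = q ^ CARD('d) * (\<Prod>i\<in>(UNIV :: 'd set). b $ i - a $ i + 1 / q)"
    by (simp add: prod.distrib)
  finally show ?thesis using q unfolding D_def by (simp add: mult.left_commute)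
qed

text \<open>
  Since multiplication by \<open>gcd j k\<close> preserves Haar measure, \<open>j\<close> and \<open>k\<close> may be assumed coprime. The
  excess over the independent value is controlled by \<open>gcd j k / k\<close>.
\<close>

lemma measure_two_multiples_in_cubes:
  assumes jk: "j > 0" "k > 0" and \<rho>: "0 \<le> \<rho>" "0 \<le> \<rho>'"
  shows "measure haar {\<alpha> :: 'd::finite torus. zmul (int j) \<alpha> \<in> tcube \<rho> \<and> zmul (int k) \<alpha> \<in> tcube \<rho>'}
    \<le> (2 * \<rho>') ^ CARD('d) * (2 * \<rho> + real (gcd j k) / real k) ^ CARD('d)"
proof -
  define g where "g = gcd j k"
  define j' k' where "j' = j div g" and "k' = k div g"
  have g: "g > 0" "j = j' * g" "k = k' * g" using jk by (simp_all add: g_def j'_def k'_def)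
  have cop: "coprime j' k'" unfolding j'_def k'_def g_def using jk by (intro div_gcd_coprime) simp
  have k': "k' > 0" using g jk by (cases k') auto
  let ?A = "{\<beta> :: 'd torus. zmul (int k') \<beta> \<in> tcube \<rho>'}"
  have A: "?A \<in> sets borel" by measurable
  have m: "{\<beta> :: 'd torus. zmul (int j') \<beta> \<in> tcube \<rho> \<and> zmul (int k') \<beta> \<in> tcube \<rho>'} \<in> sets borel" by measurable
  have tor: "zmul (int k') (torsion_point k' p) = (0 :: 'd torus)" for p
    using k' unfolding torsion_point_def zmul_to_torus zero_torus.abs_eq to_torus_eq_iff by simp
  have "{\<alpha> :: 'd torus. zmul (int j) \<alpha> \<in> tcube \<rho> \<and> zmul (int k) \<alpha> \<in> tcube \<rho>'}
      = {\<alpha>. zmul (int g) \<alpha> \<in> {\<beta> :: 'd torus. zmul (int j') \<beta> \<in> tcube \<rho> \<and> zmul (int k') \<beta> \<in> tcube \<rho>'}}"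
    by (simp add: zmul_zmul g(2,3))
  then have "measure haar {\<alpha> :: 'd torus. zmul (int j) \<alpha> \<in> tcube \<rho> \<and> zmul (int k) \<alpha> \<in> tcube \<rho>'}
      = measure haar {\<beta> :: 'd torus. zmul (int j') \<beta> \<in> tcube \<rho> \<and> zmul (int k') \<beta> \<in> tcube \<rho>'}"
    using measure_haar_zmul[OF _ m, of "int g"] g by simp
  also have "\<dots> = measure haar {x. x \<in> ?A \<and> zmul (int j') x \<in> tbox (\<chi> i. - \<rho>) (\<chi> i. \<rho>)}"
    by (simp add: tcube_def conj_commute)
  also have "\<dots> \<le> measure haar ?A * (\<Prod>i\<in>(UNIV :: 'd set). (\<chi> i. \<rho>) $ i - (\<chi> i. - \<rho>) $ i + 1 / k')"
    using k' cop \<rho> A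
    by (intro measure_torsion_invariant_inter_box) (auto simp: zmul_add_right tor)
  also have "(\<Prod>i\<in>(UNIV :: 'd set). (\<chi> i. \<rho>) $ i - (\<chi> i. - \<rho>) $ i + 1 / k') = (2 * \<rho> + 1 / k') ^ CARD('d)"
    by simp
  also have "1 / real k' = real (gcd j k) / real k"
  proof -
    have "real k = real k' * real g" using g(3) by (metis of_nat_mult)
    then have "1 / real k' = real g / real k" using g(1) k' by simp
    then show ?thesis by (simp only: g_def)
  qed
  also have "measure haar ?A = measure haar (tcube \<rho>' :: 'd torus set)"
    using k' by (intro measure_haar_zmul) auto
  also have "measure haar (tcube \<rho>' :: 'd torus set) * (2 * \<rho> + real (gcd j k) / real k) ^ CARD('d)
      \<le> (2 * \<rho>') ^ CARD('d) * (2 * \<rho> + real (gcd j k) / real k) ^ CARD('d)"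
    using \<rho> by (intro mult_right_mono measure_haar_tcube_le zero_le_power) auto
  finally show ?thesis .
qed

lemma harm_le_ln: "n > 0 \<Longrightarrow> harm n \<le> 1 + ln (real n)"
proof (induction n rule: nat_induct_non_zero)
  case (Suc n)
  have "inverse (real (Suc n)) \<le> ln (real (Suc n)) - ln (real n)"
    using ln_le_minus_one[of "real n / real (Suc n)"] Suc by (simp add: ln_div field_simps)
  then show ?case using Suc by (simp add: harm_Suc)
qed (simp add: harm_def)

text \<open>
  Bound \<open>gcd j k\<close> by the sum of all common divisors \<open>e\<close> and sum over \<open>j\<close> and \<open>k\<close> first: a divisor \<open>e\<close>
  contributes at most \<open>J / e\<close> times a harmonic sum.
\<close>

lemma sum_gcd_div_le:
  assumes "K > 0"
  shows "(\<Sum>j=1..J. \<Sum>k=1..K. real (gcd j k) / k) \<le> J * (1 + ln (real K))\<^sup>2"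
proof -
  have g: "real (gcd j k) / k \<le> (\<Sum>e=1..K. if e dvd j \<and> e dvd k then real e / k else 0)"
    if "j \<in> {1..J}" "k \<in> {1..K}" for j k
  proof -
    have "gcd j k \<le> k" using that by (intro dvd_imp_le) auto
    then have "gcd j k \<in> {1..K}" using that by (auto simp: Suc_le_eq simp del: gcd_le1_nat gcd_le2_nat)
    then show ?thesis
      using member_le_sum[of "gcd j k" "{1..K}" "\<lambda>e. if e dvd j \<and> e dvd k then real e / k else 0"] by auto
  qed
  have mult: "card {j \<in> {1..J}. e dvd j} \<le> J div e" if "e \<in> {1..K}" for e
  proof -
    have "{j \<in> {1..J}. e dvd j} \<subseteq> (\<lambda>f. e * f) ` {1..J div e}"
    proof safe
      fix j assume "j \<in> {1..J}" "e dvd j"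
      then obtain f where "j = e * f" by blast
      with \<open>j \<in> {1..J}\<close> that show "j \<in> (\<lambda>f. e * f) ` {1..J div e}"
        by (auto intro!: imageI simp: less_eq_div_iff_mult_less_eq mult.commute Suc_le_eq)
    qed
    then have "card {j \<in> {1..J}. e dvd j} \<le> card ((\<lambda>f. e * f) ` {1..J div e})"
      by (intro card_mono) auto
    also have "\<dots> \<le> J div e" using card_image_le[of "{1..J div e}" "\<lambda>f. e * f"] by simp
    finally show ?thesis .
  qed
  have inner: "(\<Sum>k=1..K. if e dvd k then real e / k else 0) \<le> harm K" if e: "e \<in> {1..K}" for e
  proof -
    have "(\<Sum>k=1..K. if e dvd k then real e / k else 0) = (\<Sum>k\<in>{k\<in>{1..K}. e dvd k}. real e / k)"
      by (rule sum.inter_filter[symmetric]) simp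
    also have "\<dots> \<le> (\<Sum>k\<in>(\<lambda>f. e * f) ` {1..K}. real e / k)"
    proof (rule sum_mono2)
      show "{k \<in> {1..K}. e dvd k} \<subseteq> (\<lambda>f. e * f) ` {1..K}"
      proof safe
        fix k assume k: "k \<in> {1..K}" "e dvd k"
        then obtain f where f: "k = e * f" by blast
        then have "f \<ge> 1" using k by (cases f) auto
        moreover have "f \<le> K" using f k e by (metis One_nat_def Suc_le_eq atLeastAtMost_iff dvd_imp_le dvd_triv_right le_trans)
        ultimately show "k \<in> (\<lambda>f. e * f) ` {1..K}" using f by auto
      qed
    qed auto
    also have "\<dots> = (\<Sum>f=1..K. real e / (e * f))"
      using e by (subst sum.reindex) (auto simp: inj_on_def)
    also have "\<dots> = harm K" unfolding harm_def using e by (intro sum.cong) (auto simp: field_simps)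
    finally show ?thesis .
  qed
  have "(\<Sum>j=1..J. \<Sum>k=1..K. real (gcd j k) / k)
      \<le> (\<Sum>j=1..J. \<Sum>k=1..K. \<Sum>e=1..K. if e dvd j \<and> e dvd k then real e / k else 0)"
    by (intro sum_mono g) auto
  also have "\<dots> = (\<Sum>j=1..J. \<Sum>e=1..K. \<Sum>k=1..K. if e dvd j \<and> e dvd k then real e / k else 0)"
    by (intro sum.cong sum.swap refl)
  also have "\<dots> = (\<Sum>e=1..K. \<Sum>j=1..J. \<Sum>k=1..K. if e dvd j \<and> e dvd k then real e / k else 0)"
    by (rule sum.swap)
  also have "\<dots> = (\<Sum>e=1..K. \<Sum>j=1..J. if e dvd j then (\<Sum>k=1..K. if e dvd k then real e / k else 0) else 0)"
    by (intro sum.cong) auto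
  also have "\<dots> = (\<Sum>e=1..K. card {j \<in> {1..J}. e dvd j} * (\<Sum>k=1..K. if e dvd k then real e / k else 0))"
    by (intro sum.cong refl) (simp add: sum.If_cases Int_def)
  also have "\<dots> \<le> (\<Sum>e=1..K. (J / e) * harm K)"
  proof (intro sum_mono mult_mono inner)
    fix e assume e: "e \<in> {1..K}"
    have "real (card {j \<in> {1..J}. e dvd j}) \<le> real (J div e)" using mult[OF e] by simp
    also have "\<dots> \<le> real J / e" by (rule of_nat_div_le_of_nat)
    finally show "real (card {j \<in> {1..J}. e dvd j}) \<le> real J / e" .
  qed (auto intro!: sum_nonneg)
  also have "\<dots> = J * (harm K * harm K)"
    by (simp add: harm_def[of K] sum_distrib_left sum_distrib_right field_simps)
  also have "\<dots> \<le> J * ((1 + ln (real K)) * (1 + ln (real K)))"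
    using harm_le_ln[OF assms] harm_nonneg[of K, where 'a = real] assms by (intro mult_left_mono mult_mono) auto
  finally show ?thesis by (simp add: power2_eq_square)
qed

section \<open>A zero-one law for torsion-invariant sets\<close>

text \<open>
  By \<open>measure_torsion_invariant_inter_box\<close>, an invariant set \<open>A\<close> occupies at most the fraction
  \<open>measure haar A\<close> of every box. The same holds for the complement, so both bounds are equalities. Hence
  the restriction of Lebesgue measure to \<open>A\<close> and the multiple \<open>measure haar A\<close> of Lebesgue measure agree on
  boxes, thus on \<open>A\<close> itself, and \<open>measure haar A\<close> equals its own square.
\<close>

lemma zero_one_dyadic_torsion:
  fixes A :: "'d::finite torus set"
  assumes A: "A \<in> sets borel"
    and inv: "\<And>n x p. x + torsion_point (2 ^ n) p \<in> A \<longleftrightarrow> x \<in> A"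
  shows "measure haar A = 0 \<or> measure haar A = 1"
proof -
  have le: "measure haar {x. x \<in> S \<and> x \<in> tbox a b} \<le> measure haar S * (\<Prod>i\<in>UNIV. b $ i - a $ i)"
    if S: "S \<in> sets borel" "\<And>n x p. x + torsion_point (2 ^ n) p \<in> S \<longleftrightarrow> x \<in> S"
      and ab: "\<And>i. a $ i \<le> b $ i" for S :: "'d torus set" and a b :: "real ^ 'd"
  proof (rule LIMSEQ_le_const)
    have "(\<lambda>n. 1 / 2 ^ n :: real) \<longlonglongrightarrow> 0" by (rule LIMSEQ_divide_realpow_zero) simp
    then have "(\<lambda>n. measure haar S * (\<Prod>i\<in>UNIV. b $ i - a $ i + 1 / 2 ^ n))
        \<longlonglongrightarrow> measure haar S * (\<Prod>i\<in>UNIV. b $ i - a $ i + 0)"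
      by (intro tendsto_intros)
    then show "(\<lambda>n. measure haar S * (\<Prod>i\<in>UNIV. b $ i - a $ i + 1 / 2 ^ n))
        \<longlonglongrightarrow> measure haar S * (\<Prod>i\<in>UNIV. b $ i - a $ i)" by simp
    have "measure haar {x. x \<in> S \<and> zmul 1 x \<in> tbox a b} \<le> measure haar S * (\<Prod>i\<in>UNIV. b $ i - a $ i + 1 / real (2 ^ n))" for n
      using S ab by (intro measure_torsion_invariant_inter_box) auto
    then show "\<exists>N. \<forall>n\<ge>N. measure haar {x. x \<in> S \<and> x \<in> tbox a b} \<le> measure haar S * (\<Prod>i\<in>UNIV. b $ i - a $ i + 1 / 2 ^ n)"
      by simp
  qed
  define U :: "(real ^ 'd) set" where "U = unit_cube"
  define B where "B = to_torus -` A \<inter> U"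
  have [measurable]: "B \<in> sets borel" "U \<in> sets borel"
    using measurable_sets[OF measurable_to_torus A] by (auto simp: B_def U_def)
  have finU: "emeasure lborel (U \<inter> X) \<noteq> \<infinity>" "emeasure lborel (X \<inter> U) \<noteq> \<infinity>" for X
    using emeasure_mono[of "U \<inter> X" U lborel] emeasure_unit_cube[where 'd = 'd]
    by (auto simp: U_def Int_commute top_unique)
  have mU: "measure lborel U = 1" using emeasure_unit_cube[where 'd = 'd] by (simp add: U_def measure_def)
  have le2: "measure lborel (to_torus -` S \<inter> U \<inter> cbox a b) \<le> measure haar S * measure lborel (U \<inter> cbox a b)"
    if S: "S \<in> sets borel" "\<And>n x p. x + torsion_point (2 ^ n) p \<in> S \<longleftrightarrow> x \<in> S" for S and a b :: "real ^ 'd"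
  proof (cases "U \<inter> cbox a b = {}")
    case False
    \<comment> \<open>Clipping the box to \<open>[0, 1] ^ d\<close> makes its volume equal to that of its part in the
      fundamental domain.\<close>
    define a' b' :: "real ^ 'd" where "a' = (\<chi> i. max (a $ i) 0)" and "b' = (\<chi> i. min (b $ i) 1)"
    obtain u where u: "u \<in> U" "u \<in> cbox a b" using False by blast
    have ab: "a' $ i \<le> b' $ i" for i
      using u(1)[unfolded U_def unit_cube_def mem_Collect_eq, rule_format, of i]
        u(2)[unfolded mem_box_cart, rule_format, of i] by (simp add: a'_def b'_def)
    have T: "{x. x \<in> S \<and> x \<in> tbox a' b'} \<in> sets borel" using S(1) by measurable
    have "measure lborel (to_torus -` S \<inter> U \<inter> cbox a b)
        \<le> measure lborel (to_torus -` {x. x \<in> S \<and> x \<in> tbox a' b'} \<inter> U)"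
    proof (rule measure_mono_fmeasurable)
      show "to_torus -` S \<inter> U \<inter> cbox a b \<subseteq> to_torus -` {x. x \<in> S \<and> x \<in> tbox a' b'} \<inter> U"
        by (auto simp: tbox_def a'_def b'_def U_def unit_cube_def mem_box_cart less_imp_le)
      show "to_torus -` S \<inter> U \<inter> cbox a b \<in> sets lborel"
        using measurable_sets[OF measurable_to_torus S(1)] by simp
      show "to_torus -` {x. x \<in> S \<and> x \<in> tbox a' b'} \<inter> U \<in> fmeasurable lborel"
        using measurable_sets[OF measurable_to_torus T] finU by (auto intro!: fmeasurableI simp: less_top)
    qed
    also have "\<dots> = measure haar {x. x \<in> S \<and> x \<in> tbox a' b'}"
      using emeasure_haar[OF T] by (simp add: measure_def U_def)
    also have "\<dots> \<le> measure haar S * (\<Prod>i\<in>UNIV. b' $ i - a' $ i)" by (rule le[OF S ab])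
    also have "(\<Prod>i\<in>UNIV. b' $ i - a' $ i) = measure lborel (box a' b')"
    proof -
      have "measure lborel (cbox a' b') = (\<Prod>i\<in>UNIV. b' $ i - a' $ i)"
        using ab by (intro content_cbox_cart) (simp add: interval_ne_empty_cart)
      then show ?thesis by (simp add: measure_lborel_box_eq measure_lborel_cbox_eq)
    qed
    also have "measure lborel (box a' b') \<le> measure lborel (U \<inter> cbox a b)"
    proof (rule measure_mono_fmeasurable)
      show "box a' b' \<subseteq> U \<inter> cbox a b"
        by (auto simp: a'_def b'_def U_def unit_cube_def mem_box_cart less_imp_le)
      show "U \<inter> cbox a b \<in> fmeasurable lborel"
        using finU by (auto intro!: fmeasurableI simp: less_top)
    qed simp
    finally show ?thesis by (simp add: mult_left_mono)
  qed (simp add: Int_assoc)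
  have eq: "measure lborel (B \<inter> cbox a b) = measure haar A * measure lborel (U \<inter> cbox a b)" for a b
  proof (rule antisym)
    show "measure lborel (B \<inter> cbox a b) \<le> measure haar A * measure lborel (U \<inter> cbox a b)"
      unfolding B_def by (rule le2[OF A inv])
    have 1: "measure haar (- A) = 1 - measure haar A" using haar.prob_compl[of A] A by (simp add: Compl_eq_Diff_UNIV)
    have "measure lborel (to_torus -` (- A) \<inter> U \<inter> cbox a b) \<le> measure haar (- A) * measure lborel (U \<inter> cbox a b)"
      using A inv by (intro le2) auto
    moreover have "measure lborel (U \<inter> cbox a b) = measure lborel (B \<inter> cbox a b) + measure lborel (to_torus -` (- A) \<inter> U \<inter> cbox a b)"
    proof -
      have 1: "U \<inter> cbox a b = (B \<inter> cbox a b) \<union> (to_torus -` (- A) \<inter> U \<inter> cbox a b)" by (auto simp: B_def)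
      have 2: "to_torus -` (- A) \<inter> U \<inter> cbox a b \<in> sets lborel" "B \<inter> cbox a b \<in> sets lborel"
        using measurable_sets[OF measurable_to_torus, of "- A"] A by simp_all
      have 3: "(B \<inter> cbox a b) \<inter> (to_torus -` (- A) \<inter> U \<inter> cbox a b) = {}" by (auto simp: B_def)
      have "emeasure lborel (B \<inter> cbox a b) \<noteq> \<infinity>" "emeasure lborel (to_torus -` (- A) \<inter> U \<inter> cbox a b) \<noteq> \<infinity>"
        using finU[of "to_torus -` A \<inter> cbox a b"] finU[of "to_torus -` (- A) \<inter> cbox a b"]
        by (simp_all add: B_def Int_ac)
      then show ?thesis unfolding 1 by (intro measure_Union 2 3)
    qed
    ultimately show "measure haar A * measure lborel (U \<inter> cbox a b) \<le> measure lborel (B \<inter> cbox a b)"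
      unfolding 1 by (simp add: algebra_simps)
  qed
  define N1 where "N1 = density lborel (indicator B :: real ^ 'd \<Rightarrow> ennreal)"
  define N2 where "N2 = density lborel (\<lambda>x :: real ^ 'd. ennreal (measure haar A) * indicator U x)"
  have N1: "emeasure N1 X = emeasure lborel (B \<inter> X)" if "X \<in> sets borel" for X
    unfolding N1_def using that by (subst emeasure_density) (auto simp: indicator_inter_arith[symmetric])
  have N2: "emeasure N2 X = ennreal (measure haar A) * emeasure lborel (U \<inter> X)" if "X \<in> sets borel" for X
    unfolding N2_def using that
    by (subst emeasure_density) (auto simp: mult.assoc indicator_inter_arith[symmetric] nn_integral_cmult)
  have "N1 = N2"
  proof (rule measure_eqI_generator_eq[where \<Omega> = UNIV and E = "range (\<lambda>(a, b). {a..b :: real ^ 'd})"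
        and A = "\<lambda>n. cbox (\<chi> i. - real n) (\<chi> i. real n)"])
    show "Int_stable (range (\<lambda>(a, b). {a..b :: real ^ 'd}))"
    proof (rule Int_stableI_image)
      fix p q :: "(real ^ 'd) \<times> (real ^ 'd)"
      have "(case p of (a, b) \<Rightarrow> {a..b}) \<inter> (case q of (a, b) \<Rightarrow> {a..b})
          = {(\<chi> i. max (fst p $ i) (fst q $ i)) .. (\<chi> i. min (snd p $ i) (snd q $ i))}"
        using Int_interval_cart[of "fst p" "snd p" "fst q" "snd q"] by (simp add: case_prod_beta interval_cbox)
      then show "\<exists>k\<in>UNIV. (case p of (a, b) \<Rightarrow> {a..b}) \<inter> (case q of (a, b) \<Rightarrow> {a..b})
          = (case k of (a, b) \<Rightarrow> {a..b})"
        by (intro bexI[of _ "(\<chi> i. max (fst p $ i) (fst q $ i), \<chi> i. min (snd p $ i) (snd q $ i))"]) simp_all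
    qed
    have s: "sets (borel :: (real ^ 'd) measure) = sigma_sets UNIV (range (\<lambda>(a, b). {a..b}))"
      unfolding borel_eq_atLeastAtMost by (rule sets_measure_of) simp
    then show "sets N1 = sigma_sets UNIV (range (\<lambda>(a, b). {a..b :: real ^ 'd}))"
      "sets N2 = sigma_sets UNIV (range (\<lambda>(a, b). {a..b :: real ^ 'd}))" by (simp_all add: N1_def N2_def)
    show "range (\<lambda>n. cbox (\<chi> i. - real n) (\<chi> i. real n)) \<subseteq> range (\<lambda>(a, b). {a..b :: real ^ 'd})"
      by (auto simp: interval_cbox)
    show "(\<Union>n. cbox (\<chi> i. - real n) (\<chi> i. real n)) = (UNIV :: (real ^ 'd) set)"
    proof safe
      fix x :: "real ^ 'd"
      obtain n where "norm x \<le> real n" using real_arch_simple by blast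
      then have "\<bar>x $ i\<bar> \<le> real n" for i using component_le_norm_cart[of x i] by linarith
      then show "x \<in> (\<Union>n. cbox (\<chi> i. - real n) (\<chi> i. real n))"
        by (auto simp: mem_box_cart abs_le_iff minus_le_iff intro!: exI[of _ n])
    qed simp
    show "emeasure N1 (cbox (\<chi> i. - real n) (\<chi> i. real n)) \<noteq> \<infinity>" for n
      using finU[of "to_torus -` A \<inter> cbox (\<chi> i. - real n) (\<chi> i. real n)"]
      by (simp add: N1 B_def Int_ac)
    fix X assume "X \<in> range (\<lambda>(a, b). {a..b :: real ^ 'd})"
    then obtain a b where X: "X = cbox a b" by (auto simp: interval_cbox)
    have "emeasure lborel (B \<inter> cbox a b) = ennreal (measure lborel (B \<inter> cbox a b))"
      using finU[of "to_torus -` A \<inter> cbox a b"] by (simp add: emeasure_eq_ennreal_measure B_def Int_ac)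
    also have "\<dots> = ennreal (measure haar A) * ennreal (measure lborel (U \<inter> cbox a b))"
      by (simp add: eq ennreal_mult)
    also have "\<dots> = ennreal (measure haar A) * emeasure lborel (U \<inter> cbox a b)"
      using finU by (simp add: emeasure_eq_ennreal_measure)
    finally show "emeasure N1 X = emeasure N2 X" by (simp add: N1 N2 X)
  qed simp
  then have "emeasure lborel (B \<inter> B) = ennreal (measure haar A) * emeasure lborel (U \<inter> B)"
    using N1[of B] N2[of B] by simp
  moreover have "U \<inter> B = B" by (auto simp: B_def)
  moreover have "emeasure lborel B = ennreal (measure haar A)"
    using emeasure_haar[OF A] by (simp add: B_def U_def haar.emeasure_eq_measure)
  ultimately have "measure haar A = measure haar A * measure haar A"
    by (simp add: ennreal_mult'[symmetric])
  then show ?thesis by auto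
qed

section \<open>Second moment arguments\<close>

lemma not_summable_filterlim_sum:
  fixes f :: "nat \<Rightarrow> real"
  assumes "\<And>n. f n \<ge> 0" "\<not> summable f"
  shows "filterlim (\<lambda>n. \<Sum>i<n. f i) at_top sequentially"
  unfolding filterlim_at_top eventually_sequentially
proof
  fix Z :: real
  have "\<not> (\<forall>n. (\<Sum>i<n. f i) \<le> Z)"
    using summableI_nonneg_bounded[of f Z] assms by blast
  then obtain N where N: "(\<Sum>i<N. f i) > Z" by (auto simp: not_le)
  have "(\<Sum>i<N. f i) \<le> (\<Sum>i<n. f i)" if "n \<ge> N" for n
    using that assms(1) by (intro sum_mono2) auto
  then show "\<exists>N. \<forall>n\<ge>N. Z \<le> (\<Sum>i<n. f i)"
    using N by (intro exI[of _ N]) (smt (verit))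
qed

text \<open>
  The weighted Kochen--Stone inequality. Let \<open>S n\<close> be the partial sum of \<open>n\<close> weighted indicators from the
  index \<open>N\<close> on, and \<open>e n\<close> its expectation. By hypothesis the second moment is at most \<open>C * e n * e n + e n\<close>, so by the
  Paley--Zygmund argument, once \<open>e n > m\<close>, the sum \<open>S n\<close> exceeds \<open>m\<close> with probability at least
  \<open>(e n - m)\<^sup>2 / (C * e n * e n + e n)\<close>, which tends to \<open>1 / C\<close> if \<open>C > 0\<close>.
\<close>

lemma (in prob_space) kochen_stone_weighted:
  fixes F :: "nat \<Rightarrow> 'a set" and c :: "nat \<Rightarrow> real"
  assumes F [measurable]: "\<And>i. F i \<in> events"
    and c: "\<And>i. 0 \<le> c i" "\<And>i. c i \<le> 1"
    and div: "\<not> summable (\<lambda>i. c i * prob (F i))"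
    and "C \<ge> 0"
    and corr: "\<And>i l. N \<le> i \<Longrightarrow> i < l \<Longrightarrow> c i > 0 \<Longrightarrow> c l > 0 \<Longrightarrow>
      prob (F i \<inter> F l) \<le> C * prob (F i) * prob (F l)"
  shows "1 \<le> C * prob {x \<in> space M. \<not> summable (\<lambda>i. c i * indicator (F i) x)}"
proof -
  define S where "S n x = (\<Sum>i<n. c (i + N) * indicator (F (i + N)) x :: real)" for n x
  define e where "e n = (\<Sum>i<n. c (i + N) * prob (F (i + N)))" for n
  have [measurable]: "S n \<in> borel_measurable M" for n unfolding S_def by measurable
  have int_ind: "integrable M (indicator A :: 'a \<Rightarrow> real)" if "A \<in> events" for A
    using that by (simp add: emeasure_eq_measure)
  have intS: "integrable M (S n)" for n
    unfolding S_def by (intro Bochner_Integration.integrable_sum integrable_mult_right int_ind F)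
  have ES: "expectation (S n) = e n" for n
    unfolding S_def e_def by (subst Bochner_Integration.integral_sum) (auto intro!: int_ind)
  have S2: "S n x * S n x = (\<Sum>i<n. \<Sum>l<n. c (i + N) * c (l + N) * indicator (F (i + N) \<inter> F (l + N)) x)" for n x
    unfolding S_def sum_product by (intro sum.cong) (auto simp: indicator_def)
  have intS2: "integrable M (\<lambda>x. S n x * S n x)" for n
    unfolding S2 by (intro Bochner_Integration.integrable_sum integrable_mult_right int_ind) measurable
  have Fc: "prob (F i \<inter> F l) * (c i * c l) \<le> C * (c i * prob (F i)) * (c l * prob (F l))"
    if "i \<ge> N" "l \<ge> N" "i \<noteq> l" for i l
  proof (cases "c i > 0 \<and> c l > 0")
    case True
    have "prob (F i \<inter> F l) \<le> C * prob (F i) * prob (F l)"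
      using corr[of i l] corr[of l i] that True by (cases "i < l") (auto simp: Int_commute mult_ac)
    then have "prob (F i \<inter> F l) * (c i * c l) \<le> C * prob (F i) * prob (F l) * (c i * c l)"
      using c by (intro mult_right_mono) auto
    then show ?thesis by (simp add: mult_ac)
  next
    case False
    then have "c i = 0 \<or> c l = 0" using c(1)[of i] c(1)[of l] by linarith
    then show ?thesis by auto
  qed
  have ES2: "expectation (\<lambda>x. S n x * S n x) \<le> C * e n * e n + e n" for n
  proof -
    have "expectation (\<lambda>x. S n x * S n x) = (\<Sum>i<n. \<Sum>l<n. c (i + N) * c (l + N) * prob (F (i + N) \<inter> F (l + N)))"
      unfolding S2 by (subst Bochner_Integration.integral_sum | intro Bochner_Integration.integrable_sum integrable_mult_right int_ind sum.cong refl | simp)+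
    also have "\<dots> \<le> (\<Sum>i<n. \<Sum>l<n. C * (c (i + N) * prob (F (i + N))) * (c (l + N) * prob (F (l + N)))
        + (if l = i then c (i + N) * prob (F (i + N)) else 0))"
    proof (intro sum_mono)
      fix i l
      show "c (i + N) * c (l + N) * prob (F (i + N) \<inter> F (l + N)) \<le> C * (c (i + N) * prob (F (i + N))) * (c (l + N) * prob (F (l + N)))
        + (if l = i then c (i + N) * prob (F (i + N)) else 0)"
      proof (cases "i = l")
        case True
        have "c (i + N) * (c (i + N) * prob (F (i + N))) \<le> 1 * (c (i + N) * prob (F (i + N)))"
          using c by (intro mult_right_mono) auto
        moreover have "0 \<le> C * (c (i + N) * prob (F (i + N))) * (c (i + N) * prob (F (i + N)))"
          using c \<open>C \<ge> 0\<close> by simp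
        ultimately show ?thesis using True by (simp add: mult_ac)
      qed (use Fc[of "i + N" "l + N"] in \<open>auto simp: mult_ac\<close>)
    qed
    also have "\<dots> = C * e n * e n + e n"
      by (simp add: sum.distrib e_def sum_distrib_left sum_distrib_right mult_ac)
    finally show ?thesis .
  qed
  have elim: "filterlim e at_top sequentially"
  proof -
    have "\<not> summable (\<lambda>i. c (i + N) * prob (F (i + N)))"
      using div summable_iff_shift[of "\<lambda>i. c i * prob (F i)" N] by simp
    then show ?thesis unfolding e_def using c by (intro not_summable_filterlim_sum) auto
  qed
  define G where "G m = {x \<in> space M. \<exists>n. S n x > real m}" for m
  have G [measurable]: "G m \<in> events" for m unfolding G_def by measurable
  have PG: "1 \<le> C * prob (G m)" for m
  proof -
    have ev: "((e n - m) / e n)\<^sup>2 \<le> prob (G m) * (C + 1 / e n)" if en: "e n > m" "e n > 0" for n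
    proof -
      define T where "T = {x \<in> space M. S n x > m}"
      have [measurable]: "T \<in> events" unfolding T_def by measurable
      define E2 where "E2 = expectation (\<lambda>x. S n x * S n x)"
      \<comment> \<open>The inequality of Cauchy and Schwarz for \<open>S n\<close> and the indicator of \<open>T\<close> is used in the linear
        form \<open>2 u v \<le> s u\<^sup>2 + v\<^sup>2 / s\<close>; this value of \<open>s\<close> gives the best bound.\<close>
      define s where "s = (e n - m) / (C * e n * e n + e n)"
      have D: "C * e n * e n + e n > 0" using en \<open>C \<ge> 0\<close> by (intro add_nonneg_pos mult_nonneg_nonneg) auto
      have s: "s > 0" unfolding s_def using en D by simp
      have "e n \<le> expectation (\<lambda>x. m + (s * (S n x * S n x) + indicator T x / s) / 2)"
        unfolding ES[symmetric]
      proof (rule integral_mono)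
        fix x assume x: "x \<in> space M"
        have "0 \<le> (s * S n x - 1)\<^sup>2 / s" using s by simp
        also have "\<dots> = s * (S n x * S n x) + 1 / s - 2 * S n x"
          using s by (simp add: field_simps power2_eq_square)
        finally have *: "S n x \<le> (s * (S n x * S n x) + 1 / s) / 2" by simp
        have "0 \<le> s * (S n x * S n x)" using s by simp
        show "S n x \<le> m + (s * (S n x * S n x) + indicator T x / s) / 2"
        proof (cases "x \<in> T")
          case True
          then have "indicator T x = (1 :: real)" by simp
          then show ?thesis using add_increasing[OF of_nat_0_le_iff[of m, where 'a = real] *] by simp
        next
          case False
          then have "S n x \<le> m" using x by (simp add: T_def)
          then show ?thesis using \<open>0 \<le> s * (S n x * S n x)\<close> False by simp
        qed
      qed (intro intS Bochner_Integration.integrable_add integrable_divide_zero integrable_mult_right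
          integrable_const intS2 int_ind impI \<open>T \<in> events\<close>)+
      also have "\<dots> = m + (s * E2 + prob T / s) / 2"
        using intS2 by (simp add: E2_def emeasure_eq_measure prob_space)
      finally have le: "e n \<le> m + (s * E2 + prob T / s) / 2" .
      have "2 * (a - c) \<le> Y" if "a \<le> c + Y / 2" for a c Y :: real using that by simp
      from this[OF le] have "2 * (e n - m) \<le> s * E2 + prob T / s" .
      also have "\<dots> \<le> s * (C * e n * e n + e n) + prob T / s"
        using ES2[of n] s unfolding E2_def by simp
      also have "s * (C * e n * e n + e n) = e n - m" using D by (simp add: s_def)
      finally have "(e n - m) * s \<le> prob T" using s by (simp add: field_simps)
      then have "(e n - m)\<^sup>2 \<le> prob T * (C * e n * e n + e n)"
        using D by (simp add: s_def field_simps power2_eq_square)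
      also have "\<dots> \<le> prob (G m) * (C * e n * e n + e n)"
        using D by (intro mult_right_mono finite_measure_mono) (auto simp: T_def G_def)
      finally have "(e n - m)\<^sup>2 / (e n)\<^sup>2 \<le> prob (G m) * (C * e n * e n + e n) / (e n)\<^sup>2"
        by (intro divide_right_mono) auto
      also have "\<dots> = prob (G m) * (C + 1 / e n)" using en by (simp add: field_simps power2_eq_square)
      finally show ?thesis by (simp add: power_divide)
    qed
    have inv: "(\<lambda>n. inverse (e n)) \<longlonglongrightarrow> 0" using elim by (rule tendsto_inverse_0_at_top)
    have "eventually (\<lambda>n. e n > max m 0) sequentially" using elim by (simp add: filterlim_at_top_dense)
    then have "eventually (\<lambda>n. (1 - m * inverse (e n))\<^sup>2 \<le> prob (G m) * (C + inverse (e n))) sequentially"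
    proof eventually_elim
      case (elim n)
      then have "(e n - m) / e n = 1 - m * inverse (e n)" by (simp add: field_simps)
      then show ?case using ev[of n] elim by (simp add: inverse_eq_divide)
    qed
    moreover have "(\<lambda>n. (1 - m * inverse (e n))\<^sup>2) \<longlonglongrightarrow> (1 - real m * 0)\<^sup>2"
      by (intro tendsto_intros inv)
    moreover have "(\<lambda>n. prob (G m) * (C + inverse (e n))) \<longlonglongrightarrow> prob (G m) * (C + 0)"
      by (intro tendsto_intros inv)
    ultimately have "(1 - real m * 0)\<^sup>2 \<le> prob (G m) * (C + 0)"
      using tendsto_le[OF sequentially_bot] by blast
    then show ?thesis by (simp add: mult.commute)
  qed
  have "(\<lambda>m. prob (G m)) \<longlonglongrightarrow> prob (\<Inter>m. G m)"
  proof (rule finite_Lim_measure_decseq)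
    have "\<exists>n. real m < S n x" if "m \<le> m'" "real m' < S n x" for m m' n x
      using that by (meson le_less_trans of_nat_le_iff)
    then show "decseq G" unfolding decseq_def G_def by blast
  qed auto
  then have "(\<lambda>m. C * prob (G m)) \<longlonglongrightarrow> C * prob (\<Inter>m. G m)" by (intro tendsto_intros)
  then have "1 \<le> C * prob (\<Inter>m. G m)" using PG by (intro LIMSEQ_le_const[of _ _ 1]) auto
  also have "(\<Inter>m. G m) = {x \<in> space M. \<not> summable (\<lambda>i. c i * indicator (F i) x)}"
  proof (intro equalityI subsetI)
    fix x assume x: "x \<in> (\<Inter>m. G m)"
    have "\<not> summable (\<lambda>i. c i * indicator (F i) x)"
    proof
      assume "summable (\<lambda>i. c i * indicator (F i) x :: real)"
      then have sm: "summable (\<lambda>i. c (i + N) * indicator (F (i + N)) x :: real)"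
        by (simp add: summable_iff_shift[of "\<lambda>i. c i * indicator (F i) x"])
      have "S n x \<le> (\<Sum>i. c (i + N) * indicator (F (i + N)) x)" for n
        unfolding S_def using sm c by (intro sum_le_suminf) auto
      moreover obtain m where "(\<Sum>i. c (i + N) * indicator (F (i + N)) x :: real) \<le> real m" using real_arch_simple by blast
      moreover obtain n where "S n x > real m" using x by (auto simp: G_def)
      ultimately show False by (meson leD order_trans)
    qed
    then show "x \<in> {x \<in> space M. \<not> summable (\<lambda>i. c i * indicator (F i) x)}" using x by (auto simp: G_def)
  next
    fix x assume x: "x \<in> {x \<in> space M. \<not> summable (\<lambda>i. c i * indicator (F i) x :: real)}"
    then have "\<not> summable (\<lambda>i. c (i + N) * indicator (F (i + N)) x :: real)"
      by (simp add: summable_iff_shift[of "\<lambda>i. c i * indicator (F i) x"])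
    then have "filterlim (\<lambda>n. S n x) at_top sequentially"
      unfolding S_def using c by (intro not_summable_filterlim_sum) auto
    then have "\<exists>n. S n x > real m" for m
      unfolding filterlim_at_top_dense eventually_sequentially by blast
    then show "x \<in> (\<Inter>m. G m)" using x by (auto simp: G_def)
  qed
  finally show ?thesis .
qed

lemma (in prob_space) kochen_stone_AE:
  fixes F :: "nat \<Rightarrow> 'a set" and c :: "nat \<Rightarrow> real"
  assumes F [measurable]: "\<And>i. F i \<in> events"
    and c: "\<And>i. 0 \<le> c i" "\<And>i. c i \<le> 1"
    and div: "\<not> summable (\<lambda>i. c i * prob (F i))"
    and corr: "\<And>C. C > 1 \<Longrightarrow> \<exists>N. \<forall>i l. N \<le> i \<longrightarrow> i < l \<longrightarrow> c i > 0 \<longrightarrow> c l > 0 \<longrightarrow>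
      prob (F i \<inter> F l) \<le> C * prob (F i) * prob (F l)"
  shows "AE x in M. \<not> summable (\<lambda>i. c i * indicator (F i) x)"
proof -
  define A where "A = {x \<in> space M. \<not> summable (\<lambda>i. c i * indicator (F i) x)}"
  have A: "A \<in> events"
    unfolding A_def summable_iff_convergent Cauchy_convergent_iff[symmetric] by measurable
  have "1 \<le> C * prob A" if C: "C > 1" for C
    using corr[OF C] C kochen_stone_weighted[OF F c div, of C] unfolding A_def by auto
  then have "1 \<le> (1 + inverse (real (Suc n))) * prob A" for n by simp
  moreover have "(\<lambda>n. (1 + inverse (real (Suc n))) * prob A) \<longlonglongrightarrow> (1 + 0) * prob A"
    by (intro tendsto_intros LIMSEQ_inverse_real_of_nat)
  ultimately have "1 \<le> (1 + 0) * prob A" by (intro LIMSEQ_le_const[of _ _ 1]) auto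
  then have "prob A = 1" using prob_le_1[of A] by simp
  then have "AE x in M. x \<in> A" using prob_eq_1[OF A] by simp
  then show ?thesis by eventually_elim (simp add: A_def)
qed

lemma frequently_mem_if_not_summable:
  fixes c :: "nat \<Rightarrow> real"
  assumes "\<not> summable (\<lambda>i. c i * indicator (F i) x)"
  shows "\<exists>\<^sub>F i in sequentially. c i \<noteq> 0 \<and> x \<in> F i"
proof (rule ccontr)
  assume "\<not> ?thesis"
  then have ev: "eventually (\<lambda>i. c i * indicator (F i) x = (0 :: real)) sequentially"
    unfolding frequently_def not_not by eventually_elim (auto simp: indicator_def)
  show False using assms summable_cong[OF ev] by simp
qed

text \<open>
  A bound by \<open>V\<close> on the total excess of the pair correlations over the independent value is a bound on
  the variance of the number of events that occur.
\<close>

lemma (in prob_space) chebyshev_count: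
  fixes p \<delta> V :: real
  assumes A: "finite A" and E [measurable]: "\<And>a. a \<in> A \<Longrightarrow> E a \<in> events"
    and p: "\<And>a. a \<in> A \<Longrightarrow> prob (E a) = p" "p > 0" "A \<noteq> {}" and \<delta>: "\<delta> > 0"
    and V: "(\<Sum>a\<in>A. \<Sum>b\<in>A. prob (E a \<inter> E b)) \<le> (card A * p)\<^sup>2 + V"
  shows "prob {x \<in> space M. (\<Sum>a\<in>A. indicator (E a) x) \<ge> (1 + \<delta>) * (card A * p)} \<le> V / (\<delta> * (card A * p))\<^sup>2"
proof -
  define f where "f x = (\<Sum>a\<in>A. indicator (E a) x :: real)" for x
  define m where "m = card A * p"
  have m: "m > 0" using p A by (simp add: m_def card_gt_0_iff)
  have [measurable]: "f \<in> borel_measurable M" unfolding f_def by measurable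
  have int_ind: "integrable M (indicator B :: 'a \<Rightarrow> real)" if "B \<in> events" for B
    using that by (simp add: emeasure_eq_measure)
  have f2: "(f x)\<^sup>2 = (\<Sum>a\<in>A. \<Sum>b\<in>A. indicator (E a \<inter> E b) x)" for x
    unfolding f_def power2_eq_square sum_product by (intro sum.cong) (auto simp: indicator_def)
  have intf: "integrable M f"
    unfolding f_def by (intro Bochner_Integration.integrable_sum int_ind E)
  have intf2: "integrable M (\<lambda>x. (f x)\<^sup>2)"
    unfolding f2 by (intro Bochner_Integration.integrable_sum int_ind sets.Int E)
  have Ef: "expectation f = m"
    unfolding f_def m_def using E p(1) by (subst Bochner_Integration.integral_sum) (auto intro!: int_ind)
  have Ef2: "expectation (\<lambda>x. (f x)\<^sup>2) = (\<Sum>a\<in>A. \<Sum>b\<in>A. prob (E a \<inter> E b))"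
  proof -
    have "expectation (\<lambda>x. (f x)\<^sup>2) = (\<Sum>a\<in>A. expectation (\<lambda>x. \<Sum>b\<in>A. indicator (E a \<inter> E b) x))"
      unfolding f2 by (intro Bochner_Integration.integral_sum Bochner_Integration.integrable_sum int_ind sets.Int E)
    also have "\<dots> = (\<Sum>a\<in>A. \<Sum>b\<in>A. expectation (indicator (E a \<inter> E b)))"
      by (intro sum.cong refl Bochner_Integration.integral_sum int_ind sets.Int E)
    also have "\<dots> = (\<Sum>a\<in>A. \<Sum>b\<in>A. prob (E a \<inter> E b))"
      using E by (intro sum.cong refl) (simp add: sets.Int_space_eq2)
    finally show ?thesis .
  qed
  have "variance f = expectation (\<lambda>x. (f x)\<^sup>2) - (expectation f)\<^sup>2"
    by (rule variance_eq[OF intf intf2])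
  also have "\<dots> \<le> V" using V unfolding Ef Ef2 m_def by linarith
  finally have var: "variance f \<le> V" .
  have "prob {x \<in> space M. f x \<ge> (1 + \<delta>) * m} \<le> prob {x \<in> space M. \<delta> * m \<le> \<bar>f x - expectation f\<bar>}"
    using m by (intro finite_measure_mono) (auto simp: Ef algebra_simps)
  also have "\<dots> \<le> variance f / (\<delta> * m)\<^sup>2"
    using m \<delta> by (intro Chebyshev_inequality intf2) auto
  also have "\<dots> \<le> V / (\<delta> * m)\<^sup>2" using var by (intro divide_right_mono) auto
  finally show ?thesis by (simp add: f_def m_def)
qed

lemma (in prob_space) borel_cantelli_power_AE:
  assumes X: "\<And>m. X m \<in> events" and q: "q > 1"
    and le: "\<And>m :: nat. m > 0 \<Longrightarrow> prob (X m) \<le> C * real m powr - q"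
  shows "AE x in M. eventually (\<lambda>m. x \<notin> X m) sequentially"
proof -
  have "AE x in M. eventually (\<lambda>m. x \<in> space M - X m) sequentially"
  proof (rule borel_cantelli_AE1[OF X])
    show "summable (\<lambda>m. prob (X m))"
    proof (rule summable_comparison_test_ev)
      show "summable (\<lambda>m. C * real m powr - q)"
        using q by (intro summable_mult) (simp add: summable_real_powr_iff)
      show "eventually (\<lambda>m. norm (prob (X m)) \<le> C * real m powr - q) sequentially"
        using eventually_gt_at_top[of 0] by eventually_elim (simp add: le)
    qed
  qed (simp add: emeasure_eq_measure)
  then show ?thesis by eventually_elim (auto elim: eventually_mono)
qed

section \<open>Dirichlet approximation and neighbourhoods of torsion points\<close>

lemma tcube_diff_commute: "x - y \<in> tcube r \<longleftrightarrow> y - x \<in> tcube r"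
  using tcube_minus_iff[of "x - y" r] by simp

lemma tcube_ball_borel [measurable]: "{x. x - c \<in> tcube r} \<in> sets borel"
proof -
  have "{x. x + (- c) \<in> tcube r} \<in> sets borel" by measurable
  then show ?thesis by simp
qed

lemma measure_tcube_ball:
  fixes c :: "'d::finite torus"
  shows "measure haar {x. x - c \<in> tcube r} = measure haar (tcube r :: 'd torus set)"
  using measure_haar_translate[of "tcube r" "- c"] by simp

lemma measure_disjoint_cubes:
  fixes c :: "'i \<Rightarrow> 'd::finite torus"
  assumes I: "finite I" and sep: "\<And>i j. i \<in> I \<Longrightarrow> j \<in> I \<Longrightarrow> i \<noteq> j \<Longrightarrow> c i - c j \<notin> tcube (2 * r)"
  shows "measure haar (\<Union>i\<in>I. {x. x - c i \<in> tcube r}) = card I * measure haar (tcube r :: 'd torus set)"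
proof -
  have "measure haar (\<Union>i\<in>I. {x. x - c i \<in> tcube r}) = (\<Sum>i\<in>I. measure haar {x. x - c i \<in> tcube r})"
  proof (rule haar.finite_measure_finite_Union[OF I])
    show "disjoint_family_on (\<lambda>i. {x. x - c i \<in> tcube r}) I"
      unfolding disjoint_family_on_def
    proof (intro ballI impI, rule ccontr)
      fix i j assume ij: "i \<in> I" "j \<in> I" "i \<noteq> j" "{x. x - c i \<in> tcube r} \<inter> {x. x - c j \<in> tcube r} \<noteq> {}"
      then obtain x where "x - c i \<in> tcube r" "x - c j \<in> tcube r" by blast
      then have "(x - c j) - (x - c i) \<in> tcube (r + r)" by (intro tcube_diff)
      then show False using sep[OF ij(1-3)] by simp
    qed
  qed auto
  then show ?thesis by (simp add: measure_tcube_ball)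
qed

text \<open>
  Otherwise the cubes of radius \<open>\<rho> / 2\<close> around the \<open>K + 1\<close> points \<open>0, \<beta>, \<dots>, K \<beta>\<close> would be disjoint,
  with total measure greater than \<open>1\<close>.
\<close>

lemma dirichlet_torus:
  fixes \<beta> :: "'d::finite torus"
  assumes K: "1 \<le> real K * \<rho> ^ CARD('d)" and \<rho>: "0 < \<rho>"
  shows "\<exists>k\<in>{1..K}. zmul (int k) \<beta> \<in> tcube \<rho>"
proof (cases "\<rho> \<ge> 1")
  case True
  have "K \<noteq> 0" using K by (intro notI) simp
  moreover have "\<beta> \<in> tcube \<rho>" using torus_tcube_UNIV tcube_mono[OF True] by blast
  ultimately show ?thesis by (intro bexI[of _ 1]) auto
next
  case False
  show ?thesis
  proof (rule ccontr)
    assume no: "\<not> ?thesis"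
    have sep: "zmul (int i) \<beta> - zmul (int j) \<beta> \<notin> tcube \<rho>" if ij: "i \<in> {0..K}" "j \<in> {0..K}" "i \<noteq> j" for i j
    proof (cases "i < j")
      case True
      have "zmul (int j) \<beta> - zmul (int i) \<beta> = zmul (int (j - i)) \<beta>" using True by (simp add: zmul_diff_left of_nat_diff)
      moreover have "j - i \<in> {1..K}" using True ij by auto
      ultimately show ?thesis using no by (metis tcube_diff_commute)
    next
      case False
      have "zmul (int i) \<beta> - zmul (int j) \<beta> = zmul (int (i - j)) \<beta>" using False by (simp add: zmul_diff_left of_nat_diff)
      moreover have "i - j \<in> {1..K}" using False ij by auto
      ultimately show ?thesis using no by metis
    qed
    have "real (card {0..K}) * measure haar (tcube (\<rho> / 2) :: 'd torus set) \<le> 1"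
      using measure_disjoint_cubes[of "{0..K}" "\<lambda>j. zmul (int j) \<beta>" "\<rho> / 2"] sep
        haar.prob_le_1[of "\<Union>i\<in>{0..K}. {x. x - zmul (int i) \<beta> \<in> tcube (\<rho> / 2)}"] by simp
    then have "real (K + 1) * \<rho> ^ CARD('d) \<le> 1"
      using False \<rho> by (simp add: measure_haar_tcube_eq)
    moreover have "\<rho> ^ CARD('d) > 0" using \<rho> by simp
    ultimately show False using K by (simp add: algebra_simps)
  qed
qed

lemma measure_returns_le:
  fixes \<rho> :: real
  assumes "\<And>k. k \<in> I \<Longrightarrow> k \<noteq> 0" "finite I" "0 \<le> \<rho>"
  shows "measure haar {\<beta> :: 'd::finite torus. \<exists>k\<in>I. zmul (int k) \<beta> \<in> tcube \<rho>} \<le> card I * (2 * \<rho>) ^ CARD('d)"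
proof -
  have "{\<beta> :: 'd torus. \<exists>k\<in>I. zmul (int k) \<beta> \<in> tcube \<rho>} = (\<Union>k\<in>I. {\<beta>. zmul (int k) \<beta> \<in> tcube \<rho>})" by blast
  also have "measure haar \<dots> \<le> (\<Sum>k\<in>I. measure haar {\<beta> :: 'd torus. zmul (int k) \<beta> \<in> tcube \<rho>})"
    by (intro measure_UNION_le assms) measurable
  also have "\<dots> \<le> (\<Sum>k\<in>I. (2 * \<rho>) ^ CARD('d))"
    using assms measure_haar_tcube_le[OF assms(3)] by (intro sum_mono) (subst measure_haar_zmul, auto)
  finally show ?thesis by simp
qed

text \<open>
  Away from a set of measure at most \<open>1 / 2\<close>, Dirichlet's theorem holds with a multiplier
  \<open>k \<in> {J..K}\<close>, and then \<open>\<beta>\<close> is within \<open>R = \<rho>0 / J\<close> of the set \<open>T\<close> of points annihilated by such a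
  \<open>k\<close>. Conversely, every point within \<open>r = \<rho> / K\<close> of \<open>T\<close> belongs to \<open>H\<close>. In a maximal \<open>2 r\<close>-separated
  subset \<open>C\<close> of \<open>T\<close> the cubes of radius \<open>r\<close> are disjoint, while those of radius \<open>R + 2 r\<close> cover half of
  the torus, so the measure of \<open>H\<close> is at least a constant times \<open>(r / R) ^ d\<close>. A second moment bound
  on the number of multipliers would not do: for \<open>d = 1\<close> the multiples of small multipliers make the
  variance too large by a logarithm.
\<close>

lemma measure_near_torsion_ge:
  fixes J K :: nat and \<rho> \<rho>0 :: real
  defines "H \<equiv> {\<beta> :: 'd::finite torus. \<exists>k\<in>{1..K}. zmul (int k) \<beta> \<in> tcube \<rho>}"
  assumes \<rho>: "0 < \<rho>" "\<rho> \<le> \<rho>0" and \<rho>0: "real K * \<rho>0 ^ CARD('d) = 1"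
    and J: "J \<ge> 1" "2 ^ (CARD('d) + 1) * J \<le> K"
  shows "measure haar H \<ge> 1 / 2 * (\<rho> * J / (3 * \<rho>0 * K)) ^ CARD('d)"
proof -
  let ?d = "CARD('d)"
  have d: "?d \<ge> 1" by (simp add: Suc_le_eq)
  have "2 ^ 2 \<le> (2 :: nat) ^ (?d + 1)" using d by (intro power_increasing) auto
  then have "4 * 1 \<le> 2 ^ (?d + 1) * J" using J(1) by (intro mult_mono) auto
  then have K4: "K \<ge> 4" using J(2) by linarith
  have JK: "J \<le> K" using J(2) one_le_power[of "2::nat" "?d + 1"] by (metis le_trans mult_le_mono1 nat_mult_1 one_le_numeral)
  have \<rho>0_le: "\<rho>0 \<le> 1"
  proof (rule ccontr)
    assume "\<not> \<rho>0 \<le> 1"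
    then have "1 \<le> \<rho>0 ^ ?d" by (intro one_le_power) simp
    then have "real K * 1 \<le> real K * \<rho>0 ^ ?d" by (intro mult_left_mono) auto
    then show False using \<rho>0 K4 by simp
  qed
  have Hm: "H \<in> sets haar" unfolding H_def by measurable
  define W where "W = {\<beta> :: 'd torus. \<exists>k\<in>{J..K}. zmul (int k) \<beta> \<in> tcube \<rho>0}"
  define V where "V = {\<beta> :: 'd torus. \<exists>k\<in>{1..<J}. zmul (int k) \<beta> \<in> tcube \<rho>0}"
  have Wm: "W \<in> sets haar" and Vm: "V \<in> sets haar" unfolding W_def V_def by measurable
  have "UNIV = W \<union> V"
  proof (intro equalityI subsetI)
    fix \<beta> :: "'d torus"
    obtain k where "k \<in> {1..K}" "zmul (int k) \<beta> \<in> tcube \<rho>0" using dirichlet_torus[of K \<rho>0 \<beta>] \<rho>0 \<rho> by auto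
    then show "\<beta> \<in> W \<union> V" by (cases "k < J") (auto simp: W_def V_def)
  qed simp
  then have "1 \<le> measure haar W + measure haar V"
    using haar.prob_space[where 'd = 'd] measure_Un_le[OF Wm Vm] by simp
  moreover have "measure haar V \<le> 1 / 2"
  proof -
    have "measure haar V \<le> real (card {1..<J}) * (2 * \<rho>0) ^ ?d"
      unfolding V_def using \<rho> by (intro measure_returns_le) auto
    also have "\<dots> \<le> J * (2 ^ ?d * \<rho>0 ^ ?d)" using \<rho> by (auto simp: power_mult_distrib intro!: mult_right_mono)
    also have "\<dots> = (2 ^ (?d + 1) * real J) * \<rho>0 ^ ?d / 2" by simp
    also have "\<dots> \<le> real K * \<rho>0 ^ ?d / 2"
    proof (intro divide_right_mono mult_right_mono)
      show "2 ^ (?d + 1) * real J \<le> real K" 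
        using J(2)[folded of_nat_le_iff[where 'a = real]] by simp
    qed (use \<rho> in auto)
    finally show ?thesis using \<rho>0 by simp
  qed
  ultimately have W: "1 / 2 \<le> measure haar W" by simp
  define T where "T = {c :: 'd torus. \<exists>k\<in>{J..K}. zmul (int k) c = 0}"
  define r where "r = \<rho> / K"
  define R where "R = \<rho>0 / J"
  have r: "0 < r" "r < 1 / 2" using \<rho> \<rho>0_le K4 by (auto simp: r_def field_simps)
  have rR: "r \<le> R" unfolding r_def R_def using \<rho> J JK by (intro frac_le) auto
  have near: "\<exists>c\<in>T. \<beta> - c \<in> tcube R" if \<beta>: "\<beta> \<in> W" for \<beta>
  proof -
    obtain k where k: "k \<in> {J..K}" "zmul (int k) \<beta> \<in> tcube \<rho>0" using \<beta> by (auto simp: W_def)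
    obtain e where e: "to_torus e = zmul (int k) \<beta>" "\<And>i. \<bar>e $ i\<bar> \<le> \<rho>0" using k(2) by (auto simp: mem_tcube)
    define s :: "'d torus" where "s = to_torus ((1 / real k) *\<^sub>R e)"
    have k0: "k > 0" using k(1) J(1) by auto
    have "zmul (int k) s = zmul (int k) \<beta>" using e(1) k0 by (simp add: s_def zmul_to_torus)
    then have "zmul (int k) (\<beta> - s) = 0" by (simp add: zmul_diff_right)
    then have "\<beta> - s \<in> T" using k(1) unfolding T_def by blast
    moreover have "s \<in> tcube R"
    proof -
      have "\<bar>((1 / real k) *\<^sub>R e) $ i\<bar> \<le> R" for i
      proof -
        have "\<bar>((1 / real k) *\<^sub>R e) $ i\<bar> = \<bar>e $ i\<bar> / k" by (simp add: abs_mult)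
        also have "\<dots> \<le> \<rho>0 / J" using e(2)[of i] k(1) J(1) by (intro frac_le) auto
        finally show ?thesis by (simp add: R_def)
      qed
      then show ?thesis unfolding mem_tcube s_def by blast
    qed
    ultimately show ?thesis by (intro bexI[of _ "\<beta> - s"]) simp_all
  qed
  define sep where "sep C \<longleftrightarrow> finite C \<and> C \<subseteq> T \<and> (\<forall>c\<in>C. \<forall>c'\<in>C. c \<noteq> c' \<longrightarrow> c - c' \<notin> tcube (2 * r))" for C
  have cardC: "measure haar (\<Union>c\<in>C. {x. x - c \<in> tcube r}) = card C * (2 * r) ^ ?d" if "sep C" for C
    using measure_disjoint_cubes[of C "\<lambda>c. c" r] that r by (simp add: sep_def measure_haar_tcube_eq)
  have bound: "card C \<le> nat \<lfloor>1 / (2 * r) ^ ?d\<rfloor>" if "sep C" for C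
  proof -
    have "real (card C) * (2 * r) ^ ?d \<le> 1" using cardC[OF that] haar.prob_le_1 by metis
    then have "real (card C) \<le> 1 / (2 * r) ^ ?d" using r by (simp add: field_simps)
    then show ?thesis by linarith
  qed
  have "sep {}" by (simp add: sep_def)
  moreover have "\<forall>C. sep C \<longrightarrow> card C < Suc (nat \<lfloor>1 / (2 * r) ^ ?d\<rfloor>)"
    using bound unfolding less_Suc_eq_le by blast
  ultimately have "\<exists>C. sep C \<and> (\<forall>C'. sep C' \<longrightarrow> card C' \<le> card C)"
    by (rule ex_has_greatest_nat)
  then obtain C where C: "sep C" "\<And>C'. sep C' \<Longrightarrow> card C' \<le> card C" by blast
  have max: "\<exists>c\<in>C. t - c \<in> tcube (2 * r)" if t: "t \<in> T" for t
  proof (rule ccontr)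
    assume no: "\<not> ?thesis"
    have "t \<notin> C"
    proof
      assume "t \<in> C"
      moreover have "t - t \<in> tcube (2 * r)" using r unfolding mem_tcube by (intro exI[of _ 0]) (simp add: zero_torus.abs_eq)
      ultimately show False using no by blast
    qed
    moreover have "sep (insert t C)"
      using C(1) t no unfolding sep_def by (auto simp: tcube_diff_commute[of _ t])
    ultimately show False using C(2)[of "insert t C"] C(1) by (simp add: sep_def)
  qed
  have "W \<subseteq> (\<Union>c\<in>C. {x. x - c \<in> tcube (R + 2 * r)})"
  proof
    fix \<beta> assume "\<beta> \<in> W"
    then obtain t where t: "t \<in> T" "\<beta> - t \<in> tcube R" using near by blast
    obtain c where c: "c \<in> C" "t - c \<in> tcube (2 * r)" using max[OF t(1)] by blast
    have "(\<beta> - t) + (t - c) \<in> tcube (R + 2 * r)" using t c by (intro tcube_add)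
    then show "\<beta> \<in> (\<Union>c\<in>C. {x. x - c \<in> tcube (R + 2 * r)})" using c(1) by auto
  qed
  then have "measure haar W \<le> measure haar (\<Union>c\<in>C. {x. x - c \<in> tcube (R + 2 * r)})"
    using C(1) by (intro haar.finite_measure_mono) (auto simp: sep_def)
  also have "\<dots> \<le> (\<Sum>c\<in>C. measure haar {x. x - c \<in> tcube (R + 2 * r)})"
    using C(1) by (intro measure_UNION_le) (auto simp: sep_def)
  also have "\<dots> \<le> (\<Sum>c\<in>C. (6 * R) ^ ?d)"
  proof (intro sum_mono)
    fix c :: "'d torus"
    have "measure haar {x. x - c \<in> tcube (R + 2 * r)} \<le> (2 * (R + 2 * r)) ^ ?d"
      unfolding measure_tcube_ball by (rule measure_haar_tcube_le) (use r rR in linarith)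
    also have "\<dots> \<le> (6 * R) ^ ?d" using r rR by (intro power_mono) auto
    finally show "measure haar {x. x - c \<in> tcube (R + 2 * r)} \<le> (6 * R) ^ ?d" .
  qed
  finally have C6: "1 / 2 \<le> card C * (6 * R) ^ ?d" using W by simp
  have "(\<Union>c\<in>C. {x. x - c \<in> tcube r}) \<subseteq> H"
  proof safe
    fix x c assume c: "c \<in> C" "x - c \<in> tcube r"
    then obtain k where k: "k \<in> {J..K}" "zmul (int k) c = 0" using C(1) by (auto simp: sep_def T_def)
    have "zmul (int k) (x - c) \<in> tcube (\<bar>of_int (int k)\<bar> * r)" using c by (intro tcube_zmul)
    moreover have "\<bar>of_int (int k)\<bar> * r \<le> \<rho>"
    proof -
      have "real k * r \<le> real K * r" using k r by (intro mult_right_mono) auto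
      then show ?thesis using K4 by (simp add: r_def)
    qed
    ultimately have "zmul (int k) x \<in> tcube \<rho>" using k tcube_mono by (auto simp: zmul_diff_right)
    then show "x \<in> H" using k J by (auto simp: H_def)
  qed
  then have "card C * (2 * r) ^ ?d \<le> measure haar H"
    using cardC[OF C(1)] haar.finite_measure_mono[OF _ Hm] by metis
  moreover have "1 / 2 * ((2 * r) / (6 * R)) ^ ?d \<le> card C * (2 * r) ^ ?d"
  proof -
    have R: "R > 0" using r rR by linarith
    have "1 / 2 * (2 * r / (6 * R)) ^ ?d \<le> (card C * (6 * R) ^ ?d) * (2 * r / (6 * R)) ^ ?d"
      using C6 r R by (intro mult_right_mono) auto
    also have "\<dots> = card C * (6 * R * (2 * r / (6 * R))) ^ ?d"
      unfolding power_mult_distrib[of "6 * R"] by (simp only: mult.assoc)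
    also have "6 * R * (2 * r / (6 * R)) = 2 * r" using R by simp
    finally show ?thesis .
  qed
  moreover have "(2 * r) / (6 * R) = \<rho> * J / (3 * \<rho>0 * K)"
    using J \<rho> K4 by (simp add: r_def R_def field_simps)
  ultimately show ?thesis by simp
qed

section \<open>Sparse scales\<close>

text \<open>
  The number of multipliers that enter a close return is \<open>gap_const d\<close> times the length of the orbit
  segment that should be free of close returns. The value is the reciprocal of the constant from
  \<open>measure_near_torsion_ge\<close>, enlarged so that the segment spoils at most half of the probability of a close
  return.
\<close>

definition gap_const :: "nat \<Rightarrow> nat" where
  "gap_const d = 2 ^ (d + 2) * (3 * 2 ^ (d + 1)) ^ d"

text \<open>
  Consecutive lengths have ratio \<open>i ^ 12\<close>, which outweighs all polynomial losses in the correlation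
  estimates, while \<open>ln (block_len i)\<close> is only of order \<open>i * ln i\<close>.
\<close>

definition block_len :: "nat \<Rightarrow> nat" where
  "block_len i = fact i ^ 12"

definition block_span :: "nat \<Rightarrow> nat \<Rightarrow> nat" where
  "block_span d i = gap_const d * block_len i"

text \<open>
  All times at scale \<open>i\<close> are multiples of this power of \<open>2\<close>. It is divisible by any given power of \<open>2\<close>
  once \<open>i\<close> is large, so that translating \<open>\<alpha>\<close> by a dyadic torsion point changes only finitely many of the
  close returns; and it grows more slowly than any power of \<open>i\<close>, so that it is negligible on the
  scale of the theorem.
\<close>

definition dyad :: "nat \<Rightarrow> nat" where
  "dyad i = 2 ^ nat \<lfloor>sqrt (ln (real i))\<rfloor>"

definition radius :: "nat \<Rightarrow> real \<Rightarrow> nat \<Rightarrow> real" where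
  "radius d \<sigma> i = (1 / (real (block_span d i) * real i powr \<sigma>)) powr (1 / real d)"

lemma gap_const_pos [simp]: "gap_const d > 0" by (simp add: gap_const_def)
lemma block_len_pos [simp]: "block_len i > 0" by (simp add: block_len_def)
lemma block_span_pos [simp]: "block_span d i > 0" by (simp add: block_span_def)
lemma dyad_pos [simp]: "dyad i > 0" by (simp add: dyad_def)

lemma scale_nonzero [simp]: "gap_const d \<noteq> 0" "block_len i \<noteq> 0" "block_span d i \<noteq> 0" "dyad i \<noteq> 0"
  by (metis gap_const_pos block_len_pos block_span_pos dyad_pos less_numeral_extra(3))+

lemma radius_pos: "i > 0 \<Longrightarrow> radius d \<sigma> i > 0"
  by (simp add: radius_def)

lemma radius_power:
  assumes "d > 0" "i > 0"
  shows "radius d \<sigma> i ^ d = 1 / (real (block_span d i) * real i powr \<sigma>)"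
proof -
  have "radius d \<sigma> i ^ d = radius d \<sigma> i powr real d"
    using assms by (simp add: powr_realpow radius_pos)
  then show ?thesis using assms by (simp add: radius_def powr_powr)
qed

lemma block_len_growth: assumes "i < l" shows "block_len i * l ^ 12 \<le> block_len l"
proof -
  obtain m where m: "l = Suc m" using assms by (cases l) auto
  have "fact i * l \<le> (fact l :: nat)"
    using fact_mono_nat[of i m] assms by (simp add: m mult.commute add_mono mult_le_mono2)
  then have "(fact i * l) ^ 12 \<le> (fact l :: nat) ^ 12" by (intro power_mono) auto
  then show ?thesis by (simp add: block_len_def power_mult_distrib)
qed

lemma dyad_le: assumes "i \<ge> 1" shows "dyad i \<le> i"
proof -
  define L where "L = ln (real i)"
  have L: "L \<ge> 0" using assms by (simp add: L_def)
  have "real (nat \<lfloor>sqrt L\<rfloor>) \<le> L"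
  proof (cases "L < 1")
    case True
    then have "\<lfloor>sqrt L\<rfloor> = 0" using L by (simp add: floor_eq_iff)
    then show ?thesis using L by simp
  next
    case False
    then have "sqrt L \<le> L" by (intro real_le_lsqrt) (auto simp: power2_eq_square)
    then show ?thesis using L by (meson of_nat_floor order_trans real_sqrt_ge_zero)
  qed
  then have "real (dyad i) \<le> 2 powr L"
    unfolding dyad_def L_def[symmetric] by (simp add: powr_realpow[symmetric])
  also have "\<dots> \<le> exp 1 powr L" using exp_ge_add_one_self[of 1] L by (intro powr_mono2) auto
  also have "\<dots> = real i" using assms by (simp add: powr_def L_def)
  finally show ?thesis by simp
qed

lemma dyad_mono: "1 \<le> i \<Longrightarrow> i \<le> l \<Longrightarrow> dyad i \<le> dyad l"
  unfolding dyad_def by (intro power_increasing nat_mono floor_mono real_sqrt_le_mono ln_mono) auto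

lemma dyad_dvd_eventually: "eventually (\<lambda>i. 2 ^ n dvd dyad i) sequentially"
proof -
  have "filterlim (\<lambda>i. sqrt (ln (real i))) at_top sequentially" by real_asymp
  then have "eventually (\<lambda>i. sqrt (ln (real i)) \<ge> real n) sequentially" by (simp add: filterlim_at_top)
  then show ?thesis
  proof eventually_elim
    case (elim i)
    then have "n \<le> nat \<lfloor>sqrt (ln (real i))\<rfloor>" by (simp add: le_nat_floor)
    then show ?case unfolding dyad_def by (rule le_imp_power_dvd)
  qed
qed

lemma ln_block_span_le:
  assumes "i \<ge> 1"
  shows "ln (real (block_span d i)) \<le> ln (real (gap_const d)) + 12 * real i * ln (real i)"
proof -
  have "ln (fact i :: real) \<le> ln (real (i ^ i))"
    using fact_le_power[of i, where 'a = real] assms by (subst ln_le_cancel_iff) auto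
  then have "ln (fact i :: real) \<le> real i * ln (real i)" using assms by (simp add: ln_realpow)
  then show ?thesis
    by (simp add: block_span_def block_len_def ln_mult ln_realpow)
qed

lemma eventually_log_le_cube:
  "eventually (\<lambda>l. 1 + ln (real (2 * block_span d l * dyad l)) \<le> real l ^ 3) sequentially"
proof -
  have "eventually (\<lambda>l. 1 + ln 2 + ln (real (gap_const d)) + 12 * real l * ln (real l) + ln (real l) \<le> real l ^ 3) sequentially"
    by real_asymp
  moreover have "eventually (\<lambda>l :: nat. l \<ge> 1) sequentially" by (rule eventually_ge_at_top)
  ultimately show ?thesis
  proof eventually_elim
    case (elim l)
    note le = elim(1) and l = elim(2)
    have "ln (real (dyad l)) \<le> ln (real l)" using dyad_le[OF l] l by simp
    moreover have "ln (real (2 * block_span d l * dyad l)) = ln 2 + ln (real (block_span d l)) + ln (real (dyad l))"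
      by (simp add: ln_mult)
    ultimately show "1 + ln (real (2 * block_span d l * dyad l)) \<le> real l ^ 3"
      using le ln_block_span_le[OF l, of d] by linarith
  qed
qed

lemma radius_less_half:
  assumes "d > 0" "i > 2 ^ d" "0 \<le> \<sigma>"
  shows "radius d \<sigma> i < 1 / 2"
proof -
  have i: "i > 0" using assms(2) by (cases i) auto
  have "i * 1 \<le> i * fact (i - 1)" by (intro mult_le_mono2) (simp add: fact_ge_1)
  then have "i \<le> fact i" using i by (simp add: fact_reduce)
  also have "fact i \<le> (fact i :: nat) ^ 12" by (intro self_le_power) (auto simp: fact_ge_1)
  also have "\<dots> \<le> block_span d i" by (simp add: block_span_def block_len_def Suc_le_eq)
  finally have 1: "real i \<le> real (block_span d i)" by simp
  have "radius d \<sigma> i ^ d \<le> 1 / (real i * 1)"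
    unfolding radius_power[OF assms(1) i] using 1 i assms by (intro frac_le mult_mono ge_one_powr_ge_zero) auto
  also have "\<dots> < 1 / 2 ^ d"
  proof -
    have "real (2 ^ d) < real i" using assms(2) by (simp only: of_nat_less_iff)
    then show ?thesis by (simp add: frac_less2)
  qed
  finally have "radius d \<sigma> i ^ d < (1 / 2) ^ d" by (simp add: power_divide)
  then show ?thesis by (rule power_less_imp_less_base) simp
qed

section \<open>Close returns of almost every translation\<close>

text \<open>
  The absence of returns before \<open>block_len i\<close> makes orbit segments of that length separated on the
  scale of the cube, so that the cubes around their points are disjoint (\<open>measure_hit\<close>).
\<close>

definition close_return :: "real \<Rightarrow> nat \<Rightarrow> 'd::finite torus set" where
  "close_return \<sigma> i = {\<alpha>.
     (\<exists>k\<in>{1..block_span CARD('d) i}. zmul (int (k * dyad i)) \<alpha> \<in> tcube (radius CARD('d) \<sigma> i)) \<and>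
     (\<forall>k\<in>{1..<block_len i}. zmul (int (k * dyad i)) \<alpha> \<notin> tcube (radius CARD('d) \<sigma> i))}"

lemma close_return_borel [measurable]: "close_return \<sigma> i \<in> sets borel"
  unfolding close_return_def by measurable

text \<open>
  The event is \<open>H - V\<close>, evaluated at \<open>dyad i * \<alpha>\<close>, where \<open>H\<close> is the set of \<open>measure_near_torsion_ge\<close> and the
  early returns \<open>V\<close> have at most half of the measure that is guaranteed for \<open>H\<close>.
\<close>

lemma measure_close_return_ge:
  assumes i: "i \<ge> 1" and \<sigma>: "0 \<le> \<sigma>"
  shows "measure haar (close_return \<sigma> i :: 'd::finite torus set)
    \<ge> 2 ^ CARD('d) / gap_const CARD('d) * real i powr - \<sigma>"
proof -
  let ?d = "CARD('d)" and ?K = "block_span CARD('d) i" and ?\<rho> = "radius CARD('d) \<sigma> i"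
  define E :: nat where "E = (3 * 2 ^ (?d + 1)) ^ ?d"
  define J where "J = 2 * E * block_len i"
  have d: "?d > 0" by simp
  have E: "gap_const ?d = 2 ^ (?d + 2) * E" "E > 0" by (simp_all add: gap_const_def E_def)
  have K: "?K = 2 ^ (?d + 1) * J" by (simp add: block_span_def J_def E)
  \<comment> \<open>The radius at which Dirichlet's theorem with multipliers up to \<open>?K\<close> is sharp.\<close>
  define \<rho>0 where "\<rho>0 = (1 / real ?K) powr (1 / ?d)"
  have \<rho>0_pos: "\<rho>0 > 0" by (simp add: \<rho>0_def)
  then have "\<rho>0 ^ ?d = \<rho>0 powr ?d" by (simp add: powr_realpow)
  then have \<rho>0: "\<rho>0 ^ ?d = 1 / ?K" by (simp add: \<rho>0_def powr_powr)
  have \<rho>: "?\<rho> > 0" using radius_pos i by simp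
  have "?\<rho> \<le> \<rho>0"
    unfolding radius_def \<rho>0_def
    using i \<sigma> ge_one_powr_ge_zero[of "real i" \<sigma>] mult_left_mono[of 1 "real i powr \<sigma>" "real ?K"]
    by (intro powr_mono2 frac_le) auto
  define H :: "'d torus set" where "H = {\<beta>. \<exists>k\<in>{1..?K}. zmul (int k) \<beta> \<in> tcube ?\<rho>}"
  define V :: "'d torus set" where "V = {\<beta>. \<exists>k\<in>{1..<block_len i}. zmul (int k) \<beta> \<in> tcube ?\<rho>}"
  have [measurable]: "H \<in> sets borel" "V \<in> sets borel" unfolding H_def V_def by measurable
  have "1 / 2 * (?\<rho> * J / (3 * \<rho>0 * ?K)) ^ ?d \<le> measure haar H"
    unfolding H_def
  proof (rule measure_near_torsion_ge)
    show "1 \<le> J" using E(2) by (simp add: J_def Suc_le_eq)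
    show "real ?K * \<rho>0 ^ ?d = 1" unfolding \<rho>0 by simp
  qed (use \<rho> \<open>?\<rho> \<le> \<rho>0\<close> K in auto)
  moreover have "?\<rho> * J / (3 * \<rho>0 * ?K) = ?\<rho> / \<rho>0 * (1 / (3 * 2 ^ (?d + 1)))"
    unfolding K using E(2) by (simp add: J_def field_simps)
  moreover have "(?\<rho> / \<rho>0 * (1 / (3 * 2 ^ (?d + 1)))) ^ ?d = real i powr - \<sigma> / E"
  proof -
    have e: "(1 / (3 * 2 ^ (?d + 1))) ^ ?d = 1 / real E" unfolding E_def power_divide by simp
    have "(?\<rho> / \<rho>0) ^ ?d = real i powr - \<sigma>"
      using i by (simp add: power_divide \<rho>0 radius_power powr_minus field_simps)
    then show ?thesis unfolding power_mult_distrib e by simp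
  qed
  ultimately have H: "real i powr - \<sigma> / (2 * E) \<le> measure haar H" by simp
  have "measure haar V \<le> real (card {1..<block_len i}) * (2 * ?\<rho>) ^ ?d"
    unfolding V_def using \<rho> by (intro measure_returns_le) auto
  also have "\<dots> \<le> block_len i * (2 * ?\<rho>) ^ ?d" using \<rho> by (intro mult_right_mono) auto
  also have "\<dots> = real i powr - \<sigma> / (4 * E)"
    using i unfolding power_mult_distrib by (simp add: radius_power block_span_def E powr_minus field_simps)
  finally have V: "measure haar V \<le> real i powr - \<sigma> / (4 * E)" .
  have "close_return \<sigma> i = {\<alpha>. zmul (int (dyad i)) \<alpha> \<in> H - V}"
    by (auto simp: close_return_def H_def V_def zmul_zmul)
  then have "measure haar (close_return \<sigma> i :: 'd torus set) = measure haar (H - V)"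
    using measure_haar_zmul[of "int (dyad i)" "H - V"] by simp
  also have "\<dots> \<ge> measure haar H - measure haar V"
  proof -
    have "measure haar H \<le> measure haar ((H - V) \<union> V)" by (intro haar.finite_measure_mono) auto
    also have "\<dots> \<le> measure haar (H - V) + measure haar V" by (intro measure_Un_le) auto
    finally show ?thesis by simp
  qed
  also have "measure haar H - measure haar V \<ge> real i powr - \<sigma> / (2 * E) - real i powr - \<sigma> / (4 * E)"
    using H V by linarith
  also have "real i powr - \<sigma> / (2 * E) - real i powr - \<sigma> / (4 * E) = 2 ^ ?d / gap_const ?d * real i powr - \<sigma>"
    using E(2) by (simp add: E(1) field_simps)
  finally show ?thesis .
qed

lemma add_power_le:
  fixes a x :: real
  assumes "0 \<le> a" "a \<le> 2" "0 \<le> x" "x \<le> 1"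
  shows "(a + x) ^ n \<le> a ^ n + n * 3 ^ n * x"
proof (induction n)
  case (Suc n)
  have "(a + x) ^ Suc n \<le> (a + x) * (a ^ n + n * 3 ^ n * x)"
    using Suc assms by (simp add: mult_left_mono)
  also have "\<dots> = a ^ Suc n + a ^ n * x + (a + x) * (n * 3 ^ n * x)" by (simp add: algebra_simps)
  also have "\<dots> \<le> a ^ Suc n + 3 ^ Suc n * x + 3 * (n * 3 ^ n * x)"
  proof -
    have "a ^ n \<le> 3 ^ n" using assms by (intro power_mono) auto
    also have "\<dots> \<le> (3 :: real) ^ Suc n" by simp
    finally have "a ^ n * x \<le> 3 ^ Suc n * x" using assms by (intro mult_right_mono) auto
    moreover have "(a + x) * (n * 3 ^ n * x) \<le> 3 * (n * 3 ^ n * x)"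
      using assms by (intro mult_right_mono) auto
    ultimately show ?thesis by linarith
  qed
  finally show ?case by (simp add: algebra_simps)
qed simp

lemma measure_two_multiples_le:
  assumes jk: "j > 0" "k > 0" and \<rho>: "0 \<le> \<rho>" "\<rho> \<le> 1" "0 \<le> \<rho>'"
  shows "measure haar {\<alpha> :: 'd::finite torus. zmul (int j) \<alpha> \<in> tcube \<rho> \<and> zmul (int k) \<alpha> \<in> tcube \<rho>'}
    \<le> (2 * \<rho>') ^ CARD('d) * ((2 * \<rho>) ^ CARD('d) + real CARD('d) * 3 ^ CARD('d) * (real (gcd j k) / real k))"
proof -
  have "gcd j k \<le> k" using jk by (intro dvd_imp_le) auto
  then have "real (gcd j k) / real k \<le> 1" using jk by simp
  then have "(2 * \<rho> + real (gcd j k) / real k) ^ CARD('d)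
      \<le> (2 * \<rho>) ^ CARD('d) + real CARD('d) * 3 ^ CARD('d) * (real (gcd j k) / real k)"
    using \<rho> by (intro add_power_le) auto
  then show ?thesis
    using measure_two_multiples_in_cubes[OF jk \<rho>(1,3), where 'd = 'd] \<rho>
    by (meson mult_left_mono order_trans zero_le_mult_iff zero_le_numeral zero_le_power)
qed

lemma sum_gcd_div_inj_le:
  fixes u :: "'i \<Rightarrow> nat" and v :: "'j \<Rightarrow> nat"
  assumes "inj_on u A" "u ` A \<subseteq> {1..J}" "inj_on v B" "v ` B \<subseteq> {1..K}" "K > 0"
  shows "(\<Sum>a\<in>A. \<Sum>b\<in>B. real (gcd (u a) (v b)) / real (v b)) \<le> J * (1 + ln (real K))\<^sup>2"
proof -
  have "(\<Sum>a\<in>A. \<Sum>b\<in>B. real (gcd (u a) (v b)) / real (v b))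
      = (\<Sum>j\<in>u ` A. \<Sum>k\<in>v ` B. real (gcd j k) / real k)"
    by (simp add: sum.reindex assms)
  also have "\<dots> \<le> (\<Sum>j=1..J. \<Sum>k=1..K. real (gcd j k) / real k)"
  proof (rule order_trans[OF sum_mono sum_mono2])
    fix j show "(\<Sum>k\<in>v ` B. real (gcd j k) / real k) \<le> (\<Sum>k=1..K. real (gcd j k) / real k)"
      using assms by (intro sum_mono2) auto
  qed (use assms in \<open>auto intro!: sum_nonneg\<close>)
  also have "\<dots> \<le> J * (1 + ln (real K))\<^sup>2" by (rule sum_gcd_div_le) fact
  finally show ?thesis .
qed

lemma measure_returns_pair_le:
  assumes pos: "q > 0" "q' > 0" "K > 0" and \<rho>: "0 \<le> \<rho>" "\<rho> \<le> 1" "0 \<le> \<rho>'"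
  shows "measure haar {\<alpha> :: 'd::finite torus. (\<exists>k\<in>{1..J}. zmul (int (k * q)) \<alpha> \<in> tcube \<rho>)
      \<and> (\<exists>k\<in>{1..K}. zmul (int (k * q')) \<alpha> \<in> tcube \<rho>')}
    \<le> (2 * \<rho>') ^ CARD('d) * (J * K * (2 * \<rho>) ^ CARD('d)
        + real CARD('d) * 3 ^ CARD('d) * ((J * q) * (1 + ln (real (K * q')))\<^sup>2))"
proof -
  let ?d = "CARD('d)"
  let ?g = "\<lambda>k k'. real (gcd (k * q) (k' * q')) / real (k' * q')"
  have "{\<alpha> :: 'd torus. (\<exists>k\<in>{1..J}. zmul (int (k * q)) \<alpha> \<in> tcube \<rho>)
      \<and> (\<exists>k\<in>{1..K}. zmul (int (k * q')) \<alpha> \<in> tcube \<rho>')}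
      = (\<Union>p\<in>{1..J} \<times> {1..K}. {\<alpha>. zmul (int (fst p * q)) \<alpha> \<in> tcube \<rho> \<and> zmul (int (snd p * q')) \<alpha> \<in> tcube \<rho>'})"
    by auto
  also have "measure haar \<dots> \<le> (\<Sum>p\<in>{1..J} \<times> {1..K}.
      measure haar {\<alpha> :: 'd torus. zmul (int (fst p * q)) \<alpha> \<in> tcube \<rho> \<and> zmul (int (snd p * q')) \<alpha> \<in> tcube \<rho>'})"
    by (intro measure_UNION_le) (simp, measurable)
  also have "\<dots> \<le> (\<Sum>p\<in>{1..J} \<times> {1..K}. (2 * \<rho>') ^ ?d * ((2 * \<rho>) ^ ?d + real ?d * 3 ^ ?d * ?g (fst p) (snd p)))"
    using pos \<rho> by (intro sum_mono measure_two_multiples_le) auto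
  also have "\<dots> = (2 * \<rho>') ^ ?d * (J * K * (2 * \<rho>) ^ ?d + real ?d * 3 ^ ?d * (\<Sum>p\<in>{1..J} \<times> {1..K}. ?g (fst p) (snd p)))"
    by (simp only: sum_distrib_left[symmetric] sum.distrib) simp
  also have "(\<Sum>p\<in>{1..J} \<times> {1..K}. ?g (fst p) (snd p)) = (\<Sum>k\<in>{1..J}. \<Sum>k'\<in>{1..K}. ?g k k')"
    by (simp add: sum.cartesian_product case_prod_beta)
  also have "(2 * \<rho>') ^ ?d * (J * K * (2 * \<rho>) ^ ?d + real ?d * 3 ^ ?d * (\<Sum>k\<in>{1..J}. \<Sum>k'\<in>{1..K}. ?g k k'))
     \<le> (2 * \<rho>') ^ ?d * (J * K * (2 * \<rho>) ^ ?d + real ?d * 3 ^ ?d * (real (J * q) * (1 + ln (real (K * q')))\<^sup>2))"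
    using pos \<rho> by (intro mult_left_mono add_left_mono sum_gcd_div_inj_le) (auto simp: inj_on_def)
  finally show ?thesis by simp
qed

text \<open>
  Sum the correlations of all pairs of multipliers. For \<open>i < l\<close> the total excess over independence is at
  most the measure of the later cube times a constant multiple of \<open>block_span i * dyad i\<close> and a power of
  \<open>ln (block_span l)\<close>; the growth of the scales makes this smaller than the main term.
\<close>

lemma close_return_quasi_independent:
  assumes \<sigma>: "0 \<le> \<sigma>" "\<sigma> \<le> 1"
  shows "\<exists>C\<ge>0. \<exists>N. \<forall>i l. N \<le> i \<longrightarrow> i < l \<longrightarrow>
    measure haar (close_return \<sigma> i \<inter> close_return \<sigma> l :: 'd::finite torus set)
      \<le> C * measure haar (close_return \<sigma> i :: 'd torus set) * measure haar (close_return \<sigma> l :: 'd torus set)"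
proof -
  let ?d = "CARD('d)"
  let ?K = "block_span ?d" and ?\<rho> = "radius ?d \<sigma>"
  define D :: real where "D = ?d * 3 ^ ?d"
  define c :: real where "c = 2 ^ ?d / gap_const ?d"
  define C where "C = 2 ^ ?d * (2 ^ ?d + D) / c\<^sup>2"
  have D: "D \<ge> 0" and c: "c > 0" by (simp_all add: D_def c_def)
  have C: "C \<ge> 0" using D c by (simp add: C_def)
  obtain N where N: "\<And>l. l \<ge> N \<Longrightarrow> 1 + ln (real (2 * ?K l * dyad l)) \<le> real l ^ 3"
    using eventually_log_le_cube[of ?d] unfolding eventually_sequentially by blast
  have "measure haar (close_return \<sigma> i \<inter> close_return \<sigma> l :: 'd torus set)
      \<le> C * measure haar (close_return \<sigma> i :: 'd torus set) * measure haar (close_return \<sigma> l :: 'd torus set)"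
    if i: "N + 2 ^ ?d + 1 \<le> i" and il: "i < l" for i l
  proof -
    have i0: "i > 0" "l > 0" "i \<ge> 1" "l \<ge> 1" using i il by auto
    have ri: "?\<rho> i ^ ?d = 1 / (?K i * real i powr \<sigma>)" "?\<rho> l ^ ?d = 1 / (?K l * real l powr \<sigma>)"
      using i0 by (simp_all add: radius_power)
    have rpos: "?\<rho> i > 0" "?\<rho> l > 0" using i0 by (simp_all add: radius_pos)
    have half: "?\<rho> i < 1 / 2" using i \<sigma> by (intro radius_less_half) auto
    have "measure haar (close_return \<sigma> i \<inter> close_return \<sigma> l :: 'd torus set)
      \<le> measure haar {\<alpha> :: 'd::finite torus. (\<exists>k\<in>{1..?K i}. zmul (int (k * dyad i)) \<alpha> \<in> tcube (?\<rho> i))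
      \<and> (\<exists>k\<in>{1..?K l}. zmul (int (k * dyad l)) \<alpha> \<in> tcube (?\<rho> l))}" (is "_ \<le> measure haar ?M")
    proof (rule haar.finite_measure_mono)
      show "?M \<in> sets haar" by measurable
    qed (auto simp: close_return_def)
    also have "\<dots> \<le> (2 * ?\<rho> l) ^ ?d * (?K i * ?K l * (2 * ?\<rho> i) ^ ?d
        + real ?d * 3 ^ ?d * (real (?K i * dyad i) * (1 + ln (real (?K l * dyad l)))\<^sup>2))"
      using half rpos by (intro order_trans[OF measure_returns_pair_le]) auto
    also have "\<dots> \<le> (2 * ?\<rho> l) ^ ?d * (?K i * ?K l * (2 * ?\<rho> i) ^ ?d + D * (?K i * ?K l * ?\<rho> i ^ ?d))"
    proof -
      have "(1 + ln (real (?K l * dyad l)))\<^sup>2 \<le> (real l ^ 3)\<^sup>2"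
      proof (rule power_mono)
        have "ln (real (?K l * dyad l)) \<le> ln (real (2 * ?K l * dyad l))"
          by (subst ln_le_cancel_iff) auto
        then show "1 + ln (real (?K l * dyad l)) \<le> real l ^ 3" using N[of l] i il by linarith
        have "real (?K l * dyad l) \<ge> 1" using block_span_pos[of ?d l] dyad_pos[of l]
          by (metis One_nat_def Suc_leI nat_0_less_mult_iff of_nat_1 of_nat_le_iff)
        then show "0 \<le> 1 + ln (real (?K l * dyad l))" by (simp add: ln_ge_zero)
      qed
      then have "real (?K i * dyad i) * (1 + ln (real (?K l * dyad l)))\<^sup>2 \<le> real (?K i * l) * (real l ^ 6)"
      proof (intro mult_mono)
        show "real (?K i * dyad i) \<le> real (?K i * l)" using dyad_le[of i] i0 il by (simp add: mult_left_mono)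
      qed (auto simp: power_mult[symmetric])
      also have "\<dots> = ?K i * real l ^ 7" by (simp add: eval_nat_numeral)
      also have "\<dots> \<le> ?K i * (real l ^ 12 / real i powr \<sigma>)"
      proof (intro mult_left_mono)
        have "real i powr \<sigma> \<le> real l powr 1" 
          using \<sigma> i0 il order_trans[OF powr_mono[of \<sigma> 1 "real i"] powr_mono2[of 1 "real i" "real l"]] by auto
        then have "real l ^ 7 * real i powr \<sigma> \<le> real l ^ 7 * real l" using i0 by (intro mult_left_mono) auto
        also have "\<dots> = real l ^ 8" by (simp add: eval_nat_numeral)
        also have "\<dots> \<le> real l ^ 12" using i0 by (intro power_increasing) auto
        finally show "real l ^ 7 \<le> real l ^ 12 / real i powr \<sigma>" using i0 by (simp add: field_simps)
      qed simp
      also have "\<dots> = gap_const ?d * real (block_len i * l ^ 12) / real i powr \<sigma>" by (simp add: block_span_def)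
      also have "\<dots> \<le> gap_const ?d * real (block_len l) / real i powr \<sigma>"
        using block_len_growth[OF il] by (intro divide_right_mono mult_left_mono) (simp_all only: of_nat_le_iff, auto)
      also have "\<dots> = ?K i * ?K l * ?\<rho> i ^ ?d" unfolding ri by (simp add: block_span_def)
      finally show ?thesis
        unfolding D_def using rpos by (intro mult_left_mono add_left_mono) auto
    qed
    also have "\<dots> = 2 ^ ?d * (2 ^ ?d + D) * (?K i * ?\<rho> i ^ ?d) * (?K l * ?\<rho> l ^ ?d)"
      by (simp add: power_mult_distrib algebra_simps)
    also have "\<dots> = 2 ^ ?d * (2 ^ ?d + D) * (real i powr - \<sigma> * real l powr - \<sigma>)"
      unfolding ri using i0 by (simp add: powr_minus field_simps)
    also have "\<dots> = C * (c * real i powr - \<sigma>) * (c * real l powr - \<sigma>)"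
      using c by (simp add: C_def power2_eq_square)
    also have "\<dots> \<le> C * measure haar (close_return \<sigma> i :: 'd torus set) * measure haar (close_return \<sigma> l :: 'd torus set)"
      using C c measure_close_return_ge[OF i0(3) \<sigma>(1), where 'd = 'd] measure_close_return_ge[OF i0(4) \<sigma>(1), where 'd = 'd]
      by (intro mult_mono) (auto simp: c_def)
    finally show ?thesis .
  qed
  then show ?thesis using C by blast
qed

text \<open>
  The Kochen--Stone inequality with some constant \<open>C\<close> gives divergence with positive probability. For large
  \<open>i\<close> a dyadic torsion point is annihilated by \<open>dyad i\<close>, so divergence is invariant under translation
  of \<open>\<alpha>\<close> by such points and the zero-one law applies.
\<close>

theorem close_returns_AE:
  assumes \<sigma>: "0 \<le> \<sigma>" "\<sigma> \<le> 1"
  shows "AE \<alpha> in (haar :: 'd::finite torus measure).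
    \<not> summable (\<lambda>i. real i powr (\<sigma> - 1) * indicator (close_return \<sigma> i) \<alpha>)"
proof -
  define A :: "'d torus set" where
    "A = {\<alpha> \<in> space haar. \<not> summable (\<lambda>i. real i powr (\<sigma> - 1) * indicator (close_return \<sigma> i) \<alpha>)}"
  have A [measurable]: "A \<in> sets borel"
    unfolding A_def summable_iff_convergent Cauchy_convergent_iff[symmetric] by measurable
  obtain C N where C: "C \<ge> 0" and N: "\<And>i l. N \<le> i \<Longrightarrow> i < l \<Longrightarrow>
    measure haar (close_return \<sigma> i \<inter> close_return \<sigma> l :: 'd::finite torus set)
      \<le> C * measure haar (close_return \<sigma> i :: 'd torus set) * measure haar (close_return \<sigma> l :: 'd torus set)"
    using close_return_quasi_independent[OF \<sigma>, where 'd = 'd] by blast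
  have "1 \<le> C * measure haar A"
    unfolding A_def
  proof (rule haar.kochen_stone_weighted[OF _ _ _ _ C])
    show "\<not> summable (\<lambda>i. real i powr (\<sigma> - 1) * measure haar (close_return \<sigma> i :: 'd torus set))"
    proof
      assume sm: "summable (\<lambda>i. real i powr (\<sigma> - 1) * measure haar (close_return \<sigma> i :: 'd torus set))"
      define c :: real where "c = 2 ^ CARD('d) / gap_const CARD('d)"
      have c: "c > 0" by (simp add: c_def)
      have "summable (\<lambda>i. c * (1 / real i))"
      proof (rule summable_comparison_test_ev[OF _ sm], use eventually_ge_at_top[of 1] in eventually_elim)
        fix i :: nat assume i: "i \<ge> 1"
        have "c * (1 / real i) = real i powr (\<sigma> - 1) * (c * real i powr - \<sigma>)"
          using i by (simp add: powr_minus powr_diff field_simps)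
        also have "\<dots> \<le> real i powr (\<sigma> - 1) * measure haar (close_return \<sigma> i :: 'd torus set)"
          using measure_close_return_ge[OF i \<sigma>(1), where 'd = 'd] by (intro mult_left_mono) (auto simp: c_def)
        finally show "norm (c * (1 / real i)) \<le> real i powr (\<sigma> - 1) * measure haar (close_return \<sigma> i :: 'd torus set)"
          using c by simp
      qed
      then have "summable (\<lambda>i. 1 / real i)" using c summable_cmult_iff[of c "\<lambda>i. 1 / real i"] by simp
      then show False using not_summable_harmonic[where 'a = real] by (simp add: inverse_eq_divide)
    qed
    show "real i powr (\<sigma> - 1) \<le> 1" for i
      using \<sigma> powr_mono[of "\<sigma> - 1" 0 "real i"] by (cases "i = 0") auto
  qed (use N in auto)
  then have pos: "measure haar A \<noteq> 0" by auto
  have "measure haar A = 0 \<or> measure haar A = 1"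
  proof (rule zero_one_dyadic_torsion[OF A])
    fix n p and x :: "'d torus"
    have "eventually (\<lambda>i. real i powr (\<sigma> - 1) * indicator (close_return \<sigma> i) (x + torsion_point (2 ^ n) p)
        = real i powr (\<sigma> - 1) * (indicator (close_return \<sigma> i) x :: real)) sequentially"
      using dyad_dvd_eventually[of n]
    proof eventually_elim
      case (elim i)
      have "zmul (int (k * dyad i)) (torsion_point (2 ^ n) p) = (0 :: 'd torus)" for k
      proof -
        obtain m where m: "dyad i = 2 ^ n * m" using elim by blast
        have "real_of_int (int (k * dyad i)) * (real_of_int (p $ j) / real (2 ^ n)) = real_of_int (int (k * m) * p $ j)" for j
          by (simp add: m)
        then have "real_of_int (int (k * dyad i)) * (real_of_int (p $ j) / real (2 ^ n)) \<in> \<int>" for j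
          by (metis Ints_of_int)
        then show ?thesis
          unfolding torsion_point_def zmul_to_torus zero_torus.abs_eq to_torus_eq_iff by simp
      qed
      then have "x + torsion_point (2 ^ n) p \<in> close_return \<sigma> i \<longleftrightarrow> x \<in> close_return \<sigma> i"
        unfolding close_return_def by (simp add: zmul_add_right)
      then show ?case by (simp add: indicator_def)
    qed
    then show "x + torsion_point (2 ^ n) p \<in> A \<longleftrightarrow> x \<in> A"
      unfolding A_def using summable_cong[of "\<lambda>i. real i powr (\<sigma> - 1) * indicator (close_return \<sigma> i) (x + torsion_point (2 ^ n) p)"]
      by simp
  qed
  then have "AE \<alpha> in haar. \<alpha> \<in> A" using pos haar.prob_eq_1[of A] by simp
  then show ?thesis by eventually_elim (simp add: A_def)
qed

section \<open>Equidistribution between different scales\<close>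

text \<open>
  The windows start at \<open>block_len i\<close> rather than at \<open>0\<close> so that times at different scales never
  coincide (\<open>window_time_less\<close>).
\<close>

definition window :: "nat \<Rightarrow> nat set" where
  "window i = {block_len i..<2 * block_len i}"

text \<open>
  The number of pairs of a point of the orbit segment at scale \<open>i\<close> and one at scale \<open>l\<close> whose cubes
  meet. Equidistribution predicts \<open>block_len i * block_len l\<close> times the measure of a cube of radius
  \<open>(radius i + radius l) / 2\<close>.
\<close>

definition overlap :: "real \<Rightarrow> nat \<Rightarrow> nat \<Rightarrow> 'd::finite torus \<Rightarrow> real" where
  "overlap \<sigma> i l \<alpha> = (\<Sum>(j, j')\<in>window i \<times> window l. indicator
     {\<alpha>. zmul (int (j' * dyad l - j * dyad i)) \<alpha> \<in> tcube ((radius CARD('d) \<sigma> i + radius CARD('d) \<sigma> l) / 2)} \<alpha>)"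

lemma window_simps [simp]: "finite (window i)" "card (window i) = block_len i" "window i \<noteq> {}"
  by (simp_all add: window_def)

lemma window_time_less:
  assumes "1 \<le> i" "i < l" "j \<in> window i" "j' \<in> window l"
  shows "j * dyad i < j' * dyad l"
proof -
  have "2 ^ 1 \<le> l ^ 1" using assms by simp
  also have "l ^ 1 \<le> l ^ 12" using assms by (intro power_increasing) auto
  finally have "2 \<le> l ^ 12" by simp
  then have "block_len i * 2 \<le> block_len i * l ^ 12" by (rule mult_le_mono2)
  moreover have "j < 2 * block_len i" "block_len l \<le> j'" using assms(3,4) by (auto simp: window_def)
  ultimately have "j < j'" using block_len_growth[OF assms(2)] by linarith
  moreover have "dyad i \<le> dyad l" using dyad_mono[of i l] assms by simp
  ultimately show ?thesis by (intro mult_less_le_imp_less) auto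
qed

text \<open>
  Chebyshev's inequality. The variance is a sum of correlations of two multiples of \<open>\<alpha>\<close>. For fixed times
  \<open>j\<close> and \<open>t\<close> at scale \<open>i\<close>, distinct times at scale \<open>l\<close> give distinct multiples, so the gcd sum applies
  and its total is multiplied by \<open>(block_len i)\<^sup>2\<close> only.
\<close>

lemma measure_overlap_large:
  assumes \<sigma>: "0 \<le> \<sigma>" "\<sigma> \<le> 1" and \<delta>: "\<delta> > 0"
  shows "\<exists>C\<ge>0. \<exists>N\<ge>1. \<forall>i l. N \<le> i \<longrightarrow> i < l \<longrightarrow>
    measure haar {\<alpha> :: 'd::finite torus. overlap \<sigma> i l \<alpha> \<ge> (1 + \<delta>) * (block_len i * block_len l
      * (radius CARD('d) \<sigma> i + radius CARD('d) \<sigma> l) ^ CARD('d))} \<le> C / real l ^ 4"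
proof -
  let ?d = "CARD('d)"
  let ?K = "block_span ?d" and ?\<rho> = "radius ?d \<sigma>" and ?J = block_len
  define D :: real where "D = real ?d * 3 ^ ?d"
  define C where "C = 2 * D * gap_const ?d / \<delta>\<^sup>2"
  have D: "D \<ge> 0" by (simp add: D_def)
  have C: "C \<ge> 0" using D by (simp add: C_def)
  obtain N where N: "\<And>l. l \<ge> N \<Longrightarrow> 1 + ln (real (2 * ?K l * dyad l)) \<le> real l ^ 3"
    using eventually_log_le_cube[of ?d] unfolding eventually_sequentially by blast
  have "measure haar {\<alpha> :: 'd torus. overlap \<sigma> i l \<alpha> \<ge> (1 + \<delta>) * (?J i * ?J l * (?\<rho> i + ?\<rho> l) ^ ?d)} \<le> C / real l ^ 4"
    if i: "N + 2 ^ ?d + 1 \<le> i" and il: "i < l" for i l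
  proof -
    have i0: "i > 0" "l > 0" "i \<ge> 1" "l \<ge> 1" using i il by auto
    have rpos: "?\<rho> i > 0" "?\<rho> l > 0" using i0 by (simp_all add: radius_pos)
    have half: "?\<rho> i < 1 / 2" by (rule radius_less_half) (use i \<sigma> in auto)
    have half': "?\<rho> l < 1 / 2" by (rule radius_less_half) (use i il \<sigma> in auto)
    define r where "r = (?\<rho> i + ?\<rho> l) / 2"
    have r: "r > 0" "r < 1 / 2" "r \<le> 1" using rpos half half' by (auto simp: r_def)
    define p where "p = (2 * r) ^ ?d"
    have p: "p > 0" using r by (simp add: p_def)
    define A where "A = window i \<times> window l"
    define h where "h a = (case a of (j, j') \<Rightarrow> j' * dyad l - j * dyad i)" for a :: "nat \<times> nat"
    define E :: "nat \<times> nat \<Rightarrow> 'd torus set" where "E a = {\<alpha>. zmul (int (h a)) \<alpha> \<in> tcube r}" for a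
    define H where "H = 2 * ?J l * dyad l"
    have H: "H > 0" by (simp add: H_def)
    have E: "E a \<in> sets haar" for a unfolding E_def by measurable
    have hpos: "h a > 0" if "a \<in> A" for a
      using that window_time_less[OF i0(3) il] by (auto simp: A_def h_def)
    have hrange: "(\<lambda>j'. h (j, j')) ` window l \<subseteq> {1..H}" if j: "j \<in> window i" for j
    proof safe
      fix j' assume j': "j' \<in> window l"
      have "h (j, j') \<le> j' * dyad l" by (simp add: h_def)
      also have "\<dots> \<le> H" unfolding H_def using j' by (intro mult_right_mono) (auto simp: window_def)
      finally show "h (j, j') \<in> {1..H}" using hpos[of "(j, j')"] j j' by (simp add: A_def)
    qed
    have hinj: "inj_on (\<lambda>j'. h (j, j')) (window l)" if j: "j \<in> window i" for j
    proof (rule inj_onI)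
      fix a b assume ab: "a \<in> window l" "b \<in> window l" "h (j, a) = h (j, b)"
      then have "a * dyad l - j * dyad i = b * dyad l - j * dyad i" by (simp add: h_def)
      then have "a * dyad l = b * dyad l"
        using window_time_less[OF i0(3) il j ab(1)] window_time_less[OF i0(3) il j ab(2)]
        by (metis eq_diff_iff less_imp_le)
      then show "a = b" by simp
    qed
    have "(\<Sum>a\<in>A. \<Sum>b\<in>A. measure haar (E a \<inter> E b)) \<le> (\<Sum>a\<in>A. \<Sum>b\<in>A. p * (p + D * (real (gcd (h a) (h b)) / real (h b))))"
    proof (intro sum_mono)
      fix a b assume ab: "a \<in> A" "b \<in> A"
      have "E a \<inter> E b = {\<alpha>. zmul (int (h a)) \<alpha> \<in> tcube r \<and> zmul (int (h b)) \<alpha> \<in> tcube r}" by (auto simp: E_def)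
      then show "measure haar (E a \<inter> E b) \<le> p * (p + D * (real (gcd (h a) (h b)) / real (h b)))"
        using measure_two_multiples_le[OF hpos[OF ab(1)] hpos[OF ab(2)], of r r, where 'd = 'd] r
        by (simp add: p_def D_def)
    qed
    also have "\<dots> = (card A * p)\<^sup>2 + p * D * (\<Sum>a\<in>A. \<Sum>b\<in>A. real (gcd (h a) (h b)) / real (h b))"
      by (simp only: distrib_left sum.distrib mult.assoc sum_distrib_left[symmetric])
        (simp add: power2_eq_square algebra_simps)
    also have "(\<Sum>a\<in>A. \<Sum>b\<in>A. real (gcd (h a) (h b)) / real (h b))
        = (\<Sum>j\<in>window i. \<Sum>j'\<in>window l. \<Sum>t\<in>window i. \<Sum>t'\<in>window l. real (gcd (h (j, j')) (h (t, t'))) / real (h (t, t')))"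
      by (simp only: A_def sum.cartesian_product')
    also have "\<dots> = (\<Sum>j\<in>window i. \<Sum>t\<in>window i. \<Sum>j'\<in>window l. \<Sum>t'\<in>window l. real (gcd (h (j, j')) (h (t, t'))) / real (h (t, t')))"
      by (intro sum.cong refl sum.swap)
    also have "\<dots> \<le> (\<Sum>j\<in>window i. \<Sum>t\<in>window i. H * (1 + ln (real H))\<^sup>2)"
      by (intro sum_mono sum_gcd_div_inj_le hinj hrange H)
    also have "\<dots> = (?J i)\<^sup>2 * (H * (1 + ln (real H))\<^sup>2)" by (simp add: power2_eq_square)
    finally have sum2: "(\<Sum>a\<in>A. \<Sum>b\<in>A. measure haar (E a \<inter> E b))
        \<le> (card A * p)\<^sup>2 + p * D * ((?J i)\<^sup>2 * (H * (1 + ln (real H))\<^sup>2))"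
      using p D by (simp add: mult_left_mono)
    have cardA: "real (card A) = ?J i * ?J l" by (simp add: A_def card_cartesian_product)
    have "2 * r = ?\<rho> i + ?\<rho> l" unfolding r_def by simp
    then have p_eq: "p = (?\<rho> i + ?\<rho> l) ^ ?d" by (simp only: p_def)
    have "measure haar {\<alpha> :: 'd torus. overlap \<sigma> i l \<alpha> \<ge> (1 + \<delta>) * (?J i * ?J l * (?\<rho> i + ?\<rho> l) ^ ?d)}
      = measure haar {x \<in> space haar. (\<Sum>a\<in>A. indicator (E a) x) \<ge> (1 + \<delta>) * (card A * p)}"
      by (simp add: cardA overlap_def A_def E_def h_def p_eq r_def case_prod_beta')
    also have "\<dots> \<le> p * D * ((?J i)\<^sup>2 * (H * (1 + ln (real H))\<^sup>2)) / (\<delta> * (card A * p))\<^sup>2"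
    proof (rule haar.chebyshev_count[OF _ E _ p _ \<delta> sum2])
      show "finite A" "A \<noteq> {}" by (simp_all add: A_def)
      fix a assume "a \<in> A"
      then show "measure haar (E a) = p"
        unfolding E_def using hpos r by (subst measure_haar_zmul) (auto simp: p_def measure_haar_tcube_eq)
    qed
    also have "\<dots> = D * H * (1 + ln (real H))\<^sup>2 / (\<delta>\<^sup>2 * (?J l)\<^sup>2 * p)"
    proof -
      have alg: "p * D * (x\<^sup>2 * (h * L)) / (\<delta> * (x * y * p))\<^sup>2 = D * h * L / (\<delta>\<^sup>2 * y\<^sup>2 * p)"
        if "x > 0" "y > 0" for x y h L :: real
        using p \<delta> that by (simp add: power2_eq_square ac_simps)
      show ?thesis unfolding cardA of_nat_mult of_nat_power by (rule alg) auto
    qed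
    also have "\<dots> \<le> D * H * (real l ^ 6) / (\<delta>\<^sup>2 * (?J l)\<^sup>2 * p)"
    proof (intro divide_right_mono mult_left_mono)
      have "H \<le> 2 * ?K l * dyad l" unfolding H_def block_span_def
        using gap_const_pos[of ?d] by (intro mult_right_mono mult_left_mono) (auto simp: Suc_le_eq)
      then have "ln (real H) \<le> ln (real (2 * ?K l * dyad l))"
        using H by (subst ln_le_cancel_iff) (auto simp only: of_nat_le_iff of_nat_0_less_iff)
      then have "1 + ln (real H) \<le> real l ^ 3" using N[of l] i il by linarith
      moreover have "0 \<le> 1 + ln (real H)" using H by (simp add: ln_ge_zero Suc_le_eq)
      ultimately have "(1 + ln (real H))\<^sup>2 \<le> (real l ^ 3)\<^sup>2" by (rule power_mono)
      then show "(1 + ln (real H))\<^sup>2 \<le> real l ^ 6" by (simp add: power_mult[symmetric])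
    qed (use D p in auto)
    also have "\<dots> = 2 * D / \<delta>\<^sup>2 * (dyad l * real l ^ 6) / (?J l * p)"
      by (simp add: H_def power2_eq_square field_simps)
    also have "\<dots> \<le> 2 * D / \<delta>\<^sup>2 * (real l * real l ^ 6) * (?K i * real l) / ?J l"
    proof -
      have "1 / p \<le> ?K i * real l"
      proof -
        have "real i powr \<sigma> \<le> real l powr 1" 
          using \<sigma> i0 il order_trans[OF powr_mono[of \<sigma> 1 "real i"] powr_mono2[of 1 "real i" "real l"]] by auto
        then have "1 / (?K i * real l) \<le> 1 / (?K i * real i powr \<sigma>)"
          using i0 by (intro divide_left_mono mult_left_mono) auto
        also have "\<dots> = ?\<rho> i ^ ?d" using i0 by (simp add: radius_power)
        also have "\<dots> \<le> p" unfolding p_def r_def using rpos by (intro power_mono) auto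
        finally show ?thesis using p i0 by (simp add: field_simps)
      qed
      then have "2 * D / \<delta>\<^sup>2 * (dyad l * real l ^ 6) * (1 / p) / ?J l \<le> 2 * D / \<delta>\<^sup>2 * (real l * real l ^ 6) * (?K i * real l) / ?J l"
        using D p dyad_le[OF i0(4)] by (intro divide_right_mono mult_mono mult_left_mono mult_right_mono) auto
      then show ?thesis by (simp add: ac_simps)
    qed
    also have "\<dots> = C * (?J i * real l ^ 8) / ?J l" by (simp add: C_def block_span_def field_simps eval_nat_numeral)
    also have "\<dots> = C * (?J i * real l ^ 12) / ?J l / real l ^ 4" using i0 by (simp add: field_simps eval_nat_numeral)
    also have "\<dots> \<le> C * ?J l / ?J l / real l ^ 4"
    proof (intro divide_right_mono mult_left_mono C)
      have "real (?J i * l ^ 12) \<le> real (?J l)" using block_len_growth[OF il] by (simp only: of_nat_le_iff)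
      then show "?J i * real l ^ 12 \<le> ?J l" by simp
    qed auto
    finally show ?thesis by simp
  qed
  then show ?thesis using C by (intro exI[of _ C] conjI exI[of _ "N + 2 ^ ?d + 1"]) auto
qed

lemma overlap_le_AE:
  assumes \<sigma>: "0 \<le> \<sigma>" "\<sigma> \<le> 1" and \<delta>: "\<delta> > 0"
  shows "AE \<alpha> in (haar :: 'd::finite torus measure). \<exists>N. \<forall>i l. N \<le> i \<longrightarrow> i < l \<longrightarrow>
    overlap \<sigma> i l \<alpha> \<le> (1 + \<delta>) * (block_len i * block_len l
      * (radius CARD('d) \<sigma> i + radius CARD('d) \<sigma> l) ^ CARD('d))"
proof -
  define B :: "nat \<Rightarrow> nat \<Rightarrow> 'd torus set" where "B i l = {\<alpha>. overlap \<sigma> i l \<alpha> \<ge> (1 + \<delta>) * (block_len i * block_len l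
      * (radius CARD('d) \<sigma> i + radius CARD('d) \<sigma> l) ^ CARD('d))}" for i l
  have [measurable]: "overlap \<sigma> i l \<in> borel_measurable (borel :: 'd torus measure)" for i l
    unfolding overlap_def case_prod_beta' by measurable
  have B [measurable]: "B i l \<in> sets haar" for i l unfolding B_def by measurable
  obtain C N where C: "C \<ge> 0" and N: "N \<ge> 1" "\<And>i l. N \<le> i \<Longrightarrow> i < l \<Longrightarrow> measure haar (B i l) \<le> C / real l ^ 4"
    using measure_overlap_large[OF \<sigma> \<delta>, where 'd = 'd] unfolding B_def by blast
  have "AE \<alpha> in haar. eventually (\<lambda>l. \<alpha> \<notin> (\<Union>i\<in>{N..<l}. B i l)) sequentially"
  proof (rule haar.borel_cantelli_power_AE)
    fix l :: nat assume l: "l > 0"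
    have "measure haar (\<Union>i\<in>{N..<l}. B i l) \<le> (\<Sum>i\<in>{N..<l}. measure haar (B i l))"
      by (intro measure_UNION_le B) auto
    also have "\<dots> \<le> (\<Sum>i\<in>{N..<l}. C / real l ^ 4)" using N by (intro sum_mono) auto
    also have "\<dots> \<le> l * (C / real l ^ 4)" using C by (auto intro!: divide_right_mono mult_right_mono)
    also have "\<dots> = C * real l powr - 3" using l by (simp add: powr_minus field_simps eval_nat_numeral)
    finally show "measure haar (\<Union>i\<in>{N..<l}. B i l) \<le> C * real l powr - 3" .
  next
    show "(\<Union>i\<in>{N..<l}. B i l) \<in> sets haar" for l by (intro sets.finite_UN B) simp
  qed simp
  then show ?thesis
  proof eventually_elim
    case (elim \<alpha>)
    then obtain L where L: "\<And>l i. l \<ge> L \<Longrightarrow> N \<le> i \<Longrightarrow> i < l \<Longrightarrow> \<alpha> \<notin> B i l"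
      unfolding eventually_sequentially by force
    show ?case
      using L by (intro exI[of _ "max L N"]) (force simp: B_def not_le intro: less_imp_le)
  qed
qed

section \<open>Hits at scales with a close return\<close>

definition hit :: "real \<Rightarrow> 'd::finite torus \<Rightarrow> nat \<Rightarrow> 'd torus set" where
  "hit \<sigma> \<alpha> i = (\<Union>j\<in>window i. {w. w + zmul (int (j * dyad i)) \<alpha> \<in> tcube (radius CARD('d) \<sigma> i / 2)})"

lemma hit_borel [measurable]: "hit \<sigma> \<alpha> i \<in> sets borel"
proof -
  have "{w. w + c \<in> tcube r} \<in> sets borel" for c :: "'a torus" and r by measurable
  then show ?thesis unfolding hit_def by (intro sets.finite_UN) auto
qed

text \<open>
  If \<open>\<alpha>\<close> has a close return at scale \<open>i\<close>, the cubes that make up \<open>hit \<sigma> \<alpha> i\<close> are disjoint.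
\<close>

lemma measure_hit:
  fixes \<alpha> :: "'d::finite torus"
  assumes "\<alpha> \<in> close_return \<sigma> i" "i > 0" "radius CARD('d) \<sigma> i < 1"
  shows "measure haar (hit \<sigma> \<alpha> i) = block_len i * radius CARD('d) \<sigma> i ^ CARD('d)"
proof -
  let ?\<rho> = "radius CARD('d) \<sigma> i"
  let ?c = "\<lambda>j. - zmul (int (j * dyad i)) \<alpha>"
  have sep: "zmul (int (k * dyad i)) \<alpha> \<notin> tcube ?\<rho>" if "k \<in> {1..<block_len i}" for k
    using assms(1) that by (auto simp: close_return_def)
  have sep2: "?c b - ?c a \<notin> tcube ?\<rho>" if "a \<in> window i" "b \<in> window i" "a > b" for a b
  proof -
    have "?c b - ?c a = zmul (int ((a - b) * dyad i)) \<alpha>"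
      using that by (simp add: zmul_diff_left of_nat_diff diff_mult_distrib algebra_simps flip: of_nat_mult)
    moreover have "a - b \<in> {1..<block_len i}" using that by (auto simp: window_def)
    ultimately show ?thesis using sep by metis
  qed
  have "measure haar (\<Union>j\<in>window i. {x. x - ?c j \<in> tcube (?\<rho> / 2)}) = card (window i) * measure haar (tcube (?\<rho> / 2) :: 'd torus set)"
  proof (rule measure_disjoint_cubes)
    fix a b assume "a \<in> window i" "b \<in> window i" "a \<noteq> b"
    then have "?c a - ?c b \<notin> tcube ?\<rho>"
      using sep2[of a b] sep2[of b a] tcube_diff_commute by (metis linorder_neqE_nat)
    then show "?c a - ?c b \<notin> tcube (2 * (?\<rho> / 2))" by simp
  qed simp
  then show ?thesis
    using assms radius_pos[of i "CARD('d)" \<sigma>] by (simp add: hit_def measure_haar_tcube_eq)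
qed

lemma measure_hit_inter_le:
  fixes \<alpha> :: "'d::finite torus"
  assumes "1 \<le> i" "i < l"
  shows "measure haar (hit \<sigma> \<alpha> i \<inter> hit \<sigma> \<alpha> l) \<le> radius CARD('d) \<sigma> l ^ CARD('d) * overlap \<sigma> i l \<alpha>"
proof -
  let ?\<rho> = "radius CARD('d) \<sigma>"
  let ?h = "\<lambda>p. snd p * dyad l - fst p * dyad i"
  let ?E = "\<lambda>p. {w. w + zmul (int (fst p * dyad i)) \<alpha> \<in> tcube (?\<rho> i / 2) \<and> w + zmul (int (snd p * dyad l)) \<alpha> \<in> tcube (?\<rho> l / 2)}"
  have eq: "hit \<sigma> \<alpha> i \<inter> hit \<sigma> \<alpha> l = (\<Union>p\<in>window i \<times> window l. ?E p)" by (auto simp: hit_def)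
  have "measure haar (hit \<sigma> \<alpha> i \<inter> hit \<sigma> \<alpha> l) \<le> (\<Sum>p\<in>window i \<times> window l. measure haar (?E p))"
    unfolding eq by (intro measure_UNION_le) (simp, measurable)
  also have "\<dots> \<le> (\<Sum>p\<in>window i \<times> window l. ?\<rho> l ^ CARD('d) *
      indicator {\<alpha>. zmul (int (?h p)) \<alpha> \<in> tcube ((?\<rho> i + ?\<rho> l) / 2)} \<alpha>)"
  proof (rule sum_mono)
    fix p assume p: "p \<in> window i \<times> window l"
    then have less: "fst p * dyad i < snd p * dyad l" using window_time_less[OF assms] by auto
    show "measure haar (?E p) \<le> ?\<rho> l ^ CARD('d) * indicator {\<alpha>. zmul (int (?h p)) \<alpha> \<in> tcube ((?\<rho> i + ?\<rho> l) / 2)} \<alpha>"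
    proof (cases "zmul (int (?h p)) \<alpha> \<in> tcube ((?\<rho> i + ?\<rho> l) / 2)")
      case True
      have "measure haar (?E p) \<le> measure haar {w. w + zmul (int (snd p * dyad l)) \<alpha> \<in> tcube (?\<rho> l / 2)}"
        by (intro haar.finite_measure_mono) auto
      also have "\<dots> \<le> (2 * (?\<rho> l / 2)) ^ CARD('d)"
        using assms radius_pos[of l "CARD('d)" \<sigma>] by (simp only: measure_haar_translate tcube_borel) (intro measure_haar_tcube_le, simp)
      finally show ?thesis using True by simp
    next
      case False
      have emp: "?E p = {}"
      proof (rule ccontr)
        assume "?E p \<noteq> {}"
        then obtain w where w: "w + zmul (int (fst p * dyad i)) \<alpha> \<in> tcube (?\<rho> i / 2)"
          "w + zmul (int (snd p * dyad l)) \<alpha> \<in> tcube (?\<rho> l / 2)" by blast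
        have "(w + zmul (int (snd p * dyad l)) \<alpha>) - (w + zmul (int (fst p * dyad i)) \<alpha>) \<in> tcube (?\<rho> l / 2 + ?\<rho> i / 2)"
          by (rule tcube_diff[OF w(2,1)])
        moreover have "(w + zmul (int (snd p * dyad l)) \<alpha>) - (w + zmul (int (fst p * dyad i)) \<alpha>) = zmul (int (?h p)) \<alpha>"
          using less by (simp add: of_nat_diff zmul_diff_left flip: of_nat_mult)
        ultimately show False using False by (simp add: add_divide_distrib add.commute)
      qed
      show ?thesis unfolding emp using False by simp
    qed
  qed
  also have "\<dots> = ?\<rho> l ^ CARD('d) * overlap \<sigma> i l \<alpha>"
    by (simp add: overlap_def sum_distrib_left case_prod_beta')
  finally show ?thesis .
qed

text \<open>
  For almost every \<open>\<alpha>\<close>, the events \<open>hit (1 / 2) \<alpha> i\<close> with weight \<open>1\<close> or \<open>0\<close>, according to whether \<open>\<alpha>\<close>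
  has a close return at scale \<open>i\<close>, are asymptotically independent in \<open>w\<close>. Their weighted probabilities
  are \<open>i powr - (1 / 2)\<close> times the indicator of a close return, up to a constant, and have divergent sum by
  \<open>close_returns_AE\<close>.
\<close>

theorem hits_AE:
  "AE \<alpha> in (haar :: 'd::finite torus measure). AE w in haar.
     \<exists>\<^sub>F i in sequentially. \<alpha> \<in> close_return (1/2) i \<and> w \<in> hit (1/2) \<alpha> i"
proof -
  let ?d = "CARD('d)" and ?\<sigma> = "1 / 2 :: real"
  let ?\<rho> = "radius ?d ?\<sigma>"
  have "AE \<alpha> in (haar :: 'd torus measure). \<forall>n::nat. \<exists>N. \<forall>i l. N \<le> i \<longrightarrow> i < l \<longrightarrow>
    overlap ?\<sigma> i l \<alpha> \<le> (1 + 1 / real (Suc n)) * (block_len i * block_len l * (?\<rho> i + ?\<rho> l) ^ ?d)"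
    unfolding AE_all_countable by (intro allI overlap_le_AE) auto
  moreover have "AE \<alpha> in (haar :: 'd torus measure). \<not> summable (\<lambda>i. real i powr (?\<sigma> - 1) * indicator (close_return ?\<sigma> i) \<alpha>)"
    by (rule close_returns_AE) auto
  ultimately show ?thesis
  proof eventually_elim
    case (elim \<alpha>)
    define c where "c i = (indicator (close_return ?\<sigma> i) \<alpha> :: real)" for i
    have corr: "\<exists>N. \<forall>i l. N \<le> i \<longrightarrow> i < l \<longrightarrow> c i > 0 \<longrightarrow> c l > 0 \<longrightarrow>
        measure haar (hit ?\<sigma> \<alpha> i \<inter> hit ?\<sigma> \<alpha> l) \<le> C * measure haar (hit ?\<sigma> \<alpha> i) * measure haar (hit ?\<sigma> \<alpha> l)"
      if C: "C > 1" for C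
    proof -
      have "(\<lambda>n. (1 + inverse (real (Suc n)))\<^sup>2) \<longlonglongrightarrow> (1 + 0)\<^sup>2"
        by (intro tendsto_intros LIMSEQ_inverse_real_of_nat)
      then have "eventually (\<lambda>n. (1 + inverse (real (Suc n)))\<^sup>2 < C) sequentially"
        using C by (intro order_tendstoD(2)[where a = C]) auto
      then obtain n where n: "(1 + 1 / real (Suc n))\<^sup>2 < C"
        by (auto simp: eventually_sequentially inverse_eq_divide)
      define \<delta> where "\<delta> = 1 / real (Suc n)"
      have \<delta>: "\<delta> > 0" "(1 + \<delta>)\<^sup>2 < C" using n by (simp_all add: \<delta>_def)
      obtain N where N: "\<And>i l. N \<le> i \<Longrightarrow> i < l \<Longrightarrow> overlap ?\<sigma> i l \<alpha> \<le> (1 + \<delta>) * (block_len i * block_len l * (?\<rho> i + ?\<rho> l) ^ ?d)"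
        using elim(1) unfolding \<delta>_def by blast
      have "eventually (\<lambda>l :: nat. (1 + (1 / real l) powr (1 / ?d)) ^ ?d < 1 + \<delta>) sequentially"
      proof -
        have "(\<lambda>l :: nat. (1 + (1 / real l) powr (1 / ?d)) ^ ?d) \<longlonglongrightarrow> (1 + 0) ^ ?d"
        proof (intro tendsto_intros)
          have "0 < 1 / real ?d" by simp
          then show "(\<lambda>l :: nat. (1 / real l) powr (1 / ?d)) \<longlonglongrightarrow> 0" by real_asymp
        qed
        then show ?thesis using \<delta> by (intro order_tendstoD(2)[where a = "1 + \<delta>"]) auto
      qed
      then obtain L where L: "\<And>l. l \<ge> L \<Longrightarrow> (1 + (1 / real l) powr (1 / ?d)) ^ ?d < 1 + \<delta>"
        unfolding eventually_sequentially by blast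
      show ?thesis
      proof (intro exI[of _ "N + L + 2 ^ ?d + 1"] allI impI)
        fix i l assume i: "N + L + 2 ^ ?d + 1 \<le> i" and il: "i < l" and c: "c i > 0" "c l > 0"
        have cr: "\<alpha> \<in> close_return ?\<sigma> i" "\<alpha> \<in> close_return ?\<sigma> l" using c by (auto simp: c_def indicator_def split: if_splits)
        have i0: "i > 0" "l > 0" "i \<ge> 1" using i il by auto
        have "?\<rho> i < 1 / 2" by (rule radius_less_half) (use i in auto)
        moreover have "?\<rho> l < 1 / 2" by (rule radius_less_half) (use i il in auto)
        ultimately have half: "?\<rho> i < 1" "?\<rho> l < 1" by simp_all
        have rpos: "?\<rho> i > 0" "?\<rho> l > 0" using i0 by (simp_all add: radius_pos)
        have m: "measure haar (hit ?\<sigma> \<alpha> i) = block_len i * ?\<rho> i ^ ?d" "measure haar (hit ?\<sigma> \<alpha> l) = block_len l * ?\<rho> l ^ ?d"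
          using measure_hit cr i0 half by auto
        \<comment> \<open>The later radius is negligible against the earlier one.\<close>
        have ratio: "(?\<rho> i + ?\<rho> l) ^ ?d \<le> (1 + \<delta>) * ?\<rho> i ^ ?d"
        proof -
          have "?\<rho> l \<le> (1 / real l) powr (1 / ?d) * ?\<rho> i"
          proof -
            have "block_span ?d i * l \<le> block_span ?d l"
            proof -
              have "l \<le> l ^ 12" using i0 by (intro self_le_power) auto
              then have "block_len i * l \<le> block_len i * l ^ 12" by (rule mult_le_mono2)
              then have "block_len i * l \<le> block_len l" using block_len_growth[OF il] by linarith
              then show ?thesis by (simp add: block_span_def mult.assoc)
            qed
            then have "real (block_span ?d i) * real l \<le> real (block_span ?d l)" by (simp only: of_nat_mult[symmetric] of_nat_le_iff)
            moreover have "real i powr ?\<sigma> \<le> real l powr ?\<sigma>" using il by (intro powr_mono2) auto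
            ultimately have "(real (block_span ?d i) * real l) * real i powr ?\<sigma> \<le> real (block_span ?d l) * real l powr ?\<sigma>"
              by (intro mult_mono) auto
            then have "1 / (real (block_span ?d l) * real l powr ?\<sigma>) \<le> 1 / real l * (1 / (real (block_span ?d i) * real i powr ?\<sigma>))"
              using i0 by (simp add: field_simps)
            then have "?\<rho> l \<le> (1 / real l * (1 / (real (block_span ?d i) * real i powr ?\<sigma>))) powr (1 / ?d)"
              unfolding radius_def by (intro powr_mono2) auto
            also have "\<dots> = (1 / real l) powr (1 / ?d) * ?\<rho> i" unfolding radius_def by (rule powr_mult)
            finally show ?thesis .
          qed
          then have "?\<rho> i + ?\<rho> l \<le> (1 + (1 / real l) powr (1 / ?d)) * ?\<rho> i" by (simp add: algebra_simps)
          then have "(?\<rho> i + ?\<rho> l) ^ ?d \<le> ((1 + (1 / real l) powr (1 / ?d)) * ?\<rho> i) ^ ?d" using rpos by (intro power_mono) auto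
          also have "\<dots> \<le> (1 + \<delta>) * ?\<rho> i ^ ?d"
            unfolding power_mult_distrib using L[of l] i il rpos by (intro mult_right_mono) auto
          finally show ?thesis .
        qed
        have "measure haar (hit ?\<sigma> \<alpha> i \<inter> hit ?\<sigma> \<alpha> l) \<le> ?\<rho> l ^ ?d * overlap ?\<sigma> i l \<alpha>"
          by (rule measure_hit_inter_le[OF i0(3) il])
        also have "\<dots> \<le> ?\<rho> l ^ ?d * ((1 + \<delta>) * (block_len i * block_len l * ((1 + \<delta>) * ?\<rho> i ^ ?d)))"
        proof (rule mult_left_mono)
          have "overlap ?\<sigma> i l \<alpha> \<le> (1 + \<delta>) * (block_len i * block_len l * (?\<rho> i + ?\<rho> l) ^ ?d)"
            using N[of i l] i il by simp
          also have "\<dots> \<le> (1 + \<delta>) * (block_len i * block_len l * ((1 + \<delta>) * ?\<rho> i ^ ?d))"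
            using \<delta> ratio by (intro mult_left_mono) auto
          finally show "overlap ?\<sigma> i l \<alpha> \<le> (1 + \<delta>) * (block_len i * block_len l * ((1 + \<delta>) * ?\<rho> i ^ ?d))" .
        qed (use rpos in auto)
        also have "\<dots> = (1 + \<delta>)\<^sup>2 * measure haar (hit ?\<sigma> \<alpha> i) * measure haar (hit ?\<sigma> \<alpha> l)"
          unfolding m by (simp add: power2_eq_square)
        also have "\<dots> \<le> C * measure haar (hit ?\<sigma> \<alpha> i) * measure haar (hit ?\<sigma> \<alpha> l)"
          using \<delta> by (intro mult_right_mono) auto
        finally show "measure haar (hit ?\<sigma> \<alpha> i \<inter> hit ?\<sigma> \<alpha> l) \<le> C * measure haar (hit ?\<sigma> \<alpha> i) * measure haar (hit ?\<sigma> \<alpha> l)" .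
      qed
    qed
    have "AE w in haar. \<not> summable (\<lambda>i. c i * indicator (hit ?\<sigma> \<alpha> i) w)"
    proof (rule haar.kochen_stone_AE)
      show "\<not> summable (\<lambda>i. c i * measure haar (hit ?\<sigma> \<alpha> i))"
      proof
        assume "summable (\<lambda>i. c i * measure haar (hit ?\<sigma> \<alpha> i))"
        then have sm: "summable (\<lambda>i. gap_const ?d * (c i * measure haar (hit ?\<sigma> \<alpha> i)))" by (rule summable_mult)
        have ev: "eventually (\<lambda>i. gap_const ?d * (c i * measure haar (hit ?\<sigma> \<alpha> i))
            = real i powr (?\<sigma> - 1) * indicator (close_return ?\<sigma> i) \<alpha>) sequentially"
          using eventually_gt_at_top[of "2 ^ ?d"]
        proof eventually_elim
          case (elim i)
          then have i: "i > 0" by (cases i) auto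
          show ?case
          proof (cases "\<alpha> \<in> close_return ?\<sigma> i")
            case True
            have "?\<rho> i < 1" using radius_less_half[of ?d i ?\<sigma>] elim by simp
            then have "measure haar (hit ?\<sigma> \<alpha> i) = block_len i * ?\<rho> i ^ ?d" using measure_hit[OF True i] by simp
            also have "\<dots> = 1 / (gap_const ?d * real i powr ?\<sigma>)" using i by (simp add: radius_power block_span_def)
            finally have "gap_const ?d * measure haar (hit ?\<sigma> \<alpha> i) = 1 / real i powr ?\<sigma>" by simp
            then show ?thesis using True i by (simp add: c_def powr_minus_divide)
          qed (simp add: c_def)
        qed
        from iffD1[OF summable_cong[OF ev] sm] elim(2) show False by simp
      qed
    qed (use corr in \<open>auto simp: c_def indicator_def\<close>)
    then show ?case
    proof eventually_elim
      case (elim w)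
      from frequently_mem_if_not_summable[OF elim] show ?case
        by (rule frequently_elim1) (auto simp: c_def indicator_def split: if_splits)
    qed
  qed
qed

section \<open>Single hits along a generic orbit\<close>

lemma prob_space_haar_pair: "prob_space (haar \<Otimes>\<^sub>M (haar :: 'd::finite torus measure))"
  by unfold_locales

text \<open>
  The sum over \<open>k\<close> of the \<open>d\<close>-th powers diverges, but only barely.
\<close>

definition single_radius :: "nat \<Rightarrow> nat \<Rightarrow> real" where
  "single_radius d k = (1 / (real k * (1 + ln (real k)))) powr (1 / real d)"

lemma not_summable_inverse_n_ln:
  "\<not> summable (\<lambda>k :: nat. 1 / (real k * (1 + ln (real k))))"
proof -
  have "summable (\<lambda>k :: nat. 1 / (real k * (1 + ln (real k)))) \<longleftrightarrow>
      summable (\<lambda>n. 2 ^ n * (1 / (real (2 ^ n) * (1 + ln (real (2 ^ n))))))"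
  proof (rule condensation_test)
    fix m :: nat assume m: "0 < m"
    show "1 / (real (Suc m) * (1 + ln (real (Suc m)))) \<le> 1 / (real m * (1 + ln (real m)))"
      using m by (intro divide_left_mono mult_mono mult_pos_pos add_left_mono add_pos_nonneg) auto
  next
    fix n :: nat show "0 \<le> 1 / (real n * (1 + ln (real n)))"
      by (cases "n = 0") (auto intro!: divide_nonneg_nonneg mult_nonneg_nonneg add_nonneg_nonneg ln_ge_zero)
  qed
  also have "(\<lambda>n. 2 ^ n * (1 / (real (2 ^ n) * (1 + ln (real (2 ^ n)))))) = (\<lambda>n. 1 / (1 + real n * ln 2))"
    by (rule ext) (simp add: ln_realpow)
  also have "\<not> summable (\<lambda>n. 1 / (1 + real n * ln 2))"
  proof
    assume sm: "summable (\<lambda>n. 1 / (1 + real n * ln 2))"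
    have "summable (\<lambda>n. 1 / real (Suc n))"
    proof (rule summable_comparison_test'[OF sm])
      fix n :: nat
      have "ln 2 \<le> (1 :: real)" using ln_le_minus_one[of 2] by simp
      then have "real n * ln 2 \<le> real n * 1" by (intro mult_left_mono) auto
      then show "norm (1 / real (Suc n)) \<le> 1 / (1 + real n * ln 2)"
        by (auto intro!: divide_left_mono mult_pos_pos add_pos_nonneg)
    qed
    then have "summable (\<lambda>n. 1 / real n)" by (subst (asm) summable_Suc_iff)
    then show False using not_summable_harmonic[where 'a = real] by (simp add: inverse_eq_divide)
  qed
  finally show ?thesis .
qed

lemma sets_hit_event:
  fixes A :: "'d::finite torus set"
  assumes [measurable]: "A \<in> sets borel"
  shows "{(\<alpha>, w). w + zmul k \<alpha> \<in> A} \<in> sets (haar \<Otimes>\<^sub>M haar)"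
proof -
  have "{p \<in> space (haar \<Otimes>\<^sub>M haar :: ('d torus \<times> 'd torus) measure). snd p + zmul k (fst p) \<in> A} \<in> sets (haar \<Otimes>\<^sub>M haar)"
    by measurable
  then show ?thesis by (simp add: space_pair_measure case_prod_beta')
qed

lemma measure_hit_event:
  fixes A :: "'d::finite torus set"
  assumes "A \<in> sets borel"
  shows "measure (haar \<Otimes>\<^sub>M haar) {(\<alpha>, w). w + zmul k \<alpha> \<in> A} = measure haar A"
  using orbit_pair_independent[of k "k + 1" A UNIV] assms haar.prob_space[where 'd = 'd] by simp

text \<open>
  The events are pairwise independent under the product measure, and their probabilities have divergent
  sum.
\<close>

theorem single_hits_AE:
  "AE \<alpha> in (haar :: 'd::finite torus measure). AE w in haar.
     \<exists>\<^sub>F k in sequentially. w + zmul (int k) \<alpha> \<in> tcube (single_radius CARD('d) k)"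
proof -
  let ?d = "CARD('d)"
  let ?P = "haar \<Otimes>\<^sub>M haar :: ('d torus \<times> 'd torus) measure"
  \<comment> \<open>The factor \<open>1 / 4\<close> keeps the radius below \<open>1 / 2\<close>, where the measure of a cube is known exactly.\<close>
  let ?r = "\<lambda>k. single_radius ?d k / 4"
  define E :: "nat \<Rightarrow> ('d torus \<times> 'd torus) set" where
    "E k = {(\<alpha>, w). w + zmul (int k) \<alpha> \<in> tcube (?r k)}" for k
  have E: "E k \<in> sets ?P" for k unfolding E_def by (rule sets_hit_event) simp
  have mE: "measure ?P (E k) = measure haar (tcube (?r k) :: 'd torus set)" for k
    unfolding E_def by (rule measure_hit_event) simp
  have ind: "measure ?P (E j \<inter> E k) = measure ?P (E j) * measure ?P (E k)" if "j \<noteq> k" for j k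
  proof -
    have "E j \<inter> E k = {(\<alpha>, w). w + zmul (int j) \<alpha> \<in> tcube (?r j) \<and> w + zmul (int k) \<alpha> \<in> tcube (?r k)}"
      by (auto simp: E_def)
    then show ?thesis
      using orbit_pair_independent[of "int j" "int k" "tcube (?r j)" "tcube (?r k)"] that by (simp add: mE)
  qed
  have "AE p in ?P. \<not> summable (\<lambda>k. 1 * indicator (E k) p :: real)"
  proof (rule prob_space.kochen_stone_AE[OF prob_space_haar_pair])
    show "\<not> summable (\<lambda>k. 1 * measure ?P (E k))"
    proof
      assume "summable (\<lambda>k. 1 * measure ?P (E k))"
      then have sm: "summable (\<lambda>k. 2 ^ ?d * measure ?P (E k))" by (intro summable_mult) simp
      have ev: "eventually (\<lambda>k. 2 ^ ?d * measure ?P (E k) = 1 / (real k * (1 + ln (real k)))) sequentially"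
        using eventually_ge_at_top[of 1]
      proof eventually_elim
        case (elim k)
        define x where "x = 1 / (real k * (1 + ln (real k)))"
        have "1 * 1 \<le> real k * (1 + ln (real k))" using elim by (intro mult_mono) auto
        then have x: "0 < x" "x \<le> 1" by (auto simp: x_def)
        have "x powr (1 / ?d) \<le> 1" using x by (intro powr_le1) auto
        then have "measure ?P (E k) = (2 * ?r k) ^ ?d"
          unfolding mE by (intro measure_haar_tcube_eq) (auto simp: single_radius_def x_def)
        also have "\<dots> = (x powr (1 / ?d)) ^ ?d / 2 ^ ?d"
          by (simp add: single_radius_def x_def power_divide)
        also have "(x powr (1 / ?d)) ^ ?d = x" using x by (simp add: powr_realpow[symmetric] powr_powr)
        finally show ?case by (simp add: x_def)
      qed
      from iffD1[OF summable_cong[OF ev] sm] not_summable_inverse_n_ln show False by simp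
    qed
    fix C :: real assume "C > 1"
    then have "measure ?P (E j) * measure ?P (E k) \<le> C * measure ?P (E j) * measure ?P (E k)" for j k
      by (intro mult_right_mono) (auto simp: mult_le_cancel_right1)
    then show "\<exists>N. \<forall>j k. N \<le> j \<longrightarrow> j < k \<longrightarrow> (0 :: real) < 1 \<longrightarrow> (0 :: real) < 1 \<longrightarrow>
        measure ?P (E j \<inter> E k) \<le> C * measure ?P (E j) * measure ?P (E k)"
      using ind by auto
  qed (use E in simp_all)
  then have "AE \<alpha> in haar. AE w in haar. \<not> summable (\<lambda>k. 1 * indicator (E k) (\<alpha>, w) :: real)"
    by (rule haar2.AE_pair)
  then show ?thesis
  proof eventually_elim
    case (elim \<alpha>)
    then show ?case
    proof eventually_elim
      case (elim w)
      have "tcube (?r k) \<subseteq> (tcube (single_radius ?d k) :: 'd torus set)" for k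
        by (intro tcube_mono) (simp add: single_radius_def)
      then show ?case
        using frequently_mem_if_not_summable[OF elim] by (auto simp: E_def elim!: frequently_elim1)
    qed
  qed
qed

section \<open>Few hits in dyadic time blocks\<close>

definition dyadic_radius :: "nat \<Rightarrow> real \<Rightarrow> nat \<Rightarrow> real" where
  "dyadic_radius d p m = (1 / (2 ^ m * real m powr p)) powr (1 / real d)"

definition few_hits :: "nat \<Rightarrow> real \<Rightarrow> (nat \<Rightarrow> 'd::finite torus) \<Rightarrow> bool" where
  "few_hits r p y \<longleftrightarrow> eventually (\<lambda>m. card {k \<in> {1..<2 ^ Suc m}. y k \<in> tcube (dyadic_radius CARD('d) p m)} < r) sequentially"

lemma dyadic_radius_nonneg [simp]: "0 \<le> dyadic_radius d p m"
  by (simp add: dyadic_radius_def)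

lemma dyadic_radius_power:
  assumes "d > 0" "m > 0"
  shows "dyadic_radius d p m ^ d = 1 / (2 ^ m * real m powr p)"
proof -
  have "dyadic_radius d p m > 0" using assms by (simp add: dyadic_radius_def)
  then have "dyadic_radius d p m ^ d = dyadic_radius d p m powr real d" by (simp add: powr_realpow)
  then show ?thesis using assms by (simp add: dyadic_radius_def powr_powr)
qed

lemma few_hits_1I:
  fixes y :: "nat \<Rightarrow> 'd::finite torus"
  assumes "eventually (\<lambda>m. \<forall>k\<in>{1..<2 ^ Suc m}. y k \<notin> tcube (dyadic_radius CARD('d) p m)) sequentially"
  shows "few_hits 1 p y"
  unfolding few_hits_def using assms by eventually_elim (simp add: card_eq_0_iff)

lemma few_hits_1_AE:
  fixes f :: "nat \<Rightarrow> 'd::finite torus \<Rightarrow> 'd torus"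
  assumes p: "p > 1"
    and f: "\<And>k A. A \<in> sets borel \<Longrightarrow> {x. f k x \<in> A} \<in> sets borel"
    and pres: "\<And>k A. k > 0 \<Longrightarrow> A \<in> sets borel \<Longrightarrow> measure haar {x. f k x \<in> A} = measure haar A"
  shows "AE x in haar. few_hits 1 p (\<lambda>k. f k x)"
proof -
  let ?d = "CARD('d)" and ?I = "\<lambda>m. {1..<2 ^ Suc m :: nat}"
  define X where "X m k = {x. f k x \<in> tcube (dyadic_radius ?d p m)}" for m k
  have X: "X m k \<in> sets haar" for m k unfolding X_def using f[of "tcube _"] by simp
  have "AE x in haar. eventually (\<lambda>m. x \<notin> (\<Union>k\<in>?I m. X m k)) sequentially"
  proof (rule haar.borel_cantelli_power_AE[OF _ p])
    fix m :: nat assume m: "m > 0"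
    let ?v = "(2 * dyadic_radius ?d p m) ^ ?d"
    have "measure haar (\<Union>k\<in>?I m. X m k) \<le> (\<Sum>k\<in>?I m. measure haar (X m k))"
      by (intro measure_UNION_le X) simp
    also have "\<dots> \<le> (\<Sum>k\<in>?I m. ?v)"
      unfolding X_def using measure_haar_tcube_le[OF dyadic_radius_nonneg, where 'd = 'd]
      by (intro sum_mono) (subst pres, auto)
    also have "\<dots> \<le> 2 ^ Suc m * ?v" by (simp add: mult_right_mono of_nat_diff)
    also have "\<dots> = 2 ^ Suc ?d * real m powr - p"
      using m by (simp add: power_mult_distrib dyadic_radius_power powr_minus field_simps)
    finally show "measure haar (\<Union>k\<in>?I m. X m k) \<le> 2 ^ Suc ?d * real m powr - p" .
  qed (intro sets.finite_UN X; simp)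
  then show ?thesis
  proof eventually_elim
    case (elim x)
    then show ?case by (intro few_hits_1I) (auto elim: eventually_mono simp: X_def)
  qed
qed

lemma few_hits_return_AE:
  "p > 1 \<Longrightarrow> AE \<alpha> in (haar :: 'd::finite torus measure). few_hits 1 p (\<lambda>k. zmul (int k) \<alpha>)"
  by (rule few_hits_1_AE) (simp_all add: measure_haar_zmul)

lemma few_hits_orbit_AE:
  "p > 1 \<Longrightarrow> AE w in haar. few_hits 1 p (\<lambda>k. w + zmul (int k) (\<alpha> :: 'd::finite torus))"
  by (rule few_hits_1_AE) (simp_all add: measure_haar_translate)

text \<open>
  First Borel--Cantelli for pairs of times: there are about \<open>4 ^ m\<close> pairs in the block, and by pairwise
  independence each has probability of order \<open>(2 ^ (- m) * m powr - p)\<^sup>2\<close>.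
\<close>

lemma few_double_hits_AE:
  assumes "p > 1 / 2"
  shows "AE \<alpha> in (haar :: 'd::finite torus measure). AE w in haar. few_hits 2 p (\<lambda>k. w + zmul (int k) \<alpha>)"
proof -
  let ?d = "CARD('d)"
  let ?P = "haar \<Otimes>\<^sub>M haar :: ('d torus \<times> 'd torus) measure"
  let ?\<rho> = "dyadic_radius ?d p"
  define I where "I m = {(j, k). j \<in> {1..<2 ^ Suc m :: nat} \<and> k \<in> {1..<2 ^ Suc m} \<and> j \<noteq> k}" for m :: nat
  have I: "finite (I m)" "card (I m) \<le> (2 ^ Suc m) * (2 ^ Suc m)" for m
  proof -
    have sub: "I m \<subseteq> {1..<2 ^ Suc m} \<times> {1..<2 ^ Suc m}" by (auto simp: I_def)
    show "finite (I m)" by (rule finite_subset[OF sub]) simp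
    have "card (I m) \<le> card ({1..<2 ^ Suc m :: nat} \<times> {1..<2 ^ Suc m :: nat})" by (rule card_mono[OF _ sub]) simp
    also have "\<dots> \<le> (2 ^ Suc m) * (2 ^ Suc m)" unfolding card_cartesian_product by (intro mult_mono) auto
    finally show "card (I m) \<le> (2 ^ Suc m) * (2 ^ Suc m)" .
  qed
  define X :: "nat \<Rightarrow> nat \<times> nat \<Rightarrow> ('d torus \<times> 'd torus) set" where
    "X m a = {(\<alpha>, w). w + zmul (int (fst a)) \<alpha> \<in> tcube (?\<rho> m) \<and> w + zmul (int (snd a)) \<alpha> \<in> tcube (?\<rho> m)}" for m a
  have X: "X m a \<in> sets ?P" for m a
  proof -
    have "X m a = {(\<alpha>, w). w + zmul (int (fst a)) \<alpha> \<in> tcube (?\<rho> m)} \<inter> {(\<alpha>, w). w + zmul (int (snd a)) \<alpha> \<in> tcube (?\<rho> m)}"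
      by (auto simp: X_def)
    also have "\<dots> \<in> sets ?P" by (intro sets.Int sets_hit_event tcube_borel)
    finally show ?thesis .
  qed
  have "AE q in ?P. eventually (\<lambda>m. q \<notin> (\<Union>a\<in>I m. X m a)) sequentially"
  proof (rule prob_space.borel_cantelli_power_AE[OF prob_space_haar_pair])
    show "2 * p > 1" using assms by simp
    fix m :: nat assume m: "m > 0"
    let ?v = "(2 * ?\<rho> m) ^ ?d"
    have r0: "0 \<le> ?\<rho> m" by (simp add: dyadic_radius_def)
    have "measure ?P (\<Union>a\<in>I m. X m a) \<le> (\<Sum>a\<in>I m. measure ?P (X m a))"
      by (intro measure_UNION_le X I)
    also have "\<dots> \<le> (\<Sum>a\<in>I m. ?v * ?v)"
    proof (rule sum_mono)
      fix a assume "a \<in> I m"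
      then have "measure ?P (X m a) = measure haar (tcube (?\<rho> m) :: 'd torus set) * measure haar (tcube (?\<rho> m) :: 'd torus set)"
        unfolding X_def by (intro orbit_pair_independent) (auto simp: I_def)
      also have "\<dots> \<le> ?v * ?v" using r0 by (intro mult_mono measure_haar_tcube_le) auto
      finally show "measure ?P (X m a) \<le> ?v * ?v" .
    qed
    also have "\<dots> = real (card (I m)) * (?v * ?v)" by simp
    also have "\<dots> \<le> real ((2 ^ Suc m) * (2 ^ Suc m)) * (?v * ?v)"
      using I(2)[of m] by (intro mult_right_mono) (simp_all only: of_nat_le_iff, auto)
    also have "\<dots> = (2 ^ Suc m * ?v) * (2 ^ Suc m * ?v)" by simp
    also have "2 ^ Suc m * ?v = 2 * 2 ^ ?d * real m powr - p"
      using m by (simp add: power_mult_distrib dyadic_radius_power powr_minus field_simps)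
    also have "2 * 2 ^ ?d * real m powr - p * (2 * 2 ^ ?d * real m powr - p) = 4 * 4 ^ ?d * real m powr (- 2 * p)"
    proof -
      have "real m powr - p * real m powr - p = real m powr (- 2 * p)" by (simp add: powr_add[symmetric])
      moreover have "2 ^ ?d * 2 ^ ?d = (4 :: real) ^ ?d" by (simp add: power_mult_distrib[symmetric])
      ultimately show ?thesis by (simp add: algebra_simps)
    qed
    finally show "measure ?P (\<Union>a\<in>I m. X m a) \<le> 4 * 4 ^ ?d * real m powr - (2 * p)" by simp
  qed (intro sets.finite_UN X I)
  then have "AE \<alpha> in haar. AE w in haar. eventually (\<lambda>m. (\<alpha>, w) \<notin> (\<Union>a\<in>I m. X m a)) sequentially"
    by (rule haar2.AE_pair)
  then show ?thesis
  proof eventually_elim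
    case (elim \<alpha>)
    then show ?case
    proof eventually_elim
      case (elim w)
      then show ?case
        unfolding few_hits_def
      proof eventually_elim
        case (elim m)
        let ?S = "{k \<in> {1..<2 ^ Suc m}. w + zmul (int k) \<alpha> \<in> tcube (?\<rho> m)}"
        have "j = k" if "j \<in> ?S" "k \<in> ?S" for j k
          using elim that by (auto simp: X_def I_def)
        then have "card ?S \<le> Suc 0" by (subst card_le_Suc0_iff_eq) auto
        then show ?case by simp
      qed
    qed
  qed
qed

section \<open>Orbits avoid points\<close>

lemma measure_haar_singleton: "measure haar {c} = 0" for c :: "'d::finite torus"
proof -
  have m: "{c} \<in> sets haar" by simp
  have "measure haar {c} \<le> (2 * (1 / real (Suc n))) ^ CARD('d)" for n
  proof -
    have "0 \<in> (tcube (1 / real (Suc n)) :: 'd torus set)"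
      unfolding mem_tcube by (intro exI[of _ 0]) (simp add: zero_torus.abs_eq)
    then have "{c} \<subseteq> {x. x - c \<in> tcube (1 / real (Suc n))}" by simp
    then have "measure haar {c} \<le> measure haar {x. x - c \<in> tcube (1 / real (Suc n))}"
      by (intro haar.finite_measure_mono) auto
    then show ?thesis
      using measure_haar_tcube_le[of "1 / real (Suc n)", where 'd = 'd] by (simp only: measure_tcube_ball) simp
  qed
  moreover have "(\<lambda>n. (2 * inverse (real (Suc n))) ^ CARD('d)) \<longlonglongrightarrow> (2 * 0) ^ CARD('d)"
    by (intro tendsto_intros LIMSEQ_inverse_real_of_nat)
  ultimately have "measure haar {c} \<le> (2 * 0) ^ CARD('d)"
    by (intro LIMSEQ_le_const[of _ "(2 * 0) ^ CARD('d)"]) (auto simp: inverse_eq_divide)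
  then show ?thesis by (simp add: zero_power measure_le_0_iff)
qed

lemma AE_haar_neq: "AE x in haar. x \<noteq> (c :: 'd::finite torus)"
proof -
  have "{c} \<in> null_sets haar"
    by (rule null_setsI) (simp_all add: haar.emeasure_eq_measure measure_haar_singleton)
  from AE_not_in[OF this] show ?thesis by simp
qed

lemma AE_aperiodic: "AE \<alpha> in (haar :: 'd::finite torus measure). \<forall>k>0. zmul (int k) \<alpha> \<noteq> 0"
proof -
  have "AE \<alpha> in (haar :: 'd torus measure). zmul (int (Suc k)) \<alpha> \<noteq> 0" for k
  proof -
    have "emeasure haar {\<alpha> :: 'd torus. zmul (int (Suc k)) \<alpha> \<in> {0}} = 0"
      by (simp only: haar.emeasure_eq_measure, subst measure_haar_zmul) (simp_all add: measure_haar_singleton del: of_nat_Suc)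
    then have "{\<alpha> :: 'd torus. zmul (int (Suc k)) \<alpha> \<in> {0}} \<in> null_sets haar"
      by (intro null_setsI) auto
    from AE_not_in[OF this] show ?thesis by simp
  qed
  then have "AE \<alpha> in (haar :: 'd torus measure). \<forall>k. zmul (int (Suc k)) \<alpha> \<noteq> 0" unfolding AE_all_countable by blast
  then show ?thesis by eventually_elim (metis Suc_pred)
qed

lemma AE_orbit_nonzero: "AE w in haar. \<forall>k. w + zmul (int k) \<alpha> \<noteq> (0 :: 'd::finite torus)"
  unfolding AE_all_countable
proof
  fix k
  show "AE w in haar. w + zmul (int k) \<alpha> \<noteq> 0"
    using AE_haar_neq[of "- zmul (int k) \<alpha>"] by eventually_elim (simp add: add_eq_0_iff2)
qed

lemma AE_haar_translate:
  fixes x :: "'d::finite torus"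
  assumes "AE w in haar. P w"
  shows "AE y in haar. P (y - x)"
proof -
  have m: "(\<lambda>y. y - x) \<in> measurable haar haar"
  proof -
    have "(\<lambda>y. y + (- x)) \<in> measurable haar haar" by measurable
    then show ?thesis by simp
  qed
  have "distr haar haar (\<lambda>y. y - x) = haar"
  proof (rule measure_eqI)
    fix A assume "A \<in> sets (distr haar haar (\<lambda>y. y - x))"
    then have A: "A \<in> sets borel" by simp
    have "emeasure (distr haar haar (\<lambda>y. y - x)) A = emeasure haar ((\<lambda>y. y - x) -` A)"
      using A m by (subst emeasure_distr) auto
    also have "\<dots> = emeasure haar A" using emeasure_haar_translate[OF A, of "- x"] by simp
    finally show "emeasure (distr haar haar (\<lambda>y. y - x)) A = emeasure haar A" .
  qed simp
  then have "AE w in distr haar haar (\<lambda>y. y - x). P w" using assms by (simp only:)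
  from AE_distrD[OF m this] show ?thesis .
qed

section \<open>Order statistics of distances\<close>

lemma sort_nth_le_iff:
  fixes xs :: "real list"
  assumes "1 \<le> r" "r \<le> length xs"
  shows "sort xs ! (r - 1) \<le> t \<longleftrightarrow> r \<le> length (filter (\<lambda>v. v \<le> t) xs)"
proof -
  let ?ys = "sort xs"
  let ?I = "{i. i < length ?ys \<and> ?ys ! i \<le> t}"
  have "length (filter (\<lambda>v. v \<le> t) xs) = length (filter (\<lambda>v. v \<le> t) ?ys)"
    by (metis filter_sort length_sort)
  then have len: "length (filter (\<lambda>v. v \<le> t) xs) = card ?I"
    by (simp add: length_filter_conv_card)
  show ?thesis
  proof
    assume le: "?ys ! (r - 1) \<le> t"
    have "{..<r} \<subseteq> ?I"
    proof
      fix i assume "i \<in> {..<r}"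
      then have "?ys ! i \<le> ?ys ! (r - 1)" using assms by (intro sorted_nth_mono) auto
      then show "i \<in> ?I" using le assms \<open>i \<in> {..<r}\<close> by auto
    qed
    then have "card {..<r} \<le> card ?I" by (intro card_mono) auto
    then show "r \<le> length (filter (\<lambda>v. v \<le> t) xs)" using len by simp
  next
    assume r: "r \<le> length (filter (\<lambda>v. v \<le> t) xs)"
    show "?ys ! (r - 1) \<le> t"
    proof (rule ccontr)
      assume gt: "\<not> ?ys ! (r - 1) \<le> t"
      have "?I \<subseteq> {..<r - 1}"
      proof
        fix i assume i: "i \<in> ?I"
        show "i \<in> {..<r - 1}"
        proof (rule ccontr)
          assume "i \<notin> {..<r - 1}"
          then have "?ys ! (r - 1) \<le> ?ys ! i" using i by (intro sorted_nth_mono) auto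
          then show False using gt i by auto
        qed
      qed
      then have "card ?I \<le> card {..<r - 1}" by (intro card_mono) auto
      then show False using r len assms by simp
    qed
  qed
qed

lemma orbit_dist_le_iff:
  assumes "1 \<le> r" "r \<le> n"
  shows "orbit_dist \<alpha> r n x y \<le> t \<longleftrightarrow> r \<le> card {k \<in> {1..n}. dist x (y + zmul (int k) \<alpha>) \<le> t}"
proof -
  let ?f = "\<lambda>k. dist x (y + zmul (int k) \<alpha>)"
  have "length (filter (\<lambda>v. v \<le> t) (map ?f [1..<Suc n])) = card ({k. ?f k \<le> t} \<inter> set [1..<Suc n])"
    unfolding filter_map length_map comp_def by (rule distinct_length_filter) simp
  also have "{k. ?f k \<le> t} \<inter> set [1..<Suc n] = {k \<in> {1..n}. ?f k \<le> t}" by auto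
  finally show ?thesis
    unfolding orbit_dist_def translation_funpow using assms by (subst sort_nth_le_iff) simp_all
qed

lemma orbit_dist_attained:
  assumes "1 \<le> r" "r \<le> n"
  shows "\<exists>k\<in>{1..n}. orbit_dist \<alpha> r n x y = dist x (y + zmul (int k) \<alpha>)"
proof -
  let ?xs = "map (\<lambda>k. dist x (y + zmul (int k) \<alpha>)) [1..<Suc n]"
  have "sort ?xs ! (r - 1) \<in> set (sort ?xs)" using assms by (intro nth_mem) simp
  then have "orbit_dist \<alpha> r n x y \<in> set ?xs" unfolding orbit_dist_def translation_funpow by simp
  then show ?thesis by auto
qed

lemma orbit_dist_le_CARD:
  fixes x :: "'d::finite torus"
  assumes "1 \<le> r" "r \<le> n"
  shows "orbit_dist \<alpha> r n x y \<le> real CARD('d)"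
proof -
  have "dist x z \<le> real CARD('d)" for z :: "'d torus"
    using dist_le_of_tcube[OF torus_tcube_UNIV[of "z - x"]] by simp
  then show ?thesis using orbit_dist_attained[OF assms, of \<alpha> x y] by auto
qed

lemma orbit_dist_pos:
  fixes x :: "'d::finite torus"
  assumes "1 \<le> r" "r \<le> n" and "\<And>k. k > 0 \<Longrightarrow> (y - x) + zmul (int k) \<alpha> \<noteq> 0"
  shows "orbit_dist \<alpha> r n x y > 0"
proof -
  obtain k where k: "k \<in> {1..n}" "orbit_dist \<alpha> r n x y = dist x (y + zmul (int k) \<alpha>)"
    using orbit_dist_attained[OF assms(1,2)] by blast
  have "(y - x) + zmul (int k) \<alpha> \<noteq> 0" using k by (intro assms(3)) simp
  then have "x \<noteq> y + zmul (int k) \<alpha>" by (auto simp: algebra_simps)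
  then show ?thesis using k by simp
qed

lemma orbit_dist_le_of_hits:
  fixes x :: "'d::finite torus"
  assumes "1 \<le> r" "T \<subseteq> {1..n}" "card T \<ge> r"
    and "\<And>k. k \<in> T \<Longrightarrow> (y - x) + zmul (int k) \<alpha> \<in> tcube \<rho>"
  shows "orbit_dist \<alpha> r n x y \<le> real CARD('d) * \<rho>"
proof -
  have "card T \<le> card {1..n}" using assms(2) by (intro card_mono) auto
  then have n: "r \<le> n" using assms(3) by simp
  have "T \<subseteq> {k \<in> {1..n}. dist x (y + zmul (int k) \<alpha>) \<le> real CARD('d) * \<rho>}"
  proof
    fix k assume k: "k \<in> T"
    have "(y + zmul (int k) \<alpha>) - x \<in> tcube \<rho>" using assms(4)[OF k] by (simp add: algebra_simps)
    then show "k \<in> {k \<in> {1..n}. dist x (y + zmul (int k) \<alpha>) \<le> real CARD('d) * \<rho>}"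
      using dist_le_of_tcube k assms(2) by auto
  qed
  then have "card T \<le> card {k \<in> {1..n}. dist x (y + zmul (int k) \<alpha>) \<le> real CARD('d) * \<rho>}"
    by (intro card_mono) auto
  then show ?thesis using assms(3) by (subst orbit_dist_le_iff[OF assms(1) n]) simp
qed

lemma orbit_dist_ge_of_few_hits:
  fixes x :: "'d::finite torus"
  assumes "1 \<le> r" "r \<le> n" "n < N"
    and "card {k \<in> {1..<N}. (y - x) + zmul (int k) \<alpha> \<in> tcube \<rho>} < r"
  shows "\<rho> \<le> orbit_dist \<alpha> r n x y"
proof (rule ccontr)
  assume less: "\<not> \<rho> \<le> orbit_dist \<alpha> r n x y"
  define t where "t = orbit_dist \<alpha> r n x y"
  have "r \<le> card {k \<in> {1..n}. dist x (y + zmul (int k) \<alpha>) \<le> t}"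
    using orbit_dist_le_iff[OF assms(1,2)] unfolding t_def by blast
  also have "\<dots> \<le> card {k \<in> {1..<N}. (y - x) + zmul (int k) \<alpha> \<in> tcube \<rho>}"
  proof (rule card_mono)
    show "{k \<in> {1..n}. dist x (y + zmul (int k) \<alpha>) \<le> t} \<subseteq> {k \<in> {1..<N}. (y - x) + zmul (int k) \<alpha> \<in> tcube \<rho>}"
    proof safe
      fix k assume k: "k \<in> {1..n}" "dist x (y + zmul (int k) \<alpha>) \<le> t"
      then have "dist x (y + zmul (int k) \<alpha>) < \<rho>" using less by (simp add: t_def)
      then have "(y + zmul (int k) \<alpha>) - x \<in> tcube \<rho>" by (rule tcube_of_dist_less)
      then show "(y - x) + zmul (int k) \<alpha> \<in> tcube \<rho>" by (simp add: algebra_simps)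
    qed (use assms(3) in auto)
  qed simp
  finally show False using assms(4) by simp
qed

section \<open>From hits to limits superior\<close>

definition log_ratio :: "nat \<Rightarrow> (nat \<Rightarrow> real) \<Rightarrow> nat \<Rightarrow> real" where
  "log_ratio d D n = (\<bar>ln (D n)\<bar> - 1 / real d * ln (real n)) / ln (ln (real n))"

lemma limsup_ge_of_frequently:
  fixes g :: "nat \<Rightarrow> real" and h :: "nat \<Rightarrow> real"
  assumes freq: "\<exists>\<^sub>F i in sequentially. g (\<nu> i) \<ge> h i"
    and \<nu>: "filterlim \<nu> sequentially sequentially" and h: "h \<longlonglongrightarrow> L"
  shows "ereal L \<le> limsup (\<lambda>n. ereal (g n))"
proof (rule ccontr)
  assume "\<not> ereal L \<le> limsup (\<lambda>n. ereal (g n))"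
  then obtain z where z: "limsup (\<lambda>n. ereal (g n)) < ereal z" "ereal z < ereal L"
    using ereal_dense2 by (metis not_le)
  have "eventually (\<lambda>n. ereal (g n) < ereal z) sequentially" by (rule Limsup_lessD[OF z(1)])
  then have "eventually (\<lambda>i. ereal (g (\<nu> i)) < ereal z) sequentially"
    using \<nu> by (rule eventually_compose_filterlim)
  moreover have "eventually (\<lambda>i. z < h i) sequentially" using h z(2) by (intro order_tendstoD(1)) auto
  ultimately have "eventually (\<lambda>i. \<not> g (\<nu> i) \<ge> h i) sequentially" by eventually_elim simp
  then show False using freq by (simp add: frequently_def)
qed

text \<open>
  For \<open>n\<close> in the \<open>m\<close>-th dyadic block, \<open>- ln (D n)\<close> is at most \<open>(m * ln 2 + p * ln m) / d\<close>, where \<open>m * ln 2\<close> is at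
  most \<open>ln n\<close> and therefore \<open>ln m\<close> is at most \<open>ln (ln n)\<close> up to a constant. The upper bound \<open>B\<close> controls the
  absolute value when \<open>D n > 1\<close>.
\<close>

lemma limsup_log_ratio_le:
  fixes D :: "nat \<Rightarrow> real"
  assumes d: "d > 0" and p: "p \<ge> 0"
    and D: "eventually (\<lambda>n. 0 < D n \<and> D n \<le> B) sequentially"
    and low: "eventually (\<lambda>m. \<forall>n\<in>{2 ^ m..<2 ^ Suc m}. r \<le> n \<longrightarrow> dyadic_radius d p m \<le> D n) sequentially"
  shows "limsup (\<lambda>n. ereal (log_ratio d D n)) \<le> ereal (p / d)"
proof -
  define b where "b n = p / d * (ln (ln (real n)) - ln (ln 2)) / ln (ln (real n))" for n :: nat
  have b: "b \<longlonglongrightarrow> p / d * 1"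
  proof -
    have "(\<lambda>n :: nat. (ln (ln (real n)) - ln (ln 2)) / ln (ln (real n))) \<longlonglongrightarrow> 1" by real_asymp
    then have "(\<lambda>n :: nat. p / d * ((ln (ln (real n)) - ln (ln 2)) / ln (ln (real n)))) \<longlonglongrightarrow> p / d * 1"
      by (intro tendsto_intros)
    then show ?thesis by (simp add: b_def[abs_def])
  qed
  obtain m0 where m0: "\<And>m n. m \<ge> m0 \<Longrightarrow> n \<in> {2 ^ m..<2 ^ Suc m} \<Longrightarrow> r \<le> n \<Longrightarrow> dyadic_radius d p m \<le> D n"
    using low unfolding eventually_sequentially by blast
  have big: "eventually (\<lambda>n :: nat. ln (max B 1) \<le> 1 / real d * ln (real n)) sequentially"
  proof -
    have "filterlim (\<lambda>n :: nat. 1 / real d * ln (real n)) at_top sequentially" using d by real_asymp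
    then show ?thesis by (simp add: filterlim_at_top)
  qed
  have lnln: "eventually (\<lambda>n :: nat. ln (ln (real n)) > 0) sequentially" by real_asymp
  have lnln2: "eventually (\<lambda>n :: nat. ln (ln (real n)) - ln (ln 2) \<ge> 0) sequentially" by real_asymp
  have "eventually (\<lambda>n. ereal (log_ratio d D n) \<le> ereal (b n)) sequentially"
    using D big lnln lnln2 eventually_ge_at_top[of "max r (2 ^ Suc m0)"]
  proof eventually_elim
    case (elim n)
    define m where "m = floor_log n"
    have "n > 0" using elim(5) by (cases n) auto
    have mn: "2 ^ m \<le> n" "n < 2 ^ Suc m"
      using floor_log_exp2_le[OF \<open>n > 0\<close>] floor_log_exp2_gt[of n] by (simp_all add: m_def)
    have "m \<ge> Suc m0"
    proof (rule ccontr)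
      assume "\<not> m \<ge> Suc m0"
      then have "2 ^ Suc m \<le> (2 :: nat) ^ Suc m0" by (intro power_increasing) auto
      moreover have "2 ^ Suc m0 \<le> n" using elim(5) by simp
      ultimately show False using mn(2) by linarith
    qed
    then have m: "m \<ge> m0" "m > 0" by auto
    have "dyadic_radius d p m \<le> D n" using m0[OF m(1), of n] mn elim(5) by auto
    moreover have rp: "dyadic_radius d p m > 0" using m by (simp add: dyadic_radius_def)
    ultimately have "ln (dyadic_radius d p m) \<le> ln (D n)" by simp
    moreover have "ln (dyadic_radius d p m) = - (1 / d) * (real m * ln 2 + p * ln (real m))"
      using m by (simp add: dyadic_radius_def ln_powr ln_div ln_mult ln_realpow add_divide_distrib diff_divide_distrib)
    ultimately have 1: "- ln (D n) \<le> (1 / d) * (real m * ln 2 + p * ln (real m))" by simp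
    have "real m * ln 2 = ln (real (2 ^ m))" by (simp add: ln_realpow)
    also have "\<dots> \<le> ln (real n)" using mn(1) \<open>n > 0\<close> by (subst ln_le_cancel_iff) (simp_all only: of_nat_le_iff, auto)
    finally have 2: "real m * ln 2 \<le> ln (real n)" .
    then have "ln (real m * ln 2) \<le> ln (ln (real n))" using m by (subst ln_le_cancel_iff) (auto intro: less_le_trans[of _ "real m * ln 2"])
    then have 3: "ln (real m) \<le> ln (ln (real n)) - ln (ln 2)" using m by (simp add: ln_mult)
    have "\<bar>ln (D n)\<bar> - 1 / d * ln (real n) \<le> p / d * (ln (ln (real n)) - ln (ln 2))"
    proof (cases "ln (D n) \<ge> 0")
      case True
      have "ln (D n) \<le> ln (max B 1)" using elim(1) by (intro ln_mono) auto
      then have "\<bar>ln (D n)\<bar> - 1 / d * ln (real n) \<le> 0" using True elim(2) by simp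
      also have "0 \<le> p / d * (ln (ln (real n)) - ln (ln 2))" using p elim(4) by simp
      finally show ?thesis .
    next
      case False
      have "(1 / d) * (real m * ln 2 + p * ln (real m)) \<le> (1 / d) * (ln (real n) + p * (ln (ln (real n)) - ln (ln 2)))"
        using 2 3 p d by (intro mult_left_mono add_mono) auto
      then show ?thesis using 1 False by (simp add: algebra_simps)
    qed
    then have "log_ratio d D n \<le> b n"
      unfolding log_ratio_def b_def using elim(3) by (intro divide_right_mono) auto
    then show ?case by simp
  qed
  then have "limsup (\<lambda>n. ereal (log_ratio d D n)) \<le> limsup (\<lambda>n. ereal (b n))" by (rule Limsup_mono)
  also have "\<dots> = ereal (p / d)" using b by (intro lim_imp_Limsup) auto
  finally show ?thesis .
qed

lemma limsup_log_ratio_ge_single: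
  fixes D :: "nat \<Rightarrow> real"
  assumes d: "d > 0" and c: "c > 0"
    and D: "\<exists>\<^sub>F k in sequentially. 0 < D k \<and> D k \<le> c * single_radius d k"
  shows "ereal (1 / d) \<le> limsup (\<lambda>n. ereal (log_ratio d D n))"
proof (rule limsup_ge_of_frequently[where \<nu> = "\<lambda>k. k"])
  define h where "h k = (1 / d * ln (1 + ln (real k)) - ln c) / ln (ln (real k))" for k :: nat
  show "h \<longlonglongrightarrow> 1 / d" unfolding h_def using d by real_asymp
  have ev: "eventually (\<lambda>k :: nat. ln (ln (real k)) > 0 \<and> k \<ge> 1) sequentially"
    by (intro eventually_conj eventually_ge_at_top) real_asymp
  show "\<exists>\<^sub>F k in sequentially. h k \<le> log_ratio d D k"
    using frequently_eventually_frequently[OF D ev]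
  proof (rule frequently_elim1)
    fix k assume k: "(0 < D k \<and> D k \<le> c * single_radius d k) \<and> ln (ln (real k)) > 0 \<and> k \<ge> 1"
    have "ln (D k) \<le> ln (c * single_radius d k)" using k by (intro ln_mono) auto
    also have "single_radius d k > 0" using k by (auto simp: single_radius_def add_pos_nonneg)
    then have "ln (c * single_radius d k) = ln c + ln (single_radius d k)" using c by (simp add: ln_mult)
    also have "ln (single_radius d k) = - (1 / d) * (ln (real k) + ln (1 + ln (real k)))"
    proof -
      have "1 + ln (real k) > 0" using k by (intro add_pos_nonneg) auto
      then show ?thesis using k by (simp add: single_radius_def ln_powr ln_div ln_mult add_divide_distrib diff_divide_distrib)
    qed
    finally have "ln (D k) \<le> ln c - (1 / d) * (ln (real k) + ln (1 + ln (real k)))" by simp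
    then have "1 / d * ln (1 + ln (real k)) - ln c \<le> \<bar>ln (D k)\<bar> - 1 / d * ln (real k)"
      by (simp add: algebra_simps)
    then show "h k \<le> log_ratio d D k" unfolding h_def log_ratio_def using k by (intro divide_right_mono) auto
  qed
qed (simp add: filterlim_ident)

text \<open>
  At \<open>n = c * block_span d i * dyad i\<close> the numerator of the ratio is at least
  \<open>(\<sigma> / d) * ln i - o(ln i)\<close>: the contribution of \<open>block_span\<close> cancels and \<open>ln (dyad i)\<close> is at most
  \<open>ln 2 * sqrt (ln i)\<close>. The denominator is at most \<open>ln i + o(ln i)\<close>, since \<open>ln n\<close> is of order \<open>i * ln i\<close>.
\<close>

lemma limsup_log_ratio_ge_block:
  fixes D :: "nat \<Rightarrow> real"
  assumes d: "d > 0" and c: "c > 0" and \<sigma>: "\<sigma> > 0"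
    and D: "\<exists>\<^sub>F i in sequentially. 0 < D (c * block_span d i * dyad i) \<and>
       D (c * block_span d i * dyad i) \<le> c * radius d \<sigma> i"
  shows "ereal (\<sigma> / d) \<le> limsup (\<lambda>n. ereal (log_ratio d D n))"
proof (rule limsup_ge_of_frequently)
  let ?\<nu> = "\<lambda>i. c * block_span d i * dyad i"
  define g where "g = ln (real c) + ln (real (gap_const d))"
  define h where "h i = (1 / d * (\<sigma> * ln (real i) - ln 2 * sqrt (ln (real i))) - (1 + 1 / d) * ln (real c))
      / ln (g + 12 * real i * ln (real i) + ln (real i))" for i :: nat
  show "h \<longlonglongrightarrow> \<sigma> / d" unfolding h_def using d \<sigma> by real_asymp
  have ge: "i \<le> ?\<nu> i" for i
  proof (cases "i = 0")
    case False
    have "i * 1 \<le> i * fact (i - 1)" by (intro mult_le_mono2) (simp add: fact_ge_1)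
    then have "i \<le> fact i" using False by (simp add: fact_reduce)
    also have "fact i \<le> (fact i :: nat) ^ 12" by (intro self_le_power) (auto simp: fact_ge_1)
    also have "\<dots> \<le> gap_const d * fact i ^ 12" by (simp add: Suc_le_eq)
    also have "\<dots> \<le> c * block_span d i * dyad i" 
      using c by (simp add: block_span_def block_len_def Suc_le_eq)
    finally show ?thesis .
  qed simp
  then show "filterlim ?\<nu> sequentially sequentially"
    by (intro filterlim_at_top_mono[OF filterlim_ident]) auto
  have ev1: "eventually (\<lambda>i :: nat. 1 / d * (\<sigma> * ln (real i) - ln 2 * sqrt (ln (real i))) - (1 + 1 / d) * ln (real c) \<ge> 0) sequentially"
    using d \<sigma> by real_asymp
  have ev2: "eventually (\<lambda>i :: nat. ln (ln (real i)) > 0 \<and> i \<ge> 1) sequentially"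
    by (intro eventually_conj eventually_ge_at_top) real_asymp
  show "\<exists>\<^sub>F i in sequentially. h i \<le> log_ratio d D (?\<nu> i)"
    using frequently_eventually_frequently[OF D eventually_conj[OF ev1 ev2]]
  proof (rule frequently_elim1, elim conjE)
    fix i
    assume pos: "0 < D (?\<nu> i)" and le: "D (?\<nu> i) \<le> c * radius d \<sigma> i"
      and num: "1 / d * (\<sigma> * ln (real i) - ln 2 * sqrt (ln (real i))) - (1 + 1 / d) * ln (real c) \<ge> 0"
      and lnln: "ln (ln (real i)) > 0" and i: "i \<ge> 1"
    have lni: "ln (real i) > 0" using i lnln by (cases "i = 1") auto
    have lnn: "ln (real (?\<nu> i)) = ln (real c) + ln (real (block_span d i)) + ln (real (dyad i))"
      using c by (simp add: ln_mult)
    have lnQ: "ln (real (dyad i)) \<le> ln 2 * sqrt (ln (real i))"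
    proof -
      have "ln (real (dyad i)) = real (nat \<lfloor>sqrt (ln (real i))\<rfloor>) * ln 2" by (simp add: dyad_def ln_realpow)
      also have "\<dots> \<le> sqrt (ln (real i)) * ln 2" using lni by (intro mult_right_mono of_nat_floor) auto
      finally show ?thesis by (simp add: mult.commute)
    qed
    have rp: "radius d \<sigma> i > 0" using i by (intro radius_pos) simp
    have "ln (D (?\<nu> i)) \<le> ln (c * radius d \<sigma> i)" using pos le by (intro ln_mono) auto
    also have "\<dots> = ln (real c) + ln (radius d \<sigma> i)" using c rp by (simp add: ln_mult)
    also have "ln (radius d \<sigma> i) = - (1 / d) * (ln (real (block_span d i)) + \<sigma> * ln (real i))"
      using i by (simp add: radius_def ln_powr ln_div ln_mult add_divide_distrib diff_divide_distrib)
    finally have "(1 / d) * (ln (real (block_span d i)) + \<sigma> * ln (real i)) - ln (real c) \<le> \<bar>ln (D (?\<nu> i))\<bar>" by simp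
    moreover have "1 / d * (\<sigma> * ln (real i) - ln 2 * sqrt (ln (real i))) - (1 + 1 / d) * ln (real c)
       \<le> (1 / d) * (ln (real (block_span d i)) + \<sigma> * ln (real i)) - ln (real c) - 1 / d * ln (real (?\<nu> i))"
    proof -
      have "1 / d * ln (real (dyad i)) \<le> 1 / d * (ln 2 * sqrt (ln (real i)))" using lnQ by (intro mult_left_mono) auto
      then show ?thesis unfolding lnn by (simp add: algebra_simps)
    qed
    ultimately have N: "1 / d * (\<sigma> * ln (real i) - ln 2 * sqrt (ln (real i))) - (1 + 1 / d) * ln (real c)
       \<le> \<bar>ln (D (?\<nu> i))\<bar> - 1 / d * ln (real (?\<nu> i))" by linarith
    have "real i \<le> real (?\<nu> i)" using ge[of i] by (simp only: of_nat_le_iff)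
    then have "ln (real i) \<le> ln (real (?\<nu> i))" using i by (intro ln_mono) simp_all
    then have lo: "0 < ln (ln (real (?\<nu> i)))"
      using lnln lni ln_le_cancel_iff[of "ln (real i)" "ln (real (?\<nu> i))"] by linarith
    have "ln (real (dyad i)) \<le> ln (real i)" using dyad_le[OF i] i by simp
    then have "ln (real (?\<nu> i)) \<le> g + 12 * real i * ln (real i) + ln (real i)"
      unfolding lnn g_def using ln_block_span_le[OF i, of d] by linarith
    then have hi: "ln (ln (real (?\<nu> i))) \<le> ln (g + 12 * real i * ln (real i) + ln (real i))"
      using lni \<open>ln (real i) \<le> ln (real (?\<nu> i))\<close> by (intro ln_mono) auto
    show "h i \<le> log_ratio d D (?\<nu> i)"
      unfolding h_def log_ratio_def using N num lo hi by (intro frac_le) auto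
  qed
qed

section \<open>The recurrence rates\<close>

lemma limsup_orbit_dist_le:
  fixes x y \<alpha> :: "'d::finite torus"
  assumes r: "r \<ge> 1" and p: "p \<ge> 0"
    and nz: "\<And>k. k > 0 \<Longrightarrow> (y - x) + zmul (int k) \<alpha> \<noteq> 0"
    and few: "\<And>q :: nat. few_hits r (p + 1 / real (Suc q)) (\<lambda>k. (y - x) + zmul (int k) \<alpha>)"
  shows "limsup (\<lambda>n. ereal (log_ratio CARD('d) (\<lambda>n. orbit_dist \<alpha> r n x y) n)) \<le> ereal (p / CARD('d))"
proof -
  let ?L = "limsup (\<lambda>n. ereal (log_ratio CARD('d) (\<lambda>n. orbit_dist \<alpha> r n x y) n))"
  have le: "?L \<le> ereal ((p + 1 / real (Suc q)) / CARD('d))" for q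
  proof (rule limsup_log_ratio_le[where B = "real CARD('d)" and r = r])
    show "eventually (\<lambda>n. 0 < orbit_dist \<alpha> r n x y \<and> orbit_dist \<alpha> r n x y \<le> real CARD('d)) sequentially"
      using eventually_ge_at_top[of r]
      by eventually_elim (use orbit_dist_pos[OF r _ nz] orbit_dist_le_CARD[OF r] in auto)
    show "eventually (\<lambda>m. \<forall>n\<in>{2 ^ m..<2 ^ Suc m}. r \<le> n \<longrightarrow>
        dyadic_radius CARD('d) (p + 1 / real (Suc q)) m \<le> orbit_dist \<alpha> r n x y) sequentially"
      using few[of q] unfolding few_hits_def
    proof eventually_elim
      case (elim m)
      show ?case
      proof (intro ballI impI)
        fix n assume "n \<in> {2 ^ m..<2 ^ Suc m}" "r \<le> n"
        then show "dyadic_radius CARD('d) (p + 1 / real (Suc q)) m \<le> orbit_dist \<alpha> r n x y"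
          using elim r by (intro orbit_dist_ge_of_few_hits[where N = "2 ^ Suc m"]) auto
      qed
    qed
  qed (use p in auto)
  have "(\<lambda>q. (p + inverse (real (Suc q))) / CARD('d)) \<longlonglongrightarrow> (p + 0) / CARD('d)"
    by (intro tendsto_intros LIMSEQ_inverse_real_of_nat) simp
  then have "(\<lambda>q. ereal ((p + 1 / real (Suc q)) / CARD('d))) \<longlonglongrightarrow> ereal (p / CARD('d))"
    by (simp add: inverse_eq_divide)
  then show ?thesis by (rule LIMSEQ_le_const) (intro exI allI impI le)
qed

lemma few_hits_mono: "few_hits r p y \<Longrightarrow> r \<le> s \<Longrightarrow> few_hits s p y"
  unfolding few_hits_def by (auto elim: eventually_mono)

lemma limsup_orbit_dist_ge_single:
  fixes x y \<alpha> :: "'d::finite torus"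
  assumes nz: "\<And>k. k > 0 \<Longrightarrow> (y - x) + zmul (int k) \<alpha> \<noteq> 0"
    and hits: "\<exists>\<^sub>F k in sequentially. (y - x) + zmul (int k) \<alpha> \<in> tcube (single_radius CARD('d) k)"
  shows "ereal (1 / CARD('d)) \<le> limsup (\<lambda>n. ereal (log_ratio CARD('d) (\<lambda>n. orbit_dist \<alpha> 1 n x y) n))"
proof (rule limsup_log_ratio_ge_single[where c = "real CARD('d)"])
  show "\<exists>\<^sub>F k in sequentially. 0 < orbit_dist \<alpha> 1 k x y \<and> orbit_dist \<alpha> 1 k x y \<le> real CARD('d) * single_radius CARD('d) k"
    using frequently_eventually_frequently[OF hits eventually_ge_at_top[of 1]]
  proof (rule frequently_elim1)
    fix k :: nat assume k: "(y - x) + zmul (int k) \<alpha> \<in> tcube (single_radius CARD('d) k) \<and> 1 \<le> k"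
    have "orbit_dist \<alpha> 1 k x y \<le> real CARD('d) * single_radius CARD('d) k"
      by (rule orbit_dist_le_of_hits[where T = "{k}"]) (use k in auto)
    moreover have "0 < orbit_dist \<alpha> 1 k x y" using k by (intro orbit_dist_pos nz) auto
    ultimately show "0 < orbit_dist \<alpha> 1 k x y \<and> orbit_dist \<alpha> 1 k x y \<le> real CARD('d) * single_radius CARD('d) k" by blast
  qed
qed auto

text \<open>
  If \<open>b \<alpha>\<close> is close to \<open>0\<close>, a hit at time \<open>a\<close> (with \<open>a = 0\<close> allowed) is repeated at the positive times
  \<open>a + b, \<dots>, a + r b\<close> with a loss of at most a factor \<open>r + 1\<close>.
\<close>

lemma orbit_dist_le_of_progression:
  fixes x y \<alpha> :: "'d::finite torus"
  assumes r: "r \<ge> 1" and a: "(y - x) + zmul (int a) \<alpha> \<in> tcube \<rho>" and b: "zmul (int b) \<alpha> \<in> tcube \<rho>"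
    and ab: "a + b > 0" "b > 0" "a + r * b \<le> n" and \<rho>: "\<rho> \<ge> 0"
  shows "orbit_dist \<alpha> r n x y \<le> real CARD('d) * (real (r + 1) * \<rho>)"
proof (rule orbit_dist_le_of_hits[OF r, where T = "(\<lambda>t. a + t * b) ` {1..r}"])
  show "(\<lambda>t. a + t * b) ` {1..r} \<subseteq> {1..n}"
  proof safe
    fix t assume t: "t \<in> {1..r}"
    then have "t * b \<le> r * b" by simp
    moreover have "t * b > 0" using t ab by simp
    ultimately show "a + t * b \<in> {1..n}" unfolding atLeastAtMost_iff using ab by linarith
  qed
  have "inj_on (\<lambda>t. a + t * b) {1..r}" using ab by (auto simp: inj_on_def)
  then show "r \<le> card ((\<lambda>t. a + t * b) ` {1..r})" by (simp add: card_image)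
  fix k assume "k \<in> (\<lambda>t. a + t * b) ` {1..r}"
  then obtain t where t: "t \<in> {1..r}" "k = a + t * b" by blast
  have "((y - x) + zmul (int a) \<alpha>) + zmul (int t) (zmul (int b) \<alpha>) \<in> tcube (\<rho> + \<bar>of_int (int t)\<bar> * \<rho>)"
    by (intro tcube_add a tcube_zmul b)
  moreover have "\<rho> + \<bar>of_int (int t)\<bar> * \<rho> \<le> real (r + 1) * \<rho>"
  proof -
    have "real t * \<rho> \<le> real r * \<rho>" using t \<rho> by (intro mult_right_mono) auto
    then show ?thesis by (simp add: algebra_simps)
  qed
  moreover have "((y - x) + zmul (int a) \<alpha>) + zmul (int t) (zmul (int b) \<alpha>) = (y - x) + zmul (int k) \<alpha>"
    by (simp add: t(2) zmul_zmul zmul_add_left add.assoc)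
  ultimately show "(y - x) + zmul (int k) \<alpha> \<in> tcube (real (r + 1) * \<rho>)" using tcube_mono by fastforce
qed

lemma limsup_orbit_dist_ge_block:
  fixes x y \<alpha> :: "'d::finite torus"
  assumes r: "r \<ge> 1" and \<sigma>: "\<sigma> > 0"
    and nz: "\<And>k. k > 0 \<Longrightarrow> (y - x) + zmul (int k) \<alpha> \<noteq> 0"
    and hits: "\<exists>\<^sub>F i in sequentially. \<alpha> \<in> close_return \<sigma> i \<and>
      (\<exists>j\<le>2 * block_len i. (y - x) + zmul (int (j * dyad i)) \<alpha> \<in> tcube (radius CARD('d) \<sigma> i))"
  shows "ereal (\<sigma> / CARD('d)) \<le> limsup (\<lambda>n. ereal (log_ratio CARD('d) (\<lambda>n. orbit_dist \<alpha> r n x y) n))"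
proof (rule limsup_log_ratio_ge_block[where c = "CARD('d) * (r + 2)"])
  let ?d = "CARD('d)"
  let ?c = "?d * (r + 2)"
  let ?n = "\<lambda>i. ?c * block_span ?d i * dyad i"
  show "\<exists>\<^sub>F i in sequentially. 0 < orbit_dist \<alpha> r (?n i) x y \<and> orbit_dist \<alpha> r (?n i) x y \<le> real ?c * radius ?d \<sigma> i"
    using frequently_eventually_frequently[OF hits eventually_ge_at_top[of 1]]
  proof (rule frequently_elim1, elim conjE exE)
    fix i j assume i: "\<alpha> \<in> close_return \<sigma> i" "1 \<le> i" and j: "j \<le> 2 * block_len i"
      and hit: "(y - x) + zmul (int (j * dyad i)) \<alpha> \<in> tcube (radius ?d \<sigma> i)"
    let ?\<rho> = "radius ?d \<sigma> i"
    obtain k where k: "k \<in> {1..block_span ?d i}" "zmul (int (k * dyad i)) \<alpha> \<in> tcube ?\<rho>"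
      using i by (auto simp: close_return_def)
    have \<rho>: "?\<rho> > 0" using i by (intro radius_pos) simp
    have "block_len i \<le> block_span ?d i" by (simp add: block_span_def Suc_le_eq)
    moreover have "r * k \<le> r * block_span ?d i" using k by (intro mult_le_mono2) auto
    moreover have "(r + 2) * block_span ?d i = r * block_span ?d i + 2 * block_span ?d i"
      by (rule distrib_right)
    ultimately have "j + r * k \<le> (r + 2) * block_span ?d i" using j by linarith
    also have "\<dots> \<le> ?c * block_span ?d i"
    proof (rule mult_le_mono1)
      have "1 * (r + 2) \<le> ?d * (r + 2)" by (rule mult_le_mono1) (simp add: Suc_le_eq)
      then show "r + 2 \<le> ?c" by simp
    qed
    finally have "(j + r * k) * dyad i \<le> ?n i" by (rule mult_right_mono) simp
    then have n: "j * dyad i + r * (k * dyad i) \<le> ?n i" by (simp add: algebra_simps)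
    have kpos: "k * dyad i > 0" using k by simp
    have "orbit_dist \<alpha> r (?n i) x y \<le> real ?d * (real (r + 1) * ?\<rho>)"
      using kpos by (intro orbit_dist_le_of_progression[OF r hit k(2) _ kpos n]) (use \<rho> in auto)
    also have "\<dots> \<le> real ?c * ?\<rho>"
    proof -
      have "real ?d * real (r + 1) \<le> real ?c" by (simp add: algebra_simps)
      then have "(real ?d * real (r + 1)) * ?\<rho> \<le> real ?c * ?\<rho>" using \<rho> by (intro mult_right_mono) auto
      then show ?thesis by (simp only: mult.assoc)
    qed
    finally have 1: "orbit_dist \<alpha> r (?n i) x y \<le> real ?c * ?\<rho>" .
    have "r * 1 \<le> r * (k * dyad i)" using kpos by (intro mult_le_mono2) linarith
    then have "r \<le> ?n i" using n by linarith
    then show "0 < orbit_dist \<alpha> r (?n i) x y \<and> orbit_dist \<alpha> r (?n i) x y \<le> real ?c * ?\<rho>"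
      using 1 by (intro conjI orbit_dist_pos[OF r _ nz]) auto
  qed
qed (use \<sigma> in auto)

theorem theorem4p7:
  shows "AE \<alpha> in (haar :: 'd::finite torus measure).
    ((AE x in haar. AE y in haar.
        limsup (\<lambda>n. ereal ((\<bar>ln (orbit_dist \<alpha> 1 n x y)\<bar> - 1 / real CARD('d) * ln (real n))
            / ln (ln (real n))))
          = ereal (1 / real CARD('d))) \<and>
     (\<forall>r\<ge>2. AE x in haar. AE y in haar.
        limsup (\<lambda>n. ereal ((\<bar>ln (orbit_dist \<alpha> r n x y)\<bar> - 1 / real CARD('d) * ln (real n))
            / ln (ln (real n))))
          = ereal (1 / (2 * real CARD('d))))) \<and>
    (\<forall>r\<ge>1. \<forall>x.
        limsup (\<lambda>n. ereal ((\<bar>ln (orbit_dist \<alpha> r n x x)\<bar> - 1 / real CARD('d) * ln (real n))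
            / ln (ln (real n))))
          = ereal (1 / real CARD('d)))"
proof -
  have ret: "AE \<alpha> in (haar :: 'd torus measure). \<forall>q :: nat. few_hits 1 (1 + 1 / real (Suc q)) (\<lambda>k. zmul (int k) \<alpha>)"
    unfolding AE_all_countable by (intro allI few_hits_return_AE) simp
  have dbl: "AE \<alpha> in (haar :: 'd torus measure). \<forall>q :: nat. AE w in haar. few_hits 2 (1 / 2 + 1 / real (Suc q)) (\<lambda>k. w + zmul (int k) \<alpha>)"
    unfolding AE_all_countable by (intro allI few_double_hits_AE) simp
  have cls: "AE \<alpha> in (haar :: 'd torus measure). \<not> summable (\<lambda>i. real i powr (1 - 1) * indicator (close_return 1 i) \<alpha>)"
    by (rule close_returns_AE) auto
  show ?thesis
    using ret dbl cls hits_AE single_hits_AE AE_aperiodic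
  proof eventually_elim
    case (elim \<alpha>)
    note ret = elim(1) and dbl = elim(2) and cls = elim(3) and hits = elim(4) and single = elim(5) and aper = elim(6)
    have sgl: "AE w in haar. \<forall>q :: nat. few_hits 1 (1 + 1 / real (Suc q)) (\<lambda>k. w + zmul (int k) \<alpha>)"
      unfolding AE_all_countable by (intro allI few_hits_orbit_AE) simp
    have dbl': "AE w in haar. \<forall>q :: nat. few_hits 2 (1 / 2 + 1 / real (Suc q)) (\<lambda>k. w + zmul (int k) \<alpha>)"
      unfolding AE_all_countable using dbl by blast
    have a1: "AE y in haar. limsup (\<lambda>n. ereal (log_ratio CARD('d) (\<lambda>n. orbit_dist \<alpha> 1 n x y) n)) = ereal (1 / real CARD('d))" for x
      using AE_haar_translate[OF sgl, of x] AE_haar_translate[OF single, of x] AE_haar_translate[OF AE_orbit_nonzero[of \<alpha>], of x]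
    proof eventually_elim
      case (elim y)
      show ?case
      proof (rule antisym)
        show "limsup (\<lambda>n. ereal (log_ratio CARD('d) (\<lambda>n. orbit_dist \<alpha> 1 n x y) n)) \<le> ereal (1 / real CARD('d))"
          by (rule limsup_orbit_dist_le[OF _ _ elim(3)[rule_format] elim(1)[rule_format]]) simp_all
        show "ereal (1 / real CARD('d)) \<le> limsup (\<lambda>n. ereal (log_ratio CARD('d) (\<lambda>n. orbit_dist \<alpha> 1 n x y) n))"
          by (rule limsup_orbit_dist_ge_single[OF elim(3)[rule_format] elim(2)])
      qed
    qed
    have a2: "AE y in haar. limsup (\<lambda>n. ereal (log_ratio CARD('d) (\<lambda>n. orbit_dist \<alpha> r n x y) n)) = ereal (1 / (2 * real CARD('d)))"
      if r: "r \<ge> 2" for r x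
      using AE_haar_translate[OF dbl', of x] AE_haar_translate[OF hits, of x] AE_haar_translate[OF AE_orbit_nonzero[of \<alpha>], of x]
    proof eventually_elim
      case (elim y)
      have "limsup (\<lambda>n. ereal (log_ratio CARD('d) (\<lambda>n. orbit_dist \<alpha> r n x y) n)) \<le> ereal ((1 / 2) / CARD('d))"
        by (rule limsup_orbit_dist_le[OF _ _ elim(3)[rule_format] few_hits_mono[OF elim(1)[rule_format]]])
          (use r in simp_all)
      moreover have "ereal ((1 / 2) / CARD('d)) \<le> limsup (\<lambda>n. ereal (log_ratio CARD('d) (\<lambda>n. orbit_dist \<alpha> r n x y) n))"
      proof (rule limsup_orbit_dist_ge_block)
        show "\<exists>\<^sub>F i in sequentially. \<alpha> \<in> close_return (1 / 2) i \<and>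
          (\<exists>j\<le>2 * block_len i. (y - x) + zmul (int (j * dyad i)) \<alpha> \<in> tcube (radius CARD('d) (1 / 2) i))"
          using frequently_eventually_frequently[OF elim(2) eventually_ge_at_top[of 1]]
        proof (rule frequently_elim1, elim conjE)
          fix i assume i: "\<alpha> \<in> close_return (1 / 2) i" "y - x \<in> hit (1 / 2) \<alpha> i" "1 \<le> i"
          then obtain j where j: "j \<in> window i" "(y - x) + zmul (int (j * dyad i)) \<alpha> \<in> tcube (radius CARD('d) (1 / 2) i / 2)"
            by (auto simp: hit_def)
          have "radius CARD('d) (1 / 2) i / 2 \<le> radius CARD('d) (1 / 2) i"
            using radius_pos[of i "CARD('d)" "1 / 2"] i(3) by simp
          then have "(y - x) + zmul (int (j * dyad i)) \<alpha> \<in> tcube (radius CARD('d) (1 / 2) i)"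
            using j(2) tcube_mono by blast
          moreover have "j \<le> 2 * block_len i" using j(1) by (simp add: window_def)
          ultimately show "\<alpha> \<in> close_return (1 / 2) i \<and>
            (\<exists>j\<le>2 * block_len i. (y - x) + zmul (int (j * dyad i)) \<alpha> \<in> tcube (radius CARD('d) (1 / 2) i))"
            using i(1) by blast
        qed
      qed (use r elim(3) in auto)
      ultimately show ?case by simp
    qed
    have b: "limsup (\<lambda>n. ereal (log_ratio CARD('d) (\<lambda>n. orbit_dist \<alpha> r n x x) n)) = ereal (1 / real CARD('d))"
      if r: "r \<ge> 1" for r x
    proof (rule antisym)
      have "\<exists>\<^sub>F i in sequentially. \<alpha> \<in> close_return 1 i"
        using frequently_mem_if_not_summable[OF cls] by (auto elim!: frequently_elim1)
      then show "ereal (1 / real CARD('d)) \<le> limsup (\<lambda>n. ereal (log_ratio CARD('d) (\<lambda>n. orbit_dist \<alpha> r n x x) n))"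
      proof (intro limsup_orbit_dist_ge_block[OF r], goal_cases)
        case 3
        from frequently_eventually_frequently[OF this eventually_ge_at_top[of 1]] show ?case
        proof (rule frequently_elim1, elim conjE)
          fix i :: nat assume i: "\<alpha> \<in> close_return 1 i" "1 \<le> i"
          \<comment> \<open>For \<open>y = x\<close> the hit at time \<open>0\<close> is automatic.\<close>
          have "0 \<in> (tcube (radius CARD('d) 1 i) :: 'd torus set)"
            using radius_pos[of i "CARD('d)" 1] i(2) unfolding mem_tcube by (intro exI[of _ 0]) (simp add: zero_torus.abs_eq)
          then show "\<alpha> \<in> close_return 1 i \<and>
            (\<exists>j\<le>2 * block_len i. (x - x) + zmul (int (j * dyad i)) \<alpha> \<in> tcube (radius CARD('d) 1 i))"
            using i(1) by (intro conjI exI[of _ 0]) auto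
        qed
      qed (use aper in auto)
      show "limsup (\<lambda>n. ereal (log_ratio CARD('d) (\<lambda>n. orbit_dist \<alpha> r n x x) n)) \<le> ereal (1 / real CARD('d))"
      proof (rule limsup_orbit_dist_le)
        show "(x - x) + zmul (int k) \<alpha> \<noteq> 0" if "k > 0" for k using aper that by simp
        show "few_hits r (1 + 1 / real (Suc q)) (\<lambda>k. (x - x) + zmul (int k) \<alpha>)" for q
          using few_hits_mono[OF ret[rule_format] r] by simp
      qed (use r in simp_all)
    qed
    show ?case
      using a1 a2 b unfolding log_ratio_def by auto
  qed
qed

end
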